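(* Fix $h\ge0$, $D\in\mathbb R$. There exists $\beta'>0$ such that for every $\beta\in(0,\beta')$, $$\nu(T^2)=A_0^2+O(N^{-3/2}),\qquad \nu(S^2)=B_0^2+O(N^{-3/2}),\qquad \nu(ST)=C_0^2+O(N^{-3/2}),$$ with implied constants independent of $N$.
   Context: Fix an integer $\mathcal S\ge1$ and $N\ge2$; $\Sigma_N=\{0,\pm1,\dots,\pm\mathcal S\}^N$. For $\beta>0$, $h\ge0$, $D\in\mathbb R$ and i.i.d. standard Gaussians $(g_{i,j})_{i<j}$, $H_N(\sigma)=\frac{\beta}{\sqrt N}\sum_{i<j}g_{i,j}\sigma_i\sigma_j+D\sum_i\sigma_i^2+h\sum_i\sigma_i$, Gibbs measure $G(\sigma)\propto e^{H_N(\sigma)}$ on $\Sigma_N$; $\langle\cdot\rangle$ is the Gibbs average, $\nu(f)=\mathbb E\langle f\rangle$. $p,q$: for $\eta\sim N(0,1)$, $\langle\phi\rangle_\eta=\sum_s\phi(s)w_\eta(s)/\sum_sw_\eta(s)$, $w_\eta(s)=\exp(\beta\sqrt q\eta s+hs+(D+\frac{\beta^2}{2}(p-q))s^2)$, $s\in\{0,\pm1,\dots,\pm\mathcal S\}$; $(p,q)$ solves $q=\mathbb E\langle s\rangle_\eta^2$, $p=\mathbb E\langle s^2\rangle_\eta$ (unique at high temperature). $T=\frac1N\sum_i\langle\sigma_i\rangle^2-q$, $S=\frac1N\sum_i\langle\sigma_i^2\rangle-p$. Constants: $m_j=\langle s^j\rangle_\eta$, expectations over $\eta$: $A=\mathbb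 E[(m_2-m_1^2)^2]$, $\mathcal D=\mathbb E[m_4-m_2^2]$, $F=\mathbb E[m_2^2-m_1^2m_2]$, $G=\mathbb E[m_1^2(m_2-m_1^2)]$, $\mathcal E=\mathbb E[m_1(m_3-m_1m_2)]$, $I_3=\mathbb E[m_1^4]-q^2$, $I_5=\mathbb E[m_1^2m_2]-pq$, $K_4=\mathbb E[m_2^2]-p^2$; $M_1=1-\beta^2(F-3G)$, $M_2=1-\frac{\beta^2}{2}\mathcal D$, $M_3=1-\beta^2(F-G)$, $M=M_1M_2+\beta^4\mathcal E^2$; $A_2^2=\frac{A}{N(1-\beta^2A)}$, $A_1^2=\frac{GM_2+\frac{\beta^2}{2}\mathcal E^2}{NMM_3}$, $B_1^2=\frac{\mathcal DM_1-2\beta^2\mathcal E^2}{NM}$, $C_1^2=\frac{\mathcal E}{NM}$; $A_0^2=\frac{\beta^2}{M}(\beta^2\mathcal EK_4+M_2I_5)C_1^2+\frac{2\beta^2}{M}(\beta^2\mathcal E(\mathcal E-I_5)+M_2(2G-I_3))A_1^2+\frac{\beta^2}{M}(\beta^2\mathcal EI_5+M_2I_3)A_2^2+\frac{1}{MN}(\beta^2\mathcal EI_5+M_2I_3)$, $B_0^2=\frac{\beta^2}{2M}(M_1K_4-\beta^2\mathcal EI_5)B_1^2+\frac{\beta^2}{M}(M_1(\mathcal E-I_5)-\beta^2\mathcal E(2G-I_3))C_1^2+\frac{1}{MN}(M_1K_4-\beta^2\mathcal EI_5)$, $C_0^2=\frac{\beta^2}{2M}(M_2I_5+\beta^2\mathcal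 EK_4)B_1^2+\frac{\beta^2}{M}(M_2(2G-I_3)+\beta^2\mathcal E(\mathcal E-I_5))C_1^2+\frac{1}{MN}(M_2I_5+\beta^2\mathcal EK_4)$. *)

theory Defs
  imports "HOL-Probability.Probability"
begin

definition spins :: "nat \<Rightarrow> real set" where
  "spins S = real_of_int ` {- int S .. int S}"

definition config :: "nat \<Rightarrow> nat \<Rightarrow> (nat \<Rightarrow> real) set" where
  "config S N = PiE {..<N} (\<lambda>_. spins S)"

definition pairs :: "nat \<Rightarrow> (nat \<times> nat) set" where
  "pairs N = {(i, j). i < j \<and> j < N}"

definition disorder :: "nat \<Rightarrow> (nat \<times> nat \<Rightarrow> real) measure" where
  "disorder N = PiM (pairs N) (\<lambda>_. density lborel std_normal_density)"

definition hamiltonian ::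
  "nat \<Rightarrow> real \<Rightarrow> real \<Rightarrow> real \<Rightarrow> (nat \<times> nat \<Rightarrow> real) \<Rightarrow> (nat \<Rightarrow> real) \<Rightarrow> real" where
  "hamiltonian N \<beta> h D g \<sigma> =
     \<beta> / sqrt (real N) * (\<Sum>(i, j)\<in>pairs N. g (i, j) * \<sigma> i * \<sigma> j)
     + D * (\<Sum>i<N. (\<sigma> i)\<^sup>2) + h * (\<Sum>i<N. \<sigma> i)"

definition gibbs ::
  "nat \<Rightarrow> nat \<Rightarrow> real \<Rightarrow> real \<Rightarrow> real \<Rightarrow> (nat \<times> nat \<Rightarrow> real) \<Rightarrow> ((nat \<Rightarrow> real) \<Rightarrow> real) \<Rightarrow> real" where
  "gibbs S N \<beta> h D g f =
     (\<Sum>\<sigma>\<in>config S N. f \<sigma> * exp (hamiltonian N \<beta> h D g \<sigma>))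
     / (\<Sum>\<sigma>\<in>config S N. exp (hamiltonian N \<beta> h D g \<sigma>))"

definition nu :: "nat \<Rightarrow> ((nat \<times> nat \<Rightarrow> real) \<Rightarrow> real) \<Rightarrow> real" where
  "nu N F = integral\<^sup>L (disorder N) F"

definition Tq :: "nat \<Rightarrow> nat \<Rightarrow> real \<Rightarrow> real \<Rightarrow> real \<Rightarrow> real \<Rightarrow> (nat \<times> nat \<Rightarrow> real) \<Rightarrow> real" where
  "Tq S N \<beta> h D q g = (1 / real N) * (\<Sum>i<N. (gibbs S N \<beta> h D g (\<lambda>\<sigma>. \<sigma> i))\<^sup>2) - q"

definition Sp :: "nat \<Rightarrow> nat \<Rightarrow> real \<Rightarrow> real \<Rightarrow> real \<Rightarrow> real \<Rightarrow> (nat \<times> nat \<Rightarrow> real) \<Rightarrow> real" where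
  "Sp S N \<beta> h D p g = (1 / real N) * (\<Sum>i<N. gibbs S N \<beta> h D g (\<lambda>\<sigma>. (\<sigma> i)\<^sup>2)) - p"

definition wt :: "real \<Rightarrow> real \<Rightarrow> real \<Rightarrow> real \<Rightarrow> real \<Rightarrow> real \<Rightarrow> real \<Rightarrow> real" where
  "wt \<beta> h D p q \<eta> s = exp (\<beta> * sqrt q * \<eta> * s + h * s + (D + \<beta>\<^sup>2 / 2 * (p - q)) * s\<^sup>2)"

definition mom :: "nat \<Rightarrow> real \<Rightarrow> real \<Rightarrow> real \<Rightarrow> real \<Rightarrow> real \<Rightarrow> nat \<Rightarrow> real \<Rightarrow> real" where
  "mom S \<beta> h D p q j \<eta> =
     (\<Sum>s\<in>spins S. s ^ j * wt \<beta> h D p q \<eta> s) / (\<Sum>s\<in>spins S. wt \<beta> h D p q \<eta> s)"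

definition Eeta :: "(real \<Rightarrow> real) \<Rightarrow> real" where
  "Eeta f = integral\<^sup>L lborel (\<lambda>x. std_normal_density x * f x)"

definition is_pq :: "nat \<Rightarrow> real \<Rightarrow> real \<Rightarrow> real \<Rightarrow> real \<Rightarrow> real \<Rightarrow> bool" where
  "is_pq S \<beta> h D p q \<longleftrightarrow>
     q = Eeta (\<lambda>\<eta>. (mom S \<beta> h D p q 1 \<eta>)\<^sup>2) \<and> p = Eeta (mom S \<beta> h D p q 2)"

context
  fixes S :: nat and \<beta> h D p q :: real
begin

definition "m j = mom S \<beta> h D p q j"

definition "cA = Eeta (\<lambda>\<eta>. (m 2 \<eta> - (m 1 \<eta>)\<^sup>2)\<^sup>2)"
definition "cD = Eeta (\<lambda>\<eta>. m 4 \<eta> - (m 2 \<eta>)\<^sup>2)"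
definition "cF = Eeta (\<lambda>\<eta>. (m 2 \<eta>)\<^sup>2 - (m 1 \<eta>)\<^sup>2 * m 2 \<eta>)"
definition "cG = Eeta (\<lambda>\<eta>. (m 1 \<eta>)\<^sup>2 * (m 2 \<eta> - (m 1 \<eta>)\<^sup>2))"
definition "cE = Eeta (\<lambda>\<eta>. m 1 \<eta> * (m 3 \<eta> - m 1 \<eta> * m 2 \<eta>))"
definition "I3 = Eeta (\<lambda>\<eta>. (m 1 \<eta>) ^ 4) - q\<^sup>2"
definition "I5 = Eeta (\<lambda>\<eta>. (m 1 \<eta>)\<^sup>2 * m 2 \<eta>) - p * q"
definition "K4 = Eeta (\<lambda>\<eta>. (m 2 \<eta>)\<^sup>2) - p\<^sup>2"

definition "M1 = 1 - \<beta>\<^sup>2 * (cF - 3 * cG)"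
definition "M2 = 1 - \<beta>\<^sup>2 / 2 * cD"
definition "M3 = 1 - \<beta>\<^sup>2 * (cF - cG)"
definition "MM = M1 * M2 + \<beta> ^ 4 * cE\<^sup>2"

definition "A2sq (N::nat) = cA / (real N * (1 - \<beta>\<^sup>2 * cA))"
definition "A1sq (N::nat) = (cG * M2 + \<beta>\<^sup>2 / 2 * cE\<^sup>2) / (real N * MM * M3)"
definition "B1sq (N::nat) = (cD * M1 - 2 * \<beta>\<^sup>2 * cE\<^sup>2) / (real N * MM)"
definition "C1sq (N::nat) = cE / (real N * MM)"

definition "A0sq (N::nat) =
    \<beta>\<^sup>2 / MM * (\<beta>\<^sup>2 * cE * K4 + M2 * I5) * C1sq N
  + 2 * \<beta>\<^sup>2 / MM * (\<beta>\<^sup>2 * cE * (cE - I5) + M2 * (2 * cG - I3)) * A1sq N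
  + \<beta>\<^sup>2 / MM * (\<beta>\<^sup>2 * cE * I5 + M2 * I3) * A2sq N
  + 1 / (MM * real N) * (\<beta>\<^sup>2 * cE * I5 + M2 * I3)"

definition "B0sq (N::nat) =
    \<beta>\<^sup>2 / (2 * MM) * (M1 * K4 - \<beta>\<^sup>2 * cE * I5) * B1sq N
  + \<beta>\<^sup>2 / MM * (M1 * (cE - I5) - \<beta>\<^sup>2 * cE * (2 * cG - I3)) * C1sq N
  + 1 / (MM * real N) * (M1 * K4 - \<beta>\<^sup>2 * cE * I5)"

definition "C0sq (N::nat) =
    \<beta>\<^sup>2 / (2 * MM) * (M2 * I5 + \<beta>\<^sup>2 * cE * K4) * B1sq N
  + \<beta>\<^sup>2 / MM * (M2 * (2 * cG - I3) + \<beta>\<^sup>2 * cE * (cE - I5)) * C1sq N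
  + 1 / (MM * real N) * (M2 * I5 + \<beta>\<^sup>2 * cE * K4)"

end

end

theory Submission
  imports Defs "HOL-Real_Asymp.Real_Asymp"
begin

text \<open>Cavity method with a single interpolation. For a site \<open>i\<close>, the couplings of \<open>i\<close> are multiplied
  by \<open>sin \<theta>\<close>, and an independent Gaussian field \<open>\<beta> sqrt q cos \<theta>\<close> together with the quadratic term
  \<open>\<beta>\<^sup>2 / 2 (p - q) cos\<^sup>2 \<theta>\<close> acts on \<open>i\<close> instead. At \<open>\<theta> = \<pi>/2\<close> this is the model; at \<open>\<theta> = 0\<close> the
  spin \<open>i\<close> is independent of the others and follows the one-site measure of \<open>(p, q)\<close>. Gaussian
  integration by parts expresses the derivative in \<open>\<theta>\<close> by the centered overlaps without site \<open>i\<close>.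

  Writing a centered overlap as an average over \<open>i\<close> of its one-site summands and expanding each of them
  around \<open>\<theta> = 0\<close> to first order gives, for small \<open>\<beta>\<close>, second and fourth moments of order \<open>1/N\<close> and
  \<open>1/N\<^sup>2\<close>. Expanding to second order gives a linear system for the covariances of the overlaps, up to
  an error \<open>N\<^sup>-\<^sup>3\<^sup>/\<^sup>2\<close>. Up to permutation of the replicas there are seven covariances. The system is a
  contraction for small \<open>\<beta>\<close>, and the constants of the statement solve it exactly. Working at every
  site \<open>i\<close> makes the symmetry between the sites unnecessary.\<close>

section \<open>Gaussian integration by parts\<close>

text \<open>The weights sin and cos are smooth up to both ends, and every Gaussian covariance
  changes with the common factor sin cos. The derivative is therefore sin cos beta^2 times the
  average of a functional \<open>L\<close> that is free of the angle, and integration over the angle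
  yields the factor beta^2/2. The obstacle is that each derivative brings two new replicas, so the
  hierarchy never closes. It is cut off by comparing averages anywhere on the path with those of the
  model itself, where moment bounds are available. The centered summand of one site has mean zero at
  the decoupled end: this is exactly the pair of fixed point equations for p and q, and it kills the
  zeroth order whenever the other factor ignores the site. The error N^(-3/2) is a third absolute
  moment, interpolated between the second and the fourth. T^2, S^2 and ST are covariances of
  overlaps on disjoint replicas (four, two and three of them), because replicas are independent
  given the disorder; their equations involve overlaps sharing replicas, so all seven covariances
  are treated together.\<close>

lemma std_normal_density_DERIV:
  "(std_normal_density has_real_derivative - x * std_normal_density x) (at x)"
  unfolding std_normal_density_def
  by (rule derivative_eq_intros refl | simp)+

lemma std_normal_density_tendsto_0:
  "(std_normal_density \<longlongrightarrow> 0) at_top" "(std_normal_density \<longlongrightarrow> 0) at_bot"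
proof -
  have "((\<lambda>x::real. exp (- x\<^sup>2 / 2)) \<longlongrightarrow> 0) at_top"
    by real_asymp
  then show "(std_normal_density \<longlongrightarrow> 0) at_top"
    unfolding std_normal_density_def by (auto intro: tendsto_eq_intros)
  then have "((\<lambda>x. std_normal_density (- x)) \<longlongrightarrow> 0) at_bot"
    by (rule filterlim_compose[OF _ filterlim_uminus_at_top_at_bot])
  then show "(std_normal_density \<longlongrightarrow> 0) at_bot"
    unfolding std_normal_density_def by simp
qed

lemma integral_std_normal:
  fixes f :: "real \<Rightarrow> real"
  assumes [measurable]: "f \<in> borel_measurable borel"
  shows "integral\<^sup>L std_normal_distribution f = (\<integral>x. std_normal_density x * f x \<partial>lborel)"
  by (subst integral_density) (auto simp: normal_density_nonneg)

lemma integrable_std_normal_ident: "integrable std_normal_distribution (\<lambda>x::real. x)"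
  using integrable_std_normal_moment[of 1]
  by (subst integrable_density) (auto simp: normal_density_nonneg)

text \<open>The product of the density and \<open>f\<close> vanishes at both infinities because
  \<open>f\<close> is bounded, so the integral of its derivative over the line is zero; the
  derivative of the density supplies the factor -x.\<close>

lemma gaussian_ibp_1:
  fixes f f' :: "real \<Rightarrow> real"
  assumes f: "\<And>x. (f has_real_derivative f' x) (at x)"
    and f': "continuous_on UNIV f'"
    and B: "\<And>x. \<bar>f x\<bar> \<le> B" "\<And>x. \<bar>f' x\<bar> \<le> B"
  shows "(\<integral>x. x * f x \<partial>std_normal_distribution) = (\<integral>x. f' x \<partial>std_normal_distribution)"
proof -
  have cf: "continuous_on UNIV f"
    using f by (meson DERIV_isCont continuous_at_imp_continuous_on)
  have [measurable]: "f \<in> borel_measurable borel" "f' \<in> borel_measurable borel"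
    using cf f' borel_measurable_continuous_onI by blast+
  let ?d = "std_normal_density"
  have i0: "integrable lborel ?d"
    using integrable_std_normal_moment[of 0] by simp
  have i1: "integrable lborel (\<lambda>x. ?d x * f' x)"
    by (rule Bochner_Integration.integrable_bound[OF integrable_mult_right[OF i0, of B]])
       (use B in \<open>auto simp: abs_mult normal_density_nonneg mult.commute intro!: mult_right_mono AE_I2 intro: order_trans[OF _ abs_ge_self]\<close>)
  have i2: "integrable lborel (\<lambda>x. ?d x * (x * f x))"
  proof (rule Bochner_Integration.integrable_bound[OF integrable_mult_right[OF integrable_std_normal_moment_abs[of 1], of B]])
    show "AE x in lborel. norm (?d x * (x * f x)) \<le> norm (B * (?d x * \<bar>x\<bar> ^ 1))"
    proof (rule AE_I2)
      fix x
      have "\<bar>?d x * x\<bar> * \<bar>f x\<bar> \<le> \<bar>?d x * x\<bar> * B" by (rule mult_left_mono) (use B in auto)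
      then show "norm (?d x * (x * f x)) \<le> norm (B * (?d x * \<bar>x\<bar> ^ 1))"
        using abs_ge_self[of B] B(1)[of x] by (simp add: abs_mult mult_ac normal_density_nonneg)
    qed
  qed simp
  define F where "F x = ?d x * f x" for x
  define G where "G x = ?d x * f' x - ?d x * (x * f x)" for x
  have FG: "(F has_real_derivative G x) (at x)" for x
    unfolding F_def[abs_def] G_def
    by (rule derivative_eq_intros std_normal_density_DERIV f refl)+ (simp add: algebra_simps)
  have cG: "continuous_on UNIV G"
    unfolding G_def[abs_def] std_normal_density_def by (intro continuous_intros cf f') auto
  have lim: "(F \<longlongrightarrow> 0) Fl" if "(?d \<longlongrightarrow> 0) Fl" for Fl
  proof (rule Lim_null_comparison[of _ "\<lambda>x. ?d x * B"])
    show "\<forall>\<^sub>F x in Fl. norm (F x) \<le> ?d x * B"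
      unfolding F_def by (intro always_eventually) (auto simp: abs_mult normal_density_nonneg B mult_left_mono)
    show "((\<lambda>x. ?d x * B) \<longlongrightarrow> 0) Fl" using tendsto_mult_right[OF that, of B] by simp
  qed
  have iG: "integrable lborel G" unfolding G_def[abs_def] using i1 i2 by auto
  have "(LBINT x=-\<infinity>..\<infinity>. G x) = 0 - 0"
  proof (rule interval_integral_FTC_integrable[where F=F])
    show "(F has_vector_derivative G x) (at x)" for x
      using FG[of x] by (simp add: has_real_derivative_iff_has_vector_derivative)
    show "isCont G x" for x using cG by (simp add: continuous_on_eq_continuous_at)
    show "set_integrable lborel (einterval (-\<infinity>) \<infinity>) G"
      using iG by (simp add: set_integrable_def)
    show "((F \<circ> real_of_ereal) \<longlongrightarrow> 0) (at_right (- \<infinity>))" "((F \<circ> real_of_ereal) \<longlongrightarrow> 0) (at_left \<infinity>)"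
      unfolding ereal_tendsto_simps using lim std_normal_density_tendsto_0 by auto
  qed auto
  then have "integral\<^sup>L lborel G = 0"
    by (simp add: interval_integral_to_infinity_eq interval_lebesgue_integral_def set_lebesgue_integral_def)
  then show ?thesis
    unfolding G_def using i1 i2
    by (subst (1 2) integral_std_normal) auto
qed

text \<open>By the mean value inequality the difference quotients are bounded by \<open>B\<close>
  uniformly in the increment, so dominated convergence applies along every sequence tending to
  \<open>t\<close>.\<close>

lemma DERIV_integral_dominated:
  fixes F F' :: "real \<Rightarrow> 'a \<Rightarrow> real"
  assumes F: "\<And>t w. w \<in> space M \<Longrightarrow> ((\<lambda>t. F t w) has_real_derivative F' t w) (at t)"
    and int: "\<And>t. integrable M (F t)"
    and meas: "\<And>t. F' t \<in> borel_measurable M"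
    and bd: "\<And>t w. w \<in> space M \<Longrightarrow> \<bar>F' t w\<bar> \<le> B w" and B: "integrable M B"
  shows "((\<lambda>t. integral\<^sup>L M (F t)) has_real_derivative integral\<^sup>L M (F' t)) (at t)"
  unfolding has_field_derivative_iff tendsto_at_iff_sequentially comp_def
proof (intro allI impI)
  fix X :: "nat \<Rightarrow> real"
  assume X: "\<forall>i. X i \<in> UNIV - {t}" and lim: "X \<longlonglongrightarrow> t"
  let ?q = "\<lambda>i w. (F (X i) w - F t w) / (X i - t)"
  have "(\<lambda>i. integral\<^sup>L M (?q i)) \<longlonglongrightarrow> integral\<^sup>L M (F' t)"
  proof (rule integral_dominated_convergence[where w=B])
    show "AE w in M. (\<lambda>i. ?q i w) \<longlonglongrightarrow> F' t w"
    proof (rule AE_I2)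
      fix w assume "w \<in> space M"
      from F[OF this, of t] show "(\<lambda>i. ?q i w) \<longlonglongrightarrow> F' t w"
        unfolding has_field_derivative_iff tendsto_at_iff_sequentially comp_def using X lim by auto
    qed
    show "AE w in M. norm (?q i w) \<le> B w" for i
    proof (rule AE_I2)
      fix w assume w: "w \<in> space M"
      have "\<bar>F (X i) w - F t w\<bar> \<le> B w * \<bar>X i - t\<bar>"
        using field_differentiable_bound[of UNIV "\<lambda>t. F t w" "\<lambda>t. F' t w" "B w" "X i" t] F[OF w] bd[OF w]
        by (auto simp: has_field_derivative_at_within)
      moreover have "X i \<noteq> t" using X by auto
      ultimately show "norm (?q i w) \<le> B w" by (simp add: pos_divide_le_eq)
    qed
  qed (use B int meas in auto)
  moreover have q: "integral\<^sup>L M (?q i) = (integral\<^sup>L M (F (X i)) - integral\<^sup>L M (F t)) / (X i - t)" for i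
    unfolding integral_divide_zero using int by simp
  ultimately show "(\<lambda>i. (integral\<^sup>L M (F (X i)) - integral\<^sup>L M (F t)) / (X i - t)) \<longlonglongrightarrow> integral\<^sup>L M (F' t)"
    by (simp only: q)
qed

text \<open>The same product measure as \<open>disorder\<close>, but over an arbitrary index set:
  the interpolation needs one Gaussian coordinate more than the couplings.\<close>

definition gauss :: "'k set \<Rightarrow> ('k \<Rightarrow> real) measure" where
  "gauss K = PiM K (\<lambda>_. density lborel std_normal_density)"

interpretation gaussP: product_prob_space "\<lambda>_. std_normal_distribution" K for K
  by (simp add: product_prob_space_def product_prob_space_axioms_def product_sigma_finite_def
      prob_space_normal_density prob_space.prob_space prob_space_imp_sigma_finite)

lemma prob_space_gauss: "prob_space (gauss K)"
  unfolding gauss_def by (intro prob_space_PiM prob_space_normal_density) simp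

lemma sets_gauss[measurable_cong]: "sets (gauss K) = sets (PiM K (\<lambda>_. borel))"
  unfolding gauss_def by (intro sets_PiM_cong) auto

lemma integrable_gauss_component:
  assumes "k \<in> K" shows "integrable (gauss K) (\<lambda>g. g k)"
proof -
  have "integrable (distr (gauss K) std_normal_distribution (\<lambda>g. g k)) (\<lambda>x. x)"
    unfolding gauss_def
    using distr_PiM_component[OF _ assms, of "\<lambda>_. std_normal_distribution"]
      integrable_std_normal_ident by (simp add: prob_space_normal_density)
  then show ?thesis
    using assms by (subst (asm) integrable_distr_eq) (auto simp: gauss_def)
qed

lemma integrable_gauss_bounded:
  fixes F :: "_ \<Rightarrow> real"
  assumes "F \<in> borel_measurable (gauss K)" "\<And>g. g \<in> space (gauss K) \<Longrightarrow> \<bar>F g\<bar> \<le> B"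
  shows "integrable (gauss K) F"
  using prob_space.finite_measure[OF prob_space_gauss] assms
  by (intro finite_measure.integrable_const_bound[where B=B]) auto

lemma integrable_gauss_component_mult:
  fixes F :: "_ \<Rightarrow> real"
  assumes "k \<in> K" "F \<in> borel_measurable (gauss K)" "\<And>g. g \<in> space (gauss K) \<Longrightarrow> \<bar>F g\<bar> \<le> B"
  shows "integrable (gauss K) (\<lambda>g. g k * F g)"
proof (rule Bochner_Integration.integrable_bound[OF integrable_mult_left[OF integrable_gauss_component[OF assms(1)], of B]])
  show "AE g in gauss K. norm (g k * F g) \<le> norm (g k * B)"
  proof (rule AE_I2)
    fix g assume "g \<in> space (gauss K)"
    from assms(3)[OF this] show "norm (g k * F g) \<le> norm (g k * B)"
      by (simp add: abs_mult mult_left_mono)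
  qed
qed (use assms in measurable)

lemma gauss_integral_insert:
  fixes F :: "_ \<Rightarrow> real"
  assumes "finite K" "k \<notin> K" "integrable (gauss (insert k K)) F"
  shows "integral\<^sup>L (gauss (insert k K)) F = (\<integral>g. (\<integral>y. F (g(k := y)) \<partial>std_normal_distribution) \<partial>gauss K)"
  using gaussP.product_integral_insert[of K k F] assms unfolding gauss_def by simp

text \<open>Fubini isolates coordinate \<open>k\<close>, and the one-dimensional formula applies for
  each value of the others.\<close>

lemma gaussian_ibp:
  fixes F F' :: "_ \<Rightarrow> real"
  assumes K: "finite K" "k \<in> K"
    and m: "F \<in> borel_measurable (gauss K)" "F' \<in> borel_measurable (gauss K)"
    and F: "\<And>g x. ((\<lambda>x. F (g(k := x))) has_real_derivative F' (g(k := x))) (at x)"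
    and F': "\<And>g. continuous_on UNIV (\<lambda>x. F' (g(k := x)))"
    and B: "\<And>g. \<bar>F g\<bar> \<le> B" "\<And>g. \<bar>F' g\<bar> \<le> B"
  shows "(\<integral>g. g k * F g \<partial>gauss K) = (\<integral>g. F' g \<partial>gauss K)"
proof -
  define K' where "K' = K - {k}"
  have KK: "K = insert k K'" "k \<notin> K'" "finite K'" using K by (auto simp: K'_def)
  have "(\<integral>g. g k * F g \<partial>gauss K) = (\<integral>g. (\<integral>y. y * F (g(k := y)) \<partial>std_normal_distribution) \<partial>gauss K')"
    using gauss_integral_insert[OF KK(3,2), of "\<lambda>g. g k * F g"]
      integrable_gauss_component_mult[OF K(2) m(1) B(1)] KK(1) by simp
  also have "\<dots> = (\<integral>g. (\<integral>y. F' (g(k := y)) \<partial>std_normal_distribution) \<partial>gauss K')"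
    by (intro Bochner_Integration.integral_cong refl gaussian_ibp_1[where B=B] F F' B)
  also have "\<dots> = (\<integral>g. F' g \<partial>gauss K)"
    using gauss_integral_insert[OF KK(3,2), of F'] integrable_gauss_bounded[OF m(2) B(2)] KK(1) by simp
  finally show ?thesis .
qed

section \<open>Replica averages of finite Gibbs measures\<close>

definition softmax :: "'c set \<Rightarrow> ('c \<Rightarrow> real) \<Rightarrow> 'c \<Rightarrow> real" where
  "softmax \<Omega> H \<sigma> = exp (H \<sigma>) / (\<Sum>\<tau>\<in>\<Omega>. exp (H \<tau>))"

definition rep :: "'c set \<Rightarrow> ('c \<Rightarrow> real) \<Rightarrow> nat \<Rightarrow> ((nat \<Rightarrow> 'c) \<Rightarrow> real) \<Rightarrow> real" where
  "rep \<Omega> p n f = (\<Sum>s\<in>PiE {..<n} (\<lambda>_. \<Omega>). (\<Prod>a<n. p (s a)) * f s)"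

definition prb :: "'c set \<Rightarrow> ('c \<Rightarrow> real) \<Rightarrow> bool" where
  "prb \<Omega> p \<longleftrightarrow> finite \<Omega> \<and> (\<forall>\<sigma>\<in>\<Omega>. 0 \<le> p \<sigma>) \<and> sum p \<Omega> = 1"

text \<open>Replica functions take arguments indexed by all of nat. \<open>dep n\<close> marks those
  that read only the replicas below \<open>n\<close>; then one fixed number of replicas can serve
  for all averages (\<open>rep_dep\<close>), and replica \<open>n\<close> is fresh.\<close>

definition dep :: "nat \<Rightarrow> ((nat \<Rightarrow> 'c) \<Rightarrow> real) \<Rightarrow> bool" where
  "dep n f \<longleftrightarrow> (\<forall>s t. (\<forall>a<n. s a = t a) \<longrightarrow> f s = f t)"

text \<open>Differentiating a normalised average of a function of \<open>n\<close> replicas adds one replica, whose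
  weight \<open>- n\<close> comes from the partition function.\<close>

definition coef :: "nat \<Rightarrow> nat \<Rightarrow> real" where
  "coef n a = (if a < n then 1 else if a = n then - real n else 0)"

lemma depI: "(\<And>s t. (\<And>a. a < n \<Longrightarrow> s a = t a) \<Longrightarrow> f s = f t) \<Longrightarrow> dep n f"
  unfolding dep_def by blast

lemma depD: "dep n f \<Longrightarrow> (\<And>a. a < n \<Longrightarrow> s a = t a) \<Longrightarrow> f s = f t"
  unfolding dep_def by blast

lemma dep_mono: "dep n f \<Longrightarrow> n \<le> l \<Longrightarrow> dep l f"
  by (rule depI, erule depD) auto

lemma dep_const: "dep n (\<lambda>_. c)"
  unfolding dep_def by blast

lemma dep_comp: "a < n \<Longrightarrow> dep n (\<lambda>s. y (s a))"
  by (rule depI) simp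

lemma dep_map2:
  assumes "dep n f" "dep n g" shows "dep n (\<lambda>s. h (f s) (g s))"
proof (rule depI)
  fix s t :: "nat \<Rightarrow> 'a" assume e: "\<And>a. a < n \<Longrightarrow> s a = t a"
  from depD[OF assms(1) e] depD[OF assms(2) e] show "h (f s) (g s) = h (f t) (g t)" by simp
qed

lemma dep_map: "dep n f \<Longrightarrow> dep n (\<lambda>s. h (f s))"
  by (rule dep_map2[where h="\<lambda>x y. h x"])

lemmas dep_add = dep_map2[where h="(+)"]
lemmas dep_diff = dep_map2[where h="(-)"]
lemmas dep_mult = dep_map2[where h="(*)"]
lemmas dep_abs = dep_map[where h=abs]
lemmas dep_power = dep_map[where h="\<lambda>x. x ^ k" for k]
lemmas dep_divide = dep_map[where h="\<lambda>x. x / c" for c]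

lemma dep_sum:
  assumes "\<And>i. i \<in> I \<Longrightarrow> dep n (f i)" shows "dep n (\<lambda>s. \<Sum>i\<in>I. f i s)"
  by (rule depI, rule sum.cong[OF refl], rule depD[OF assms])

lemmas dep_intros = dep_const dep_comp dep_add dep_diff dep_mult dep_abs dep_power dep_divide dep_sum

lemma softmax_prb:
  assumes "finite \<Omega>" "\<Omega> \<noteq> {}" shows "prb \<Omega> (softmax \<Omega> H)"
proof -
  have "0 < (\<Sum>\<tau>\<in>\<Omega>. exp (H \<tau>))" by (intro sum_pos assms) auto
  then show ?thesis
    unfolding prb_def softmax_def sum_divide_distrib[symmetric] using assms by (simp add: less_imp_le)
qed

lemma rep_cong:
  "(\<And>s. s \<in> PiE {..<n} (\<lambda>_. \<Omega>) \<Longrightarrow> f s = f' s) \<Longrightarrow> (\<And>\<sigma>. \<sigma> \<in> \<Omega> \<Longrightarrow> p \<sigma> = p' \<sigma>)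
    \<Longrightarrow> rep \<Omega> p n f = rep \<Omega> p' n f'"
  unfolding rep_def by (intro sum.cong refl arg_cong2[where f="(*)"] prod.cong) (auto simp: PiE_iff)

lemma rep_add: "rep \<Omega> p n (\<lambda>s. f s + f' s) = rep \<Omega> p n f + rep \<Omega> p n f'"
  unfolding rep_def by (simp add: distrib_left sum.distrib)

lemma rep_diff: "rep \<Omega> p n (\<lambda>s. f s - f' s) = rep \<Omega> p n f - rep \<Omega> p n f'"
  unfolding rep_def by (simp add: right_diff_distrib sum_subtractf)

lemma rep_cmult: "rep \<Omega> p n (\<lambda>s. c * f s) = c * rep \<Omega> p n f"
  unfolding rep_def by (simp add: sum_distrib_left mult_ac)

lemma rep_sum: "rep \<Omega> p n (\<lambda>s. \<Sum>i\<in>I. f i s) = (\<Sum>i\<in>I. rep \<Omega> p n (f i))"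
  unfolding rep_def by (subst sum.swap) (simp add: sum_distrib_left)

lemma rep_Suc: "rep \<Omega> p (Suc n) f = rep \<Omega> p n (\<lambda>s. \<Sum>\<tau>\<in>\<Omega>. p \<tau> * f (s(n := \<tau>)))"
proof -
  have "rep \<Omega> p (Suc n) f
      = (\<Sum>(y, g)\<in>\<Omega> \<times> PiE {..<n} (\<lambda>_. \<Omega>). (\<Prod>a<Suc n. p ((g(n := y)) a)) * f (g(n := y)))"
    unfolding rep_def lessThan_Suc PiE_insert_eq
    by (subst sum.reindex[OF inj_combinator]) (auto simp: case_prod_unfold)
  also have "\<dots> = (\<Sum>y\<in>\<Omega>. \<Sum>g\<in>PiE {..<n} (\<lambda>_. \<Omega>). (\<Prod>a<Suc n. p ((g(n := y)) a)) * f (g(n := y)))"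
    by (simp add: sum.cartesian_product)
  also have "\<dots> = (\<Sum>g\<in>PiE {..<n} (\<lambda>_. \<Omega>). \<Sum>y\<in>\<Omega>. (\<Prod>a<Suc n. p ((g(n := y)) a)) * f (g(n := y)))"
    by (rule sum.swap)
  also have "\<dots> = rep \<Omega> p n (\<lambda>s. \<Sum>\<tau>\<in>\<Omega>. p \<tau> * f (s(n := \<tau>)))"
    unfolding rep_def by (simp add: sum_distrib_left mult_ac)
  finally show ?thesis .
qed

lemma rep_dep:
  assumes p: "prb \<Omega> p" and f: "dep n f" and nl: "n \<le> l"
  shows "rep \<Omega> p l f = rep \<Omega> p n f"
  using nl
proof (induction rule: dec_induct)
  case (step k)
  have "f (s(k := \<tau>)) = f s" for s \<tau>
    by (rule depD[OF f]) (use step in auto)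
  then show ?case using step p
    by (simp add: rep_Suc prb_def flip: sum_distrib_right)
qed simp

text \<open>Replica \<open>n\<close> is not read by \<open>f\<close>, hence independent of it. Read
  from right to left, this turns the product of an average and a Gibbs mean into a single replica
  average.\<close>

lemma rep_mult_next:
  assumes p: "prb \<Omega> p" and f: "dep n f" and nl: "n < l"
  shows "rep \<Omega> p l (\<lambda>s. f s * y (s n)) = rep \<Omega> p l f * (\<Sum>\<tau>\<in>\<Omega>. p \<tau> * y \<tau>)"
proof -
  have "rep \<Omega> p l (\<lambda>s. f s * y (s n)) = rep \<Omega> p (Suc n) (\<lambda>s. f s * y (s n))"
    using nl by (intro rep_dep[OF p] dep_intros) (auto intro: dep_mono[OF f])
  also have "\<dots> = rep \<Omega> p n (\<lambda>s. (\<Sum>\<tau>\<in>\<Omega>. p \<tau> * y \<tau>) * f s)"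
  proof -
    have "f (s(n := \<tau>)) = f s" for s \<tau> by (rule depD[OF f]) auto
    then show ?thesis by (simp add: rep_Suc sum_distrib_left sum_distrib_right mult_ac)
  qed
  also have "\<dots> = (\<Sum>\<tau>\<in>\<Omega>. p \<tau> * y \<tau>) * rep \<Omega> p l f"
    using rep_dep[OF p f, of l] nl by (simp add: rep_cmult)
  finally show ?thesis by simp
qed

lemma rep_mono:
  assumes "prb \<Omega> p" "\<And>s. s \<in> PiE {..<n} (\<lambda>_. \<Omega>) \<Longrightarrow> f s \<le> f' s"
  shows "rep \<Omega> p n f \<le> rep \<Omega> p n f'"
  unfolding rep_def
  by (intro sum_mono mult_left_mono assms prod_nonneg) (use assms(1) in \<open>auto simp: prb_def PiE_iff\<close>)

lemma rep_abs_le: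
  assumes "prb \<Omega> p" shows "\<bar>rep \<Omega> p n f\<bar> \<le> rep \<Omega> p n (\<lambda>s. \<bar>f s\<bar>)"
proof -
  have "0 \<le> (\<Prod>a<n. p (s a))" if "s \<in> PiE {..<n} (\<lambda>_. \<Omega>)" for s
    using that assms by (intro prod_nonneg) (auto simp: prb_def PiE_iff)
  then show ?thesis
    unfolding rep_def by (intro order_trans[OF sum_abs] sum_mono) (auto simp: abs_mult)
qed

lemma rep_const: "prb \<Omega> p \<Longrightarrow> rep \<Omega> p n (\<lambda>_. c) = c"
  using rep_dep[OF _ dep_const, of \<Omega> p 0 n c] by (simp add: rep_def)

lemma rep_bounded:
  assumes "prb \<Omega> p" shows "\<bar>rep \<Omega> p n f\<bar> \<le> (\<Sum>s\<in>PiE {..<n} (\<lambda>_. \<Omega>). \<bar>f s\<bar>)"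
proof -
  have fin: "finite (PiE {..<n} (\<lambda>_. \<Omega>))"
    using assms by (auto simp: prb_def intro!: finite_PiE)
  have "\<bar>rep \<Omega> p n f\<bar> \<le> rep \<Omega> p n (\<lambda>s. \<bar>f s\<bar>)" by (rule rep_abs_le[OF assms])
  also have "\<dots> \<le> rep \<Omega> p n (\<lambda>_. \<Sum>s\<in>PiE {..<n} (\<lambda>_. \<Omega>). \<bar>f s\<bar>)"
    by (intro rep_mono assms member_le_sum fin) auto
  also have "\<dots> = (\<Sum>s\<in>PiE {..<n} (\<lambda>_. \<Omega>). \<bar>f s\<bar>)" by (rule rep_const[OF assms])
  finally show ?thesis .
qed

lemma rep_prod:
  assumes "finite \<Omega>"
  shows "rep \<Omega> p n (\<lambda>s. \<Prod>a<n. \<phi> a (s a)) = (\<Prod>a<n. \<Sum>\<tau>\<in>\<Omega>. p \<tau> * \<phi> a \<tau>)"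
  unfolding rep_def
  by (subst prod_sum_PiE) (auto simp: assms prod.distrib)

lemma rep_permute:
  assumes \<pi>: "\<pi> permutes {..<n}"
  shows "rep \<Omega> p n (\<lambda>s. f (s \<circ> \<pi>)) = rep \<Omega> p n f"
  unfolding rep_def
proof (rule sum.reindex_bij_witness[where i="\<lambda>s. s \<circ> inv \<pi>" and j="\<lambda>s. s \<circ> \<pi>"])
  have i\<pi>: "inv \<pi> permutes {..<n}" by (rule permutes_inv[OF \<pi>])
  have E: "s \<circ> \<rho> \<in> PiE {..<n} (\<lambda>_. \<Omega>)" if "s \<in> PiE {..<n} (\<lambda>_. \<Omega>)" "\<rho> permutes {..<n}" for s \<rho>
    using that permutes_in_image[OF that(2)] permutes_not_in[OF that(2)]
    by (auto simp: PiE_iff extensional_def)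
  show "(s \<circ> \<pi>) \<circ> inv \<pi> = s" "(s \<circ> inv \<pi>) \<circ> \<pi> = s" for s :: "nat \<Rightarrow> 'a"
    using permutes_inv_o[OF \<pi>] by (simp_all add: comp_assoc)
  show "s \<in> PiE {..<n} (\<lambda>_. \<Omega>) \<Longrightarrow> s \<circ> \<pi> \<in> PiE {..<n} (\<lambda>_. \<Omega>)"
    "s \<in> PiE {..<n} (\<lambda>_. \<Omega>) \<Longrightarrow> s \<circ> inv \<pi> \<in> PiE {..<n} (\<lambda>_. \<Omega>)" for s
    using E \<pi> i\<pi> by auto
  show "(\<Prod>a<n. p ((s \<circ> \<pi>) a)) * f (s \<circ> \<pi>) = (\<Prod>a<n. p (s a)) * f (s \<circ> \<pi>)" for s
    using prod.permute[OF \<pi>, of "\<lambda>a. p (s a)"] by (simp add: comp_def)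
qed

lemma softmax_DERIV:
  assumes "finite \<Omega>" "\<Omega> \<noteq> {}" and H: "\<And>\<sigma>. \<sigma> \<in> \<Omega> \<Longrightarrow> ((\<lambda>u. H u \<sigma>) has_real_derivative H' \<sigma>) (at u)"
    and \<sigma>: "\<sigma> \<in> \<Omega>"
  shows "((\<lambda>u. softmax \<Omega> (H u) \<sigma>) has_real_derivative
     softmax \<Omega> (H u) \<sigma> * (H' \<sigma> - (\<Sum>\<tau>\<in>\<Omega>. softmax \<Omega> (H u) \<tau> * H' \<tau>))) (at u)"
proof -
  define Z where "Z u = (\<Sum>\<tau>\<in>\<Omega>. exp (H u \<tau>))" for u
  have Z: "Z u > 0" for u unfolding Z_def using assms by (intro sum_pos) auto
  have dZ: "(Z has_real_derivative (\<Sum>\<tau>\<in>\<Omega>. exp (H u \<tau>) * H' \<tau>)) (at u)"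
    unfolding Z_def[abs_def] by (intro DERIV_sum DERIV_fun_exp H)
  have "((\<lambda>u. exp (H u \<sigma>) / Z u) has_real_derivative
     (exp (H u \<sigma>) * H' \<sigma> * Z u - exp (H u \<sigma>) * (\<Sum>\<tau>\<in>\<Omega>. exp (H u \<tau>) * H' \<tau>)) / (Z u * Z u)) (at u)"
    by (intro DERIV_divide DERIV_fun_exp H dZ \<sigma>) (use Z[of u] in auto)
  moreover have "(\<Sum>\<tau>\<in>\<Omega>. exp (H u \<tau>) / Z u * H' \<tau>) = (\<Sum>\<tau>\<in>\<Omega>. exp (H u \<tau>) * H' \<tau>) / Z u"
    by (simp add: sum_divide_distrib)
  ultimately show ?thesis
    unfolding softmax_def Z_def[symmetric]
    by (rule_tac DERIV_cong) (use Z[of u] in \<open>auto simp: field_simps\<close>)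
qed

text \<open>Product rule over the replicas: the logarithmic derivative of each weight is
  \<open>H'\<close> at its replica minus the Gibbs mean of \<open>H'\<close>.\<close>

lemma rep_DERIV_all:
  assumes "finite \<Omega>" "\<Omega> \<noteq> {}" and H: "\<And>\<sigma>. \<sigma> \<in> \<Omega> \<Longrightarrow> ((\<lambda>u. H u \<sigma>) has_real_derivative H' \<sigma>) (at u)"
  shows "((\<lambda>u. rep \<Omega> (softmax \<Omega> (H u)) n f) has_real_derivative
     rep \<Omega> (softmax \<Omega> (H u)) n (\<lambda>s. f s * (\<Sum>a<n. H' (s a) - (\<Sum>\<tau>\<in>\<Omega>. softmax \<Omega> (H u) \<tau> * H' \<tau>)))) (at u)"
proof -
  define p where "p u = softmax \<Omega> (H u)" for u
  define A where "A = (\<Sum>\<tau>\<in>\<Omega>. p u \<tau> * H' \<tau>)"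
  have "((\<lambda>u. (\<Prod>a<k. p u (s a)) * f s) has_real_derivative
      (\<Prod>a<k. p u (s a)) * (f s * (\<Sum>a<k. H' (s a) - A))) (at u)"
    if "s \<in> PiE {..<n} (\<lambda>_. \<Omega>)" "k \<le> n" for s k
    using that(2)
  proof (induction k)
    case (Suc k)
    have 1: "((\<lambda>u. p u (s k)) has_real_derivative p u (s k) * (H' (s k) - A)) (at u)"
      unfolding p_def A_def using Suc that by (intro softmax_DERIV assms) (auto simp: PiE_iff)
    have 2: "((\<lambda>u. ((\<Prod>a<k. p u (s a)) * f s) * p u (s k)) has_real_derivative
       ((\<Prod>a<k. p u (s a)) * f s) * (p u (s k) * (H' (s k) - A))
       + ((\<Prod>a<k. p u (s a)) * (f s * (\<Sum>a<k. H' (s a) - A))) * p u (s k)) (at u)"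
      using DERIV_mult'[OF Suc.IH 1] Suc.prems by simp
    show ?case
      using 2 by (rule_tac DERIV_cong) (auto simp: algebra_simps)
  qed simp
  then show ?thesis
    unfolding rep_def p_def[symmetric] A_def[symmetric] by (intro DERIV_sum) auto
qed

lemma rep_DERIV:
  assumes fin: "finite \<Omega>" "\<Omega> \<noteq> {}" and H: "\<And>\<sigma>. \<sigma> \<in> \<Omega> \<Longrightarrow> ((\<lambda>u. H u \<sigma>) has_real_derivative H' \<sigma>) (at u)"
    and f: "dep n f" and nl: "n < l"
  shows "((\<lambda>u. rep \<Omega> (softmax \<Omega> (H u)) l f) has_real_derivative
     rep \<Omega> (softmax \<Omega> (H u)) l (\<lambda>s. f s * (\<Sum>a<Suc n. coef n a * H' (s a)))) (at u)"
proof -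
  define p where "p = softmax \<Omega> (H u)"
  define A where "A = (\<Sum>\<tau>\<in>\<Omega>. p \<tau> * H' \<tau>)"
  have p: "prb \<Omega> p" unfolding p_def by (rule softmax_prb[OF fin])
  have eq: "rep \<Omega> (softmax \<Omega> (H u)) l f = rep \<Omega> (softmax \<Omega> (H u)) n f" for u
    using nl by (intro rep_dep[OF softmax_prb[OF fin] f]) simp
  have "rep \<Omega> p l (\<lambda>s. f s * (\<Sum>a<Suc n. coef n a * H' (s a)))
      = rep \<Omega> p l (\<lambda>s. f s * (\<Sum>a<n. H' (s a)) - real n * (f s * H' (s n)))"
    by (intro rep_cong refl) (simp add: coef_def right_diff_distrib)
  \<comment> \<open>Replica \<open>n\<close> is independent of \<open>f\<close>, so its term splits
    off the Gibbs mean \<open>A\<close>; the next steps distribute the \<open>n\<close> copies of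
    \<open>A\<close> over the \<open>n\<close> replicas.\<close>
  also have "\<dots> = rep \<Omega> p l (\<lambda>s. f s * (\<Sum>a<n. H' (s a))) - real n * (rep \<Omega> p l f * A)"
    unfolding rep_diff rep_cmult rep_mult_next[OF p f nl] A_def ..
  also have "\<dots> = rep \<Omega> p l (\<lambda>s. f s * (\<Sum>a<n. H' (s a)) - (real n * A) * f s)"
    unfolding rep_diff rep_cmult by simp
  also have "\<dots> = rep \<Omega> p l (\<lambda>s. f s * (\<Sum>a<n. H' (s a) - A))"
    by (intro rep_cong refl) (simp add: sum_subtractf right_diff_distrib)
  also have "\<dots> = rep \<Omega> p n (\<lambda>s. f s * (\<Sum>a<n. H' (s a) - A))"
    using nl by (intro rep_dep[OF p] dep_intros f) auto
  finally have E: "rep \<Omega> p l (\<lambda>s. f s * (\<Sum>a<Suc n. coef n a * H' (s a))) = \<dots>" .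
  have "((\<lambda>u. rep \<Omega> (softmax \<Omega> (H u)) n f) has_real_derivative
      rep \<Omega> p n (\<lambda>s. f s * (\<Sum>a<n. H' (s a) - A))) (at u)"
    using rep_DERIV_all[where n=n and f=f, OF fin H] unfolding p_def A_def .
  then show ?thesis by (simp only: eq E p_def[symmetric])
qed

lemma continuous_on_rep:
  assumes "finite \<Omega>" "\<Omega> \<noteq> {}" "\<And>\<sigma>. \<sigma> \<in> \<Omega> \<Longrightarrow> continuous_on X (\<lambda>u. H u \<sigma>)"
  shows "continuous_on X (\<lambda>u. rep \<Omega> (softmax \<Omega> (H u)) n f)"
proof -
  have "(\<Sum>\<tau>\<in>\<Omega>. exp (H u \<tau>)) \<noteq> 0" for u
    using sum_pos[OF assms(1,2), of "\<lambda>\<tau>. exp (H u \<tau>)"] by auto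
  then show ?thesis
    unfolding rep_def softmax_def
    by (intro continuous_intros assms ballI) (auto simp: PiE_iff)
qed

lemma borel_measurable_rep:
  assumes "\<And>\<sigma>. \<sigma> \<in> \<Omega> \<Longrightarrow> (\<lambda>u. H u \<sigma>) \<in> borel_measurable M"
  shows "(\<lambda>u. rep \<Omega> (softmax \<Omega> (H u)) n f) \<in> borel_measurable M"
  unfolding rep_def softmax_def
  by (intro borel_measurable_sum borel_measurable_times borel_measurable_prod borel_measurable_divide
      borel_measurable_const measurable_compose[OF _ borel_measurable_exp] assms) (auto simp: PiE_iff)

section \<open>Gibbs averages along a Gaussian interpolation\<close>

locale gibbs_path =
  fixes \<Omega> :: "'c set" and K :: "'k set"
    and c c' :: "real \<Rightarrow> 'c \<Rightarrow> real" and x x' :: "real \<Rightarrow> 'k \<Rightarrow> 'c \<Rightarrow> real" and X :: real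
  assumes fin: "finite \<Omega>" "\<Omega> \<noteq> {}" "finite K"
    and dc: "\<And>\<theta> \<sigma>. ((\<lambda>\<theta>. c \<theta> \<sigma>) has_real_derivative c' \<theta> \<sigma>) (at \<theta>)"
    and dx: "\<And>\<theta> k \<sigma>. ((\<lambda>\<theta>. x \<theta> k \<sigma>) has_real_derivative x' \<theta> k \<sigma>) (at \<theta>)"
    and bc: "\<And>\<theta> \<sigma>. \<sigma> \<in> \<Omega> \<Longrightarrow> \<bar>c' \<theta> \<sigma>\<bar> \<le> X"
    and bx: "\<And>\<theta> k \<sigma>. \<sigma> \<in> \<Omega> \<Longrightarrow> k \<in> K \<Longrightarrow> \<bar>x' \<theta> k \<sigma>\<bar> \<le> X"
begin

definition ham :: "real \<Rightarrow> ('k \<Rightarrow> real) \<Rightarrow> 'c \<Rightarrow> real" where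
  "ham \<theta> g \<sigma> = c \<theta> \<sigma> + (\<Sum>k\<in>K. x \<theta> k \<sigma> * g k)"

definition av :: "nat \<Rightarrow> real \<Rightarrow> ('k \<Rightarrow> real) \<Rightarrow> ((nat \<Rightarrow> 'c) \<Rightarrow> real) \<Rightarrow> real" where
  "av l \<theta> g f = rep \<Omega> (softmax \<Omega> (ham \<theta> g)) l f"

definition Eav :: "nat \<Rightarrow> real \<Rightarrow> ((nat \<Rightarrow> 'c) \<Rightarrow> real) \<Rightarrow> real" where
  "Eav l \<theta> f = (\<integral>g. av l \<theta> g f \<partial>gauss K)"

definition cov :: "real \<Rightarrow> 'c \<Rightarrow> 'c \<Rightarrow> real" where
  "cov \<theta> \<sigma> \<tau> = (\<Sum>k\<in>K. x' \<theta> k \<sigma> * x \<theta> k \<tau>)"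

text \<open>The inner coefficients carry \<open>Suc n\<close> because integration by parts acts on a
  function that already reads replica \<open>n\<close>, created by the angle derivative; it adds
  replica n + 1 with weight -(n + 1).\<close>

definition gen :: "real \<Rightarrow> nat \<Rightarrow> (nat \<Rightarrow> 'c) \<Rightarrow> real" where
  "gen \<theta> n s = (\<Sum>a<Suc n. coef n a * (c' \<theta> (s a)
     + (\<Sum>b<Suc (Suc n). coef (Suc n) b * cov \<theta> (s a) (s b))))"

lemma prb: "prb \<Omega> (softmax \<Omega> (ham \<theta> g))"
  by (rule softmax_prb[OF fin(1,2)])

lemma measurable_av[measurable]: "(\<lambda>g. av l \<theta> g f) \<in> borel_measurable (gauss K)"
  unfolding av_def by (rule borel_measurable_rep) (auto simp: ham_def)

lemma av_bounded: "\<bar>av l \<theta> g f\<bar> \<le> (\<Sum>s\<in>PiE {..<l} (\<lambda>_. \<Omega>). \<bar>f s\<bar>)"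
  unfolding av_def by (rule rep_bounded[OF prb])

lemma integrable_av: "integrable (gauss K) (\<lambda>g. av l \<theta> g f)"
  by (rule integrable_gauss_bounded[OF measurable_av av_bounded])

lemma Eav_cong: "(\<And>s. s \<in> PiE {..<l} (\<lambda>_. \<Omega>) \<Longrightarrow> f s = f' s) \<Longrightarrow> Eav l \<theta> f = Eav l \<theta> f'"
  unfolding Eav_def av_def
  by (intro Bochner_Integration.integral_cong refl rep_cong)

lemma Eav_add: "Eav l \<theta> (\<lambda>s. f s + f' s) = Eav l \<theta> f + Eav l \<theta> f'"
  using integrable_av unfolding Eav_def av_def by (simp add: rep_add)

lemma Eav_diff: "Eav l \<theta> (\<lambda>s. f s - f' s) = Eav l \<theta> f - Eav l \<theta> f'"
  using integrable_av unfolding Eav_def av_def by (simp add: rep_diff)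

lemma Eav_cmult: "Eav l \<theta> (\<lambda>s. z * f s) = z * Eav l \<theta> f"
  unfolding Eav_def av_def by (simp add: rep_cmult)

lemma Eav_sum: "Eav l \<theta> (\<lambda>s. \<Sum>i\<in>I. f i s) = (\<Sum>i\<in>I. Eav l \<theta> (f i))"
  using integrable_av unfolding Eav_def av_def by (simp add: rep_sum)

lemma Eav_const: "Eav l \<theta> (\<lambda>_. z) = z"
  using prob_space.prob_space[OF prob_space_gauss, of K]
  unfolding Eav_def av_def by (simp add: rep_const[OF prb])

lemma Eav_mono: "(\<And>s. s \<in> PiE {..<l} (\<lambda>_. \<Omega>) \<Longrightarrow> f s \<le> f' s) \<Longrightarrow> Eav l \<theta> f \<le> Eav l \<theta> f'"
  unfolding Eav_def av_def
  by (intro integral_mono integrable_av[unfolded av_def] rep_mono prb)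

lemma Eav_abs_le: "\<bar>Eav l \<theta> f\<bar> \<le> Eav l \<theta> (\<lambda>s. \<bar>f s\<bar>)"
proof -
  have "\<bar>Eav l \<theta> f\<bar> \<le> (\<integral>g. \<bar>av l \<theta> g f\<bar> \<partial>gauss K)"
    unfolding Eav_def by (rule integral_abs_bound)
  also have "\<dots> \<le> Eav l \<theta> (\<lambda>s. \<bar>f s\<bar>)"
    unfolding Eav_def using rep_abs_le[OF prb]
    by (intro integral_mono integrable_abs integrable_av) (auto simp: av_def)
  finally show ?thesis .
qed

lemma Eav_permute: "\<pi> permutes {..<l} \<Longrightarrow> Eav l \<theta> (\<lambda>s. f (s \<circ> \<pi>)) = Eav l \<theta> f"
  unfolding Eav_def av_def by (simp add: rep_permute)

text \<open>The Hamiltonian is affine in the coordinate \<open>g k\<close> with slope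
  \<open>x \<theta> k\<close>, so the derivative in that coordinate is again a replica
  average.\<close>

lemma ibp_av:
  assumes k: "k \<in> K" and f: "dep n f" and nl: "n < l"
  shows "(\<integral>g. g k * av l \<theta> g f \<partial>gauss K) = Eav l \<theta> (\<lambda>s. f s * (\<Sum>a<Suc n. coef n a * x \<theta> k (s a)))"
proof -
  have upd: "ham \<theta> (g(k := u)) \<sigma> = c \<theta> \<sigma> + ((\<Sum>j\<in>K - {k}. x \<theta> j \<sigma> * g j) + x \<theta> k \<sigma> * u)" for g u \<sigma>
    unfolding ham_def using sum.remove[OF fin(3) k, of "\<lambda>j. x \<theta> j \<sigma> * (g(k := u)) j"] by simp
  show ?thesis unfolding Eav_def
  proof (rule gaussian_ibp[OF fin(3) k measurable_av measurable_av])
    fix g u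
    show "((\<lambda>u. av l \<theta> (g(k := u)) f) has_real_derivative
          av l \<theta> (g(k := u)) (\<lambda>s. f s * (\<Sum>a<Suc n. coef n a * x \<theta> k (s a)))) (at u)"
      unfolding av_def
      by (rule rep_DERIV[OF fin(1,2) _ f nl], unfold upd) (auto intro!: derivative_eq_intros)
    show "continuous_on UNIV (\<lambda>u. av l \<theta> (g(k := u)) (\<lambda>s. f s * (\<Sum>a<Suc n. coef n a * x \<theta> k (s a))))"
      unfolding av_def
      by (rule continuous_on_rep[OF fin(1,2)], unfold upd) (auto intro!: continuous_intros)
    let ?f' = "\<lambda>s. f s * (\<Sum>a<Suc n. coef n a * x \<theta> k (s a))"
    let ?T = "\<lambda>f. \<Sum>s\<in>PiE {..<l} (\<lambda>_. \<Omega>). \<bar>f s\<bar>"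
    show "\<bar>av l \<theta> g f\<bar> \<le> max (?T f) (?T ?f')" "\<bar>av l \<theta> g ?f'\<bar> \<le> max (?T f) (?T ?f')"
      using av_bounded[of l \<theta> g f] av_bounded[of l \<theta> g ?f'] by linarith+
  qed
qed

text \<open>The angle derivative of the Hamiltonian is affine in the Gaussians. Integrating by parts
  in each of them leaves a replica average in which the disorder enters through the Gibbs weights
  only.\<close>

theorem Eav_DERIV:
  assumes f: "dep n f" and nl: "Suc n < l"
  shows "((\<lambda>\<theta>. Eav l \<theta> f) has_real_derivative Eav l \<theta> (\<lambda>s. f s * gen \<theta> n s)) (at \<theta>)"
proof -
  define D where "D \<theta> g \<sigma> = c' \<theta> \<sigma> + (\<Sum>k\<in>K. x' \<theta> k \<sigma> * g k)" for \<theta> g \<sigma>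
  define F' where "F' \<theta> g = av l \<theta> g (\<lambda>s. f s * (\<Sum>a<Suc n. coef n a * D \<theta> g (s a)))" for \<theta> g
  define fk where "fk \<theta> k s = f s * (\<Sum>a<Suc n. coef n a * x' \<theta> k (s a))" for \<theta> k s
  \<comment> \<open>\<open>Y\<close> bounds the angle derivative of the Hamiltonian, which is the
    purpose of the uniform bound \<open>X\<close> of the locale; it grows linearly in the Gaussians
    and is thus integrable.\<close>
  define Y where "Y g = X * (1 + (\<Sum>k\<in>K. \<bar>g k\<bar>))" for g
  define B where "B g = (\<Sum>s\<in>PiE {..<l} (\<lambda>_. \<Omega>). \<bar>f s\<bar> * (\<Sum>a<Suc n. \<bar>coef n a\<bar> * Y g))" for g
  have split: "f s * (\<Sum>a<Suc n. coef n a * D \<theta> g (s a))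
      = f s * (\<Sum>a<Suc n. coef n a * c' \<theta> (s a)) + (\<Sum>k\<in>K. g k * fk \<theta> k s)" for \<theta> g s
  proof -
    have "(\<Sum>a<Suc n. coef n a * (\<Sum>k\<in>K. x' \<theta> k (s a) * g k))
        = (\<Sum>k\<in>K. g k * (\<Sum>a<Suc n. coef n a * x' \<theta> k (s a)))"
      unfolding sum_distrib_left by (subst sum.swap) (simp add: mult_ac)
    then show ?thesis
      unfolding D_def fk_def by (simp only: distrib_left sum.distrib sum_distrib_left mult_ac)
  qed
  have F'eq: "F' \<theta> g = av l \<theta> g (\<lambda>s. f s * (\<Sum>a<Suc n. coef n a * c' \<theta> (s a))) + (\<Sum>k\<in>K. g k * av l \<theta> g (fk \<theta> k))" for \<theta> g
    unfolding F'_def split av_def rep_add rep_sum rep_cmult ..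
  have int: "integrable (gauss K) (\<lambda>g. g k * av l \<theta> g h)" if "k \<in> K" for k \<theta> h
    by (rule integrable_gauss_component_mult[OF that measurable_av av_bounded])
  have "((\<lambda>\<theta>. \<integral>g. av l \<theta> g f \<partial>gauss K) has_real_derivative (\<integral>g. F' \<theta> g \<partial>gauss K)) (at \<theta>)"
  proof (rule DERIV_integral_dominated[where B=B])
    show "((\<lambda>\<theta>. av l \<theta> g f) has_real_derivative F' \<theta> g) (at \<theta>)" for \<theta> g
      unfolding av_def F'_def ham_def D_def
      using nl by (intro rep_DERIV fin f derivative_eq_intros) (auto intro: dc dx)
    show "integrable (gauss K) (\<lambda>g. av l \<theta> g f)" for \<theta> by (rule integrable_av)
    show "F' \<theta> \<in> borel_measurable (gauss K)" for \<theta>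
      unfolding F'eq[abs_def] by measurable
    show "\<bar>F' \<theta> g\<bar> \<le> B g" for \<theta> g
    proof -
      have "\<bar>D \<theta> g \<sigma>\<bar> \<le> Y g" if "\<sigma> \<in> \<Omega>" for \<sigma>
      proof -
        have "\<bar>\<Sum>k\<in>K. x' \<theta> k \<sigma> * g k\<bar> \<le> (\<Sum>k\<in>K. X * \<bar>g k\<bar>)"
          by (intro order_trans[OF sum_abs] sum_mono) (auto simp: abs_mult intro!: mult_right_mono bx that)
        with bc[OF that, of \<theta>] show ?thesis
          unfolding D_def Y_def by (simp add: algebra_simps sum_distrib_left)
      qed
      then have "\<bar>\<Sum>a<Suc n. coef n a * D \<theta> g (s a)\<bar> \<le> (\<Sum>a<Suc n. \<bar>coef n a\<bar> * Y g)"
        if "s \<in> PiE {..<l} (\<lambda>_. \<Omega>)" for s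
        using that nl
        by (intro order_trans[OF sum_abs] sum_mono) (auto simp: abs_mult PiE_iff intro!: mult_left_mono)
      then show ?thesis
        unfolding F'_def B_def
        by (intro order_trans[OF av_bounded] sum_mono) (auto simp: abs_mult intro!: mult_left_mono)
    qed
    show "integrable (gauss K) B"
      unfolding B_def[abs_def] Y_def
      by (intro Bochner_Integration.integrable_sum integrable_mult_right Bochner_Integration.integrable_add
          finite_measure.integrable_const integrable_abs integrable_gauss_component
          prob_space.finite_measure[OF prob_space_gauss])
  qed
  also have "(\<integral>g. F' \<theta> g \<partial>gauss K) = Eav l \<theta> (\<lambda>s. f s * (\<Sum>a<Suc n. coef n a * c' \<theta> (s a)))
      + (\<Sum>k\<in>K. (\<integral>g. g k * av l \<theta> g (fk \<theta> k) \<partial>gauss K))"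
    unfolding F'eq Eav_def
    by (simp add: integrable_av int Bochner_Integration.integral_add Bochner_Integration.integrable_sum
        Bochner_Integration.integral_sum)
  also have "(\<Sum>k\<in>K. (\<integral>g. g k * av l \<theta> g (fk \<theta> k) \<partial>gauss K))
      = (\<Sum>k\<in>K. Eav l \<theta> (\<lambda>s. fk \<theta> k s * (\<Sum>b<Suc (Suc n). coef (Suc n) b * x \<theta> k (s b))))"
    unfolding fk_def[abs_def] using nl
    by (intro sum.cong refl ibp_av dep_intros) (auto intro: dep_mono[OF f])
  also have "Eav l \<theta> (\<lambda>s. f s * (\<Sum>a<Suc n. coef n a * c' \<theta> (s a))) + \<dots> = Eav l \<theta> (\<lambda>s. f s * gen \<theta> n s)"
  proof -
    have "(\<Sum>k\<in>K. fk \<theta> k s * (\<Sum>b<Suc (Suc n). coef (Suc n) b * x \<theta> k (s b)))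
        = f s * (\<Sum>a<Suc n. coef n a * (\<Sum>b<Suc (Suc n). coef (Suc n) b * cov \<theta> (s a) (s b)))" for s
    proof -
      have "(\<Sum>a<Suc n. coef n a * (\<Sum>b<Suc (Suc n). coef (Suc n) b * cov \<theta> (s a) (s b)))
          = (\<Sum>a<Suc n. \<Sum>b<Suc (Suc n). \<Sum>k\<in>K. (coef n a * x' \<theta> k (s a)) * (coef (Suc n) b * x \<theta> k (s b)))"
        unfolding cov_def sum_distrib_left by (simp only: mult_ac)
      also have "\<dots> = (\<Sum>a<Suc n. \<Sum>k\<in>K. \<Sum>b<Suc (Suc n). (coef n a * x' \<theta> k (s a)) * (coef (Suc n) b * x \<theta> k (s b)))"
        by (intro sum.cong refl sum.swap)
      also have "\<dots> = (\<Sum>k\<in>K. \<Sum>a<Suc n. \<Sum>b<Suc (Suc n). (coef n a * x' \<theta> k (s a)) * (coef (Suc n) b * x \<theta> k (s b)))"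
        by (rule sum.swap)
      also have "\<dots> = (\<Sum>k\<in>K. (\<Sum>a<Suc n. coef n a * x' \<theta> k (s a)) * (\<Sum>b<Suc (Suc n). coef (Suc n) b * x \<theta> k (s b)))"
        by (simp only: sum_product)
      finally show ?thesis unfolding fk_def by (simp only: mult.assoc sum_distrib_left[symmetric])
    qed
    then show ?thesis
      unfolding Eav_sum[symmetric] Eav_add[symmetric] gen_def
      by (intro Eav_cong) (simp only: distrib_left sum.distrib)
  qed
  finally show ?thesis unfolding Eav_def[symmetric] .
qed

end

section \<open>The interpolation at one site\<close>

lemma finite_spins: "finite (spins S)" and spins_nonempty: "spins S \<noteq> {}"
  by (auto simp: spins_def)

lemma finite_config: "finite (config S N)"
  unfolding config_def by (intro finite_PiE finite_spins) auto

lemma config_nonempty: "config S N \<noteq> {}"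
  unfolding config_def by (simp add: PiE_eq_empty_iff spins_nonempty)

lemma spins_abs_le: "s \<in> spins S \<Longrightarrow> \<bar>s\<bar> \<le> real S"
  by (auto simp: spins_def abs_le_iff minus_le_iff)

lemma config_abs_le: "\<sigma> \<in> config S N \<Longrightarrow> j < N \<Longrightarrow> \<bar>\<sigma> j\<bar> \<le> real S"
  unfolding config_def by (intro spins_abs_le) (auto simp: PiE_iff)

lemma abs_mult_le: "\<bar>x\<bar> \<le> a \<Longrightarrow> \<bar>y\<bar> \<le> b \<Longrightarrow> \<bar>x * y\<bar> \<le> a * (b::real)"
  unfolding abs_mult by (rule mult_mono) auto

lemma config_mult_le: "\<sigma> \<in> config S N \<Longrightarrow> \<tau> \<in> config S N \<Longrightarrow> j < N \<Longrightarrow> k < N \<Longrightarrow> \<bar>\<sigma> j * \<tau> k\<bar> \<le> (real S)\<^sup>2"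
  unfolding power2_eq_square by (intro abs_mult_le config_abs_le)

lemma finite_pairs: "finite (pairs N)"
  by (rule finite_subset[of _ "{..<N} \<times> {..<N}"]) (auto simp: pairs_def)

text \<open>A pair containing \<open>i\<close> is determined by its other member; \<open>min\<close>
  and \<open>max\<close> restore the order that \<open>pairs\<close> demands, and the symmetry of
  \<open>f\<close> makes that order invisible.\<close>

lemma sum_pairs_star:
  fixes f :: "nat \<Rightarrow> nat \<Rightarrow> real"
  assumes i: "i < N" and sym: "\<And>a b. f a b = f b a"
  shows "(\<Sum>k\<in>pairs N. if fst k = i \<or> snd k = i then f (fst k) (snd k) else 0) = (\<Sum>j\<in>{..<N} - {i}. f i j)"
proof -
  have "(\<Sum>k\<in>pairs N. if fst k = i \<or> snd k = i then f (fst k) (snd k) else 0)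
      = (\<Sum>k\<in>{k\<in>pairs N. fst k = i \<or> snd k = i}. f (fst k) (snd k))"
    by (simp add: sum.inter_filter[OF finite_pairs])
  also have "\<dots> = (\<Sum>j\<in>{..<N} - {i}. f i j)"
    by (rule sum.reindex_bij_witness[where i="\<lambda>j. (min i j, max i j)"
          and j="\<lambda>k. if fst k = i then snd k else fst k"])
       (use i sym in \<open>auto simp: pairs_def min_def max_def\<close>)
  finally show ?thesis .
qed

definition gibbs_weight :: "nat \<Rightarrow> nat \<Rightarrow> real \<Rightarrow> real \<Rightarrow> real \<Rightarrow> (nat \<times> nat \<Rightarrow> real) \<Rightarrow> (nat \<Rightarrow> real) \<Rightarrow> real" where
  "gibbs_weight S N \<beta> h D g = softmax (config S N) (hamiltonian N \<beta> h D g)"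

definition nu_rep :: "nat \<Rightarrow> nat \<Rightarrow> real \<Rightarrow> real \<Rightarrow> real \<Rightarrow> nat \<Rightarrow> ((nat \<Rightarrow> nat \<Rightarrow> real) \<Rightarrow> real) \<Rightarrow> real" where
  "nu_rep S N \<beta> h D l f = nu N (\<lambda>g. rep (config S N) (gibbs_weight S N \<beta> h D g) l f)"

text \<open>Centering value of an overlap: \<open>p\<close> for a self-overlap, \<open>q\<close> for
  two distinct replicas.\<close>

definition Qv :: "real \<Rightarrow> real \<Rightarrow> nat \<Rightarrow> nat \<Rightarrow> real" where
  "Qv p q a b = (if a = b then p else q)"

definition ovl :: "nat \<Rightarrow> real \<Rightarrow> real \<Rightarrow> nat \<Rightarrow> nat \<Rightarrow> (nat \<Rightarrow> nat \<Rightarrow> real) \<Rightarrow> real" where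
  "ovl N p q a b s = (\<Sum>j<N. s a j * s b j) / real N - Qv p q a b"

text \<open>The factor 10000 serves \<open>\<beta>_le\<close>, since 576/10000 <= 1/16. The fixed
  point equations for p and q come in later, with \<open>cavity_pq\<close>.\<close>

locale cavity =
  fixes S N i :: nat and \<beta> h D p q :: real
  assumes i: "i < N" and q: "0 \<le> q" and S: "1 \<le> S"
    and pq_le: "\<bar>p\<bar> \<le> (real S)\<^sup>2" "\<bar>q\<bar> \<le> (real S)\<^sup>2"
    and \<beta>: "\<beta>\<^sup>2 * ((real S)\<^sup>2)\<^sup>2 * 10000 \<le> 1"
begin

abbreviation "B \<equiv> (real S)\<^sup>2"

definition cc :: "real \<Rightarrow> (nat \<Rightarrow> real) \<Rightarrow> real" where
  "cc \<theta> \<sigma> = D * (\<Sum>j<N. (\<sigma> j)\<^sup>2) + h * (\<Sum>j<N. \<sigma> j) + (cos \<theta>)\<^sup>2 * (\<beta>\<^sup>2 / 2 * (p - q) * (\<sigma> i)\<^sup>2)"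

definition cc' :: "real \<Rightarrow> (nat \<Rightarrow> real) \<Rightarrow> real" where
  "cc' \<theta> \<sigma> = - (sin \<theta> * cos \<theta> * (\<beta>\<^sup>2 * (p - q) * (\<sigma> i)\<^sup>2))"

text \<open>The index (0, 0) lies outside \<open>pairs N\<close>, whose elements are strictly
  increasing, and is used for the Gaussian of the external field at site \<open>i\<close>.\<close>

definition cx :: "real \<Rightarrow> nat \<times> nat \<Rightarrow> (nat \<Rightarrow> real) \<Rightarrow> real" where
  "cx \<theta> k \<sigma> = (if k = (0, 0) then cos \<theta> * (\<beta> * sqrt q * \<sigma> i)
     else (if fst k = i \<or> snd k = i then sin \<theta> else 1) * (\<beta> / sqrt (real N) * (\<sigma> (fst k) * \<sigma> (snd k))))"

definition cx' :: "real \<Rightarrow> nat \<times> nat \<Rightarrow> (nat \<Rightarrow> real) \<Rightarrow> real" where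
  "cx' \<theta> k \<sigma> = (if k = (0, 0) then - sin \<theta> * (\<beta> * sqrt q * \<sigma> i)
     else (if fst k = i \<or> snd k = i then cos \<theta> else 0) * (\<beta> / sqrt (real N) * (\<sigma> (fst k) * \<sigma> (snd k))))"

definition X :: real where
  "X = \<bar>\<beta>\<^sup>2 * (p - q)\<bar> * B + \<bar>\<beta> * sqrt q\<bar> * real S + \<bar>\<beta> / sqrt (real N)\<bar> * B"

sublocale gibbs_path "config S N" "insert (0, 0) (pairs N)" cc cc' cx cx' X
proof
  show "finite (config S N)" "config S N \<noteq> {}" "finite (insert (0, 0) (pairs N))"
    using finite_config config_nonempty finite_pairs by auto
  show "((\<lambda>\<theta>. cc \<theta> \<sigma>) has_real_derivative cc' \<theta> \<sigma>) (at \<theta>)" for \<theta> \<sigma>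
    unfolding cc_def cc'_def
    by (rule derivative_eq_intros refl)+ (simp add: field_simps)
  show "((\<lambda>\<theta>. cx \<theta> k \<sigma>) has_real_derivative cx' \<theta> k \<sigma>) (at \<theta>)" for \<theta> k \<sigma>
  proof -
    have u: "((\<lambda>\<theta>. cos \<theta> * y) has_real_derivative - sin \<theta> * y) (at \<theta>)"
      "((\<lambda>\<theta>. sin \<theta> * y) has_real_derivative cos \<theta> * y) (at \<theta>)"
      "((\<lambda>\<theta>. 1 * y) has_real_derivative 0 * y) (at \<theta>)" for y :: real
      by (intro DERIV_cmult_right DERIV_cos DERIV_sin DERIV_const)+
    show ?thesis
      unfolding cx_def cx'_def
      by (cases "k = (0, 0)"; cases "fst k = i \<or> snd k = i") (simp_all only: if_True if_False u simp_thms)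
  qed
  fix \<theta> :: real and \<sigma> k assume \<sigma>: "\<sigma> \<in> config S N"
  have sc: "\<bar>sin \<theta> * cos \<theta>\<bar> \<le> 1" using abs_mult_le[of "sin \<theta>" 1 "cos \<theta>" 1] by simp
  have s2: "\<bar>(\<sigma> i)\<^sup>2\<bar> \<le> B" using config_mult_le[OF \<sigma> \<sigma> i i] by (simp add: power2_eq_square)
  have "\<bar>sin \<theta> * cos \<theta> * (\<beta>\<^sup>2 * (p - q) * (\<sigma> i)\<^sup>2)\<bar> \<le> 1 * (\<bar>\<beta>\<^sup>2 * (p - q)\<bar> * B)"
    by (intro abs_mult_le sc s2) auto
  then show "\<bar>cc' \<theta> \<sigma>\<bar> \<le> X"
    unfolding cc'_def X_def by (simp add: add_increasing2)
  assume k: "k \<in> insert (0, 0) (pairs N)"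
  have 1: "\<bar>- sin \<theta> * (\<beta> * sqrt q * \<sigma> i)\<bar> \<le> 1 * (\<bar>\<beta> * sqrt q\<bar> * real S)"
    by (intro abs_mult_le config_abs_le[OF \<sigma> i]) auto
  have 2: "\<bar>y * (\<beta> / sqrt (real N) * (\<sigma> (fst k) * \<sigma> (snd k)))\<bar> \<le> 1 * (\<bar>\<beta> / sqrt (real N)\<bar> * B)"
    if "k \<in> pairs N" "\<bar>y\<bar> \<le> 1" for y
    by (intro abs_mult_le config_mult_le) (use that \<sigma> in \<open>auto simp: pairs_def\<close>)
  have 3: "0 \<le> \<bar>\<beta>\<^sup>2 * (p - q)\<bar> * B" "0 \<le> \<bar>\<beta> * sqrt q\<bar> * real S" "0 \<le> \<bar>\<beta> / sqrt (real N)\<bar> * B" by simp_all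
  show "\<bar>cx' \<theta> k \<sigma>\<bar> \<le> X"
  proof (cases "k = (0, 0)")
    case True
    with 1 3 show ?thesis unfolding cx'_def X_def by (simp only: if_True simp_thms)
  next
    case False
    with k have "k \<in> pairs N" by auto
    from 2[OF this, of "if fst k = i \<or> snd k = i then cos \<theta> else 0"]
    have "\<bar>cx' \<theta> k \<sigma>\<bar> \<le> 1 * (\<bar>\<beta> / sqrt (real N)\<bar> * B)"
      unfolding cx'_def using False by simp
    with 3 show ?thesis unfolding X_def by linarith
  qed
qed

text \<open>Still normalised by \<open>N\<close>, so that it differs from the full overlap only by
  the summand of site \<open>i\<close> divided by \<open>N\<close>.\<close>

definition rm :: "nat \<Rightarrow> nat \<Rightarrow> (nat \<Rightarrow> nat \<Rightarrow> real) \<Rightarrow> real" where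
  "rm a b s = (\<Sum>j\<in>{..<N} - {i}. s a j * s b j) / real N - Qv p q a b"

definition L :: "nat \<Rightarrow> (nat \<Rightarrow> nat \<Rightarrow> real) \<Rightarrow> real" where
  "L n s = (\<Sum>a<Suc n. \<Sum>b<Suc (Suc n). coef n a * coef (Suc n) b * (s a i * s b i * rm a b s))"

text \<open>The couplings of \<open>i\<close> carry sin and the field carries cos, so their
  derivatives contribute with opposite signs and combine to an overlap centered at
  \<open>q\<close>.\<close>

lemma cov_eq:
  "cov \<theta> \<sigma> \<tau> = sin \<theta> * cos \<theta> * \<beta>\<^sup>2 * (\<sigma> i * \<tau> i * ((\<Sum>j\<in>{..<N} - {i}. \<sigma> j * \<tau> j) / real N - q))"
proof -
  have 0: "(0, 0) \<notin> pairs N" by (auto simp: pairs_def)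
  have "(\<Sum>k\<in>pairs N. cx' \<theta> k \<sigma> * cx \<theta> k \<tau>)
      = (\<Sum>k\<in>pairs N. if fst k = i \<or> snd k = i
          then (\<lambda>a b. sin \<theta> * cos \<theta> * (\<beta>\<^sup>2 / real N) * ((\<sigma> a * \<sigma> b) * (\<tau> a * \<tau> b))) (fst k) (snd k) else 0)"
    using 0 i unfolding cx'_def cx_def
    by (intro sum.cong refl) (auto simp: power2_eq_square)
  also have "\<dots> = (\<Sum>j\<in>{..<N} - {i}. sin \<theta> * cos \<theta> * (\<beta>\<^sup>2 / real N) * ((\<sigma> i * \<sigma> j) * (\<tau> i * \<tau> j)))"
    by (subst sum_pairs_star[OF i]) (simp_all add: mult_ac)
  also have "\<dots> = sin \<theta> * cos \<theta> * \<beta>\<^sup>2 * (\<sigma> i * \<tau> i * ((\<Sum>j\<in>{..<N} - {i}. \<sigma> j * \<tau> j) / real N))"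
    by (simp add: sum_distrib_left sum_divide_distrib mult_ac)
  finally have 1: "(\<Sum>k\<in>pairs N. cx' \<theta> k \<sigma> * cx \<theta> k \<tau>) = \<dots>" .
  have 2: "cx' \<theta> (0, 0) \<sigma> * cx \<theta> (0, 0) \<tau> = - (sin \<theta> * cos \<theta> * \<beta>\<^sup>2 * (\<sigma> i * \<tau> i * q))"
  proof -
    have "cx' \<theta> (0, 0) \<sigma> * cx \<theta> (0, 0) \<tau> = - (sin \<theta> * cos \<theta> * \<beta>\<^sup>2 * (\<sigma> i * \<tau> i * (sqrt q * sqrt q)))"
      by (simp add: cx'_def cx_def power2_eq_square mult_ac)
    then show ?thesis using q by simp
  qed
  show ?thesis
    unfolding cov_def using finite_pairs 0 by (simp add: 1 2 right_diff_distrib)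
qed

text \<open>For equal replicas the covariance is centered at \<open>q\<close> whereas
  \<open>rm\<close> is centered at \<open>p\<close>. The quadratic term with p - q is chosen so that
  its derivative \<open>cc'\<close> cancels the discrepancy.\<close>

lemma gen_eq: "gen \<theta> n s = sin \<theta> * cos \<theta> * \<beta>\<^sup>2 * L n s"
proof -
  let ?k = "sin \<theta> * cos \<theta> * \<beta>\<^sup>2"
  have "cc' \<theta> (s a) + (\<Sum>b<Suc (Suc n). coef (Suc n) b * cov \<theta> (s a) (s b))
      = ?k * (\<Sum>b<Suc (Suc n). coef (Suc n) b * (s a i * s b i * rm a b s))" if "a < Suc n" for a
  proof -
    have "(\<Sum>b<Suc (Suc n). coef (Suc n) b * cov \<theta> (s a) (s b))
        = (\<Sum>b<Suc (Suc n). ?k * (coef (Suc n) b * (s a i * s b i * rm a b s))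
             + (if a = b then ?k * coef (Suc n) a * (s a i * s a i * (p - q)) else 0))"
      unfolding cov_eq rm_def Qv_def by (intro sum.cong refl) (auto simp: algebra_simps)
    also have "\<dots> = ?k * (\<Sum>b<Suc (Suc n). coef (Suc n) b * (s a i * s b i * rm a b s))
       + ?k * coef (Suc n) a * (s a i * s a i * (p - q))"
      using that by (simp only: sum.distrib sum_distrib_left sum.delta finite_lessThan lessThan_iff) simp
    \<comment> \<open>The diagonal occurs with weight 1, as \<open>a\<close> is at most
      \<open>n\<close> and never the last replica n + 1 of the inner sum.\<close>
    also have "coef (Suc n) a = 1" using that by (simp add: coef_def)
    finally show ?thesis unfolding cc'_def by (simp add: power2_eq_square algebra_simps)
  qed
  then have "gen \<theta> n s = (\<Sum>a<Suc n. coef n a * (?k * (\<Sum>b<Suc (Suc n). coef (Suc n) b * (s a i * s b i * rm a b s))))"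
    unfolding gen_def by (intro sum.cong refl) (simp only: lessThan_iff)
  then show ?thesis unfolding L_def by (simp only: sum_distrib_left mult_ac)
qed

text \<open>Ten replicas suffice throughout: four in the observables, and two more for each of the three
  applications of the derivative formula.\<close>

abbreviation E :: "real \<Rightarrow> ((nat \<Rightarrow> nat \<Rightarrow> real) \<Rightarrow> real) \<Rightarrow> real" where
  "E \<equiv> Eav 10"

lemma E_DERIV:
  assumes "dep n f" "n \<le> 8"
  shows "((\<lambda>\<theta>. E \<theta> f) has_real_derivative sin \<theta> * cos \<theta> * \<beta>\<^sup>2 * E \<theta> (\<lambda>s. f s * L n s)) (at \<theta>)"
proof -
  have "(\<lambda>s. f s * gen \<theta> n s) = (\<lambda>s. (sin \<theta> * cos \<theta> * \<beta>\<^sup>2) * (f s * L n s))"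
    unfolding gen_eq by (simp add: fun_eq_iff)
  then show ?thesis
    using Eav_DERIV[OF assms(1), of 10 \<theta>] assms(2) by (simp only: Eav_cmult)
qed

lemma dep_rm: "a < n \<Longrightarrow> b < n \<Longrightarrow> dep n (rm a b)"
  unfolding rm_def[abs_def]
  by (intro dep_intros) (auto intro: dep_comp[where y="\<lambda>x. x _"])

lemma dep_L: "dep (Suc (Suc n)) (L n)"
  unfolding L_def[abs_def]
  by (intro dep_intros dep_rm) (auto intro: dep_comp[where y="\<lambda>x. x _"])

lemma sum_abs_coef: "(\<Sum>a<Suc n. \<bar>coef n a\<bar>) = 2 * real n"
  by (simp add: coef_def)

lemma B_ge_1: "1 \<le> B"
  using S by (simp add: one_le_power)

abbreviation "Sp10 \<equiv> PiE {..<10::nat} (\<lambda>_. config S N)"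

lemma prod_le: "s \<in> Sp10 \<Longrightarrow> a < 10 \<Longrightarrow> b < 10 \<Longrightarrow> j < N \<Longrightarrow> \<bar>s a j * s b j\<bar> \<le> B"
  by (rule config_mult_le) (auto simp: PiE_iff)

lemma rm_le:
  assumes "s \<in> Sp10" "a < 10" "b < 10" shows "\<bar>rm a b s\<bar> \<le> 2 * B"
proof -
  have "\<bar>\<Sum>j\<in>{..<N} - {i}. s a j * s b j\<bar> \<le> (\<Sum>j\<in>{..<N} - {i}. B)"
    by (intro order_trans[OF sum_abs] sum_mono prod_le assms) auto
  also have "\<dots> \<le> real N * B" using i by (simp add: mult_right_mono)
  finally have "\<bar>(\<Sum>j\<in>{..<N} - {i}. s a j * s b j) / real N\<bar> \<le> B"
    using i by (simp add: divide_simps mult.commute)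
  moreover have "\<bar>Qv p q a b\<bar> \<le> B" using pq_le by (simp add: Qv_def)
  ultimately show ?thesis unfolding rm_def by linarith
qed

lemma L_le:
  assumes "s \<in> Sp10" "n \<le> 8"
  shows "\<bar>L n s\<bar> \<le> (\<Sum>a<Suc n. \<Sum>b<Suc (Suc n). \<bar>coef n a\<bar> * \<bar>coef (Suc n) b\<bar> * (B * \<bar>rm a b s\<bar>))"
  unfolding L_def
proof (intro order_trans[OF sum_abs] sum_mono)
  fix a b assume ab: "a \<in> {..<Suc n}" "b \<in> {..<Suc (Suc n)}"
  have "\<bar>s a i * s b i * rm a b s\<bar> \<le> B * \<bar>rm a b s\<bar>"
    by (intro abs_mult_le prod_le i) (use assms ab in auto)
  then show "\<bar>coef n a * coef (Suc n) b * (s a i * s b i * rm a b s)\<bar> \<le> \<bar>coef n a\<bar> * \<bar>coef (Suc n) b\<bar> * (B * \<bar>rm a b s\<bar>)"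
    unfolding abs_mult[of "coef n a * coef (Suc n) b"] abs_mult[of "coef n a"] by (intro mult_left_mono) auto
qed

lemma sum_coef_le:
  assumes "\<And>a b. a < Suc n \<Longrightarrow> b < Suc (Suc n) \<Longrightarrow> y a b \<le> (Y::real)"
  shows "(\<Sum>a<Suc n. \<Sum>b<Suc (Suc n). \<bar>coef n a\<bar> * \<bar>coef (Suc n) b\<bar> * y a b) \<le> 4 * real n * (real n + 1) * Y"
proof -
  have "(\<Sum>a<Suc n. \<Sum>b<Suc (Suc n). \<bar>coef n a\<bar> * \<bar>coef (Suc n) b\<bar> * y a b)
      \<le> (\<Sum>a<Suc n. \<Sum>b<Suc (Suc n). \<bar>coef n a\<bar> * \<bar>coef (Suc n) b\<bar> * Y)"
    by (intro sum_mono mult_left_mono assms) auto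
  also have "\<dots> = (\<Sum>a<Suc n. \<bar>coef n a\<bar>) * (\<Sum>b<Suc (Suc n). \<bar>coef (Suc n) b\<bar>) * Y"
    unfolding sum_product by (simp only: sum_distrib_right)
  also have "\<dots> = 4 * real n * (real n + 1) * Y" by (simp only: sum_abs_coef) simp
  finally show ?thesis .
qed

text \<open>The worst case is n = 8: the coefficients have total weight 4 * 8 * 9, the spins
  contribute B and the centered overlap 2 B.\<close>

lemma L_bounded:
  assumes "s \<in> Sp10" "n \<le> 8" shows "\<bar>L n s\<bar> \<le> 576 * B\<^sup>2"
proof -
  have "\<bar>L n s\<bar> \<le> 4 * real n * (real n + 1) * (B * (2 * B))"
    by (intro order_trans[OF L_le[OF assms] sum_coef_le] mult_left_mono rm_le assms)
       (use assms in auto)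
  also have "\<dots> \<le> 4 * 8 * (8 + 1) * (B * (2 * B))"
    using assms(2) by (intro mult_right_mono mult_mono) auto
  finally show ?thesis by (simp add: power2_eq_square)
qed

lemma \<beta>_le: "\<beta>\<^sup>2 * (576 * B\<^sup>2) \<le> 1 / 16"
  using \<beta> by simp

lemma E_abs_L_le:
  assumes "n \<le> 8" "\<And>s. s \<in> Sp10 \<Longrightarrow> 0 \<le> f s"
  shows "\<bar>E \<theta> (\<lambda>s. f s * L n s)\<bar> \<le> 576 * B\<^sup>2 * E \<theta> f"
proof -
  have "\<bar>E \<theta> (\<lambda>s. f s * L n s)\<bar> \<le> E \<theta> (\<lambda>s. \<bar>f s * L n s\<bar>)" by (rule Eav_abs_le)
  also have "\<dots> \<le> E \<theta> (\<lambda>s. 576 * B\<^sup>2 * f s)"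
  proof (rule Eav_mono)
    fix s assume s: "s \<in> Sp10"
    have "f s * \<bar>L n s\<bar> \<le> f s * (576 * B\<^sup>2)"
      by (intro mult_left_mono L_bounded assms s)
    then show "\<bar>f s * L n s\<bar> \<le> 576 * B\<^sup>2 * f s"
      using assms(2)[OF s] by (simp add: abs_mult mult.commute)
  qed
  finally show ?thesis unfolding Eav_cmult .
qed

section \<open>Comparison and expansion along the path\<close>

lemma abs_sin_cos_le: "\<bar>sin \<theta> * cos \<theta>\<bar> \<le> (1::real)"
  using abs_mult_le[of "sin \<theta>" 1 "cos \<theta>" 1] by simp

text \<open>Gronwall's argument: the derivative of \<open>E \<theta> f\<close> is at most k times
  \<open>E \<theta> f\<close> in absolute value, so exp(k theta) times it is nondecreasing. Averages
  of nonnegative functions anywhere on the path are thereby controlled by the model itself.\<close>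

lemma E_compare:
  assumes f: "dep n f" "n \<le> 8" and pos: "\<And>s. s \<in> Sp10 \<Longrightarrow> 0 \<le> f s" and \<theta>: "0 \<le> \<theta>" "\<theta> \<le> pi / 2"
  shows "E \<theta> f \<le> 3 * E (pi / 2) f"
proof -
  define k where "k = \<beta>\<^sup>2 * (576 * B\<^sup>2)"
  have E0: "0 \<le> E \<theta> f" for \<theta>
    using Eav_mono[of 10 "\<lambda>_. 0" f \<theta>] pos by (simp add: Eav_const)
  have "exp (k * \<theta>) * E \<theta> f \<le> exp (k * (pi / 2)) * E (pi / 2) f"
  proof (rule DERIV_nonneg_imp_nondecreasing[OF \<theta>(2)])
    fix t
    let ?d = "exp (k * t) * (k * E t f + sin t * cos t * \<beta>\<^sup>2 * E t (\<lambda>s. f s * L n s))"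
    have "((\<lambda>t. exp (k * t) * E t f) has_real_derivative ?d) (at t)"
      by (rule derivative_eq_intros E_DERIV[OF f] refl)+ (simp add: algebra_simps)
    moreover have "\<bar>(sin t * cos t * \<beta>\<^sup>2) * E t (\<lambda>s. f s * L n s)\<bar> \<le> (1 * \<beta>\<^sup>2) * (576 * B\<^sup>2 * E t f)"
      by (intro abs_mult_le E_abs_L_le f pos abs_sin_cos_le) auto
    then have "0 \<le> ?d" unfolding k_def by (simp add: mult_ac)
    ultimately show "\<exists>y. ((\<lambda>t. exp (k * t) * E t f) has_real_derivative y) (at t) \<and> 0 \<le> y" by blast
  qed
  moreover have "exp (k * (pi / 2)) \<le> exp 1"
  proof -
    \<comment> \<open>With pi/2 < 2 and k <= 1/16 the exponent stays below 1, and exp 1 <= 3 is the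
      constant claimed.\<close>
    have "k * (pi / 2) \<le> 1 / 16 * 2"
      unfolding k_def using \<beta>_le pi_less_4 by (intro mult_mono) auto
    then have "k * (pi / 2) \<le> 1" by linarith
    then show ?thesis by (simp only: exp_le_cancel_iff)
  qed
  moreover have "1 \<le> exp (k * \<theta>)" using \<theta> by (simp add: k_def)
  ultimately have "1 * E \<theta> f \<le> exp 1 * E (pi / 2) f"
    using E0 by (meson mult_right_mono order_trans)
  also have "\<dots> \<le> 3 * E (pi / 2) f" using exp_le E0 by (intro mult_right_mono) auto
  finally show ?thesis by simp
qed

lemma E_abs_nonneg: "0 \<le> E \<theta> (\<lambda>s. \<bar>f s\<bar>)"
  using Eav_mono[of 10 "\<lambda>_. 0" "\<lambda>s. \<bar>f s\<bar>" \<theta>] by (simp add: Eav_const)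

text \<open>Mean value inequality on an interval of length below 2; the derivative is bounded by
  \<open>E_compare\<close>, whence 6 = 2 * 3. The bound on \<open>n\<close> leaves room for the two
  replicas added by \<open>L\<close>.\<close>

lemma E_first_order:
  assumes f: "dep n f" "n \<le> 6" and \<theta>: "0 \<le> \<theta>" "\<theta> \<le> pi / 2"
  shows "\<bar>E \<theta> f - E 0 f\<bar> \<le> 6 * \<beta>\<^sup>2 * E (pi / 2) (\<lambda>s. \<bar>f s * L n s\<bar>)"
proof -
  define M where "M = E (pi / 2) (\<lambda>s. \<bar>f s * L n s\<bar>)"
  have M: "0 \<le> M" unfolding M_def by (rule E_abs_nonneg)
  have b: "\<bar>sin t * cos t * \<beta>\<^sup>2 * E t (\<lambda>s. f s * L n s)\<bar> \<le> (1 * \<beta>\<^sup>2) * (3 * M)" if "0 \<le> t" "t \<le> pi / 2" for t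
  proof (intro abs_mult_le abs_sin_cos_le)
    have "dep (Suc (Suc n)) (\<lambda>s. \<bar>f s * L n s\<bar>)"
      by (intro dep_intros dep_L dep_mono[OF f(1)]) auto
    from E_compare[OF this _ abs_ge_zero that] f(2)
    show "\<bar>E t (\<lambda>s. f s * L n s)\<bar> \<le> 3 * M"
      unfolding M_def by (intro order_trans[OF Eav_abs_le]) simp
  qed auto
  have "norm (E \<theta> f - E 0 f) \<le> (1 * \<beta>\<^sup>2) * (3 * M) * norm (\<theta> - 0)"
  proof (rule field_differentiable_bound[of "{0..pi/2}" "\<lambda>\<theta>. E \<theta> f"
        "\<lambda>t. sin t * cos t * \<beta>\<^sup>2 * E t (\<lambda>s. f s * L n s)"])
    fix t assume "t \<in> {0..pi/2}"
    then show "norm (sin t * cos t * \<beta>\<^sup>2 * E t (\<lambda>s. f s * L n s)) \<le> 1 * \<beta>\<^sup>2 * (3 * M)"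
      unfolding real_norm_def by (intro b) auto
    show "((\<lambda>\<theta>. E \<theta> f) has_real_derivative sin t * cos t * \<beta>\<^sup>2 * E t (\<lambda>s. f s * L n s)) (at t within {0..pi/2})"
      using f by (auto intro: has_field_derivative_at_within[OF E_DERIV])
  qed (use \<theta> in auto)
  also have "\<dots> \<le> (1 * \<beta>\<^sup>2) * (3 * M) * 2"
    using \<theta> pi_less_4 M by (intro mult_left_mono) auto
  finally have "norm (E \<theta> f - E 0 f) \<le> 1 * \<beta>\<^sup>2 * (3 * M) * 2" .
  then show ?thesis unfolding M_def[symmetric] by simp
qed

lemma E_second_order:
  assumes f: "dep n f" "n \<le> 4"
  shows "\<bar>E (pi / 2) f - E 0 f - \<beta>\<^sup>2 / 2 * E 0 (\<lambda>s. f s * L n s)\<bar>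
     \<le> 12 * \<beta> ^ 4 * E (pi / 2) (\<lambda>s. \<bar>f s * L n s * L (Suc (Suc n)) s\<bar>)"
proof -
  let ?fL = "\<lambda>s. f s * L n s"
  define M where "M = E (pi / 2) (\<lambda>s. \<bar>?fL s * L (Suc (Suc n)) s\<bar>)"
  have M: "0 \<le> M" unfolding M_def by (rule E_abs_nonneg)
  \<comment> \<open>As sin^2/2 is a primitive of sin cos, \<open>\<phi>\<close> removes the first
    order part exactly; what is left in its derivative is a first order difference for f times
    L.\<close>
  define \<phi> where "\<phi> t = E t f - (sin t)\<^sup>2 * (\<beta>\<^sup>2 / 2 * E 0 ?fL)" for t
  have d: "(\<phi> has_real_derivative sin t * cos t * \<beta>\<^sup>2 * (E t ?fL - E 0 ?fL)) (at t)" for t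
    unfolding \<phi>_def[abs_def] using f
    by (auto intro!: derivative_eq_intros E_DERIV simp: algebra_simps)
  have b: "\<bar>sin t * cos t * \<beta>\<^sup>2 * (E t ?fL - E 0 ?fL)\<bar> \<le> (1 * \<beta>\<^sup>2) * (6 * \<beta>\<^sup>2 * M)" if "0 \<le> t" "t \<le> pi / 2" for t
  proof (intro abs_mult_le abs_sin_cos_le)
    have "dep (Suc (Suc n)) ?fL"
      by (intro dep_intros dep_L dep_mono[OF f(1)]) auto
    from E_first_order[OF this _ that] f(2)
    show "\<bar>E t ?fL - E 0 ?fL\<bar> \<le> 6 * \<beta>\<^sup>2 * M" unfolding M_def by linarith
  qed auto
  have "norm (\<phi> (pi / 2) - \<phi> 0) \<le> (1 * \<beta>\<^sup>2) * (6 * \<beta>\<^sup>2 * M) * norm (pi / 2 - 0)"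
  proof (rule field_differentiable_bound[of "{0..pi/2}" \<phi>
        "\<lambda>t. sin t * cos t * \<beta>\<^sup>2 * (E t ?fL - E 0 ?fL)"])
    fix t assume "t \<in> {0..pi/2}"
    then show "norm (sin t * cos t * \<beta>\<^sup>2 * (E t ?fL - E 0 ?fL)) \<le> 1 * \<beta>\<^sup>2 * (6 * \<beta>\<^sup>2 * M)"
      unfolding real_norm_def by (intro b) auto
    show "(\<phi> has_real_derivative sin t * cos t * \<beta>\<^sup>2 * (E t ?fL - E 0 ?fL)) (at t within {0..pi/2})"
      by (rule has_field_derivative_at_within[OF d])
  qed auto
  also have "\<dots> \<le> (1 * \<beta>\<^sup>2) * (6 * \<beta>\<^sup>2 * M) * 2"
    using pi_less_4 M by (intro mult_left_mono) auto
  finally have "norm (\<phi> (pi / 2) - \<phi> 0) \<le> 1 * \<beta>\<^sup>2 * (6 * \<beta>\<^sup>2 * M) * 2" .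
  then show ?thesis
    unfolding \<phi>_def M_def[symmetric] by (simp add: power4_eq_xxxx power2_eq_square mult_ac)
qed

section \<open>The endpoint of the path is the model\<close>

lemma ham_pi_half: "ham (pi / 2) g \<sigma> = hamiltonian N \<beta> h D g \<sigma>"
proof -
  have 0: "(0, 0) \<notin> pairs N" by (auto simp: pairs_def)
  have "(\<Sum>k\<in>pairs N. cx (pi / 2) k \<sigma> * g k) = (\<Sum>k\<in>pairs N. \<beta> / sqrt (real N) * (g k * \<sigma> (fst k) * \<sigma> (snd k)))"
    using 0 by (intro sum.cong refl) (auto simp: cx_def)
  also have "\<dots> = \<beta> / sqrt (real N) * (\<Sum>(i, j)\<in>pairs N. g (i, j) * \<sigma> i * \<sigma> j)"
    by (simp add: sum_distrib_left case_prod_unfold)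
  finally have 1: "(\<Sum>k\<in>pairs N. cx (pi / 2) k \<sigma> * g k) = \<dots>" .
  show ?thesis
    unfolding ham_def hamiltonian_def 1[symmetric] cc_def using 0 finite_pairs by (simp add: cx_def[of _ "(0, 0)"])
qed

text \<open>At this end the field coordinate (0, 0) has coefficient zero and integrates out.\<close>

lemma Eav_pi_half: "Eav l (pi / 2) f = nu_rep S N \<beta> h D l f"
proof -
  have 0: "(0, 0) \<notin> pairs N" by (auto simp: pairs_def)
  have upd: "av l (pi / 2) (g((0, 0) := y)) f = av l (pi / 2) g f" for g y
  proof -
    have "ham (pi / 2) (g((0, 0) := y)) = ham (pi / 2) g"
      unfolding ham_def using 0 finite_pairs
      by (auto simp: fun_eq_iff cx_def[of _ "(0, 0)"] intro!: sum.cong)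
    then show ?thesis unfolding av_def by simp
  qed
  have "Eav l (pi / 2) f = (\<integral>g. (\<integral>y. av l (pi / 2) g f \<partial>std_normal_distribution) \<partial>gauss (pairs N))"
    unfolding Eav_def using gauss_integral_insert[OF finite_pairs 0 integrable_av] by (simp only: upd)
  also have "\<dots> = (\<integral>g. av l (pi / 2) g f \<partial>gauss (pairs N))"
    using prob_space.prob_space[OF prob_space_normal_density[of 1 0]] by simp
  also have "\<dots> = nu_rep S N \<beta> h D l f"
    unfolding nu_rep_def nu_def disorder_def gauss_def av_def gibbs_weight_def ham_pi_half[abs_def] ..
  finally show ?thesis .
qed

end

section \<open>The decoupled site\<close>

definition psite :: "nat \<Rightarrow> real \<Rightarrow> real \<Rightarrow> real \<Rightarrow> real \<Rightarrow> real \<Rightarrow> real \<Rightarrow> real \<Rightarrow> real" where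
  "psite S \<beta> h D p q \<eta> = softmax (spins S) (\<lambda>s. \<beta> * sqrt q * \<eta> * s + h * s + (D + \<beta>\<^sup>2 / 2 * (p - q)) * s\<^sup>2)"

lemma psite_prb: "prb (spins S) (psite S \<beta> h D p q \<eta>)"
  unfolding psite_def by (rule softmax_prb[OF finite_spins spins_nonempty])

lemma psite_wt: "psite S \<beta> h D p q \<eta> s = wt \<beta> h D p q \<eta> s / (\<Sum>s\<in>spins S. wt \<beta> h D p q \<eta> s)"
  by (simp add: psite_def softmax_def wt_def)

lemma mom_psite: "(\<Sum>s\<in>spins S. psite S \<beta> h D p q \<eta> s * s ^ k) = mom S \<beta> h D p q k \<eta>"
  unfolding psite_wt mom_def by (simp add: sum_divide_distrib mult.commute)

text \<open>All ten replicas share one field \<open>\<eta>\<close>: they are independent given it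
  and become correlated by the average over it.\<close>

definition siteE :: "nat \<Rightarrow> real \<Rightarrow> real \<Rightarrow> real \<Rightarrow> real \<Rightarrow> real \<Rightarrow> ((nat \<Rightarrow> real) \<Rightarrow> real) \<Rightarrow> real" where
  "siteE S \<beta> h D p q \<phi> = Eeta (\<lambda>\<eta>. rep (spins S) (psite S \<beta> h D p q \<eta>) 10 \<phi>)"

lemma Eeta_eq:
  "f \<in> borel_measurable borel \<Longrightarrow> Eeta f = integral\<^sup>L std_normal_distribution f"
  unfolding Eeta_def by (simp add: integral_std_normal)

lemma rep_site_measurable:
  "(\<lambda>\<eta>. rep (spins S) (psite S \<beta> h D p q \<eta>) n \<phi>) \<in> borel_measurable borel"
  unfolding psite_def by (rule borel_measurable_rep) measurable

lemma rep_0: "rep \<Omega> p 0 f = f (\<lambda>_. undefined)"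
  by (simp add: rep_def)

context cavity
begin

abbreviation "sm g \<equiv> softmax (config S N) (ham 0 g)"
abbreviation "J \<equiv> {..<N} - {i}"

text \<open>The Boltzmann weight of the system with site \<open>i\<close> removed.\<close>

definition rest :: "(nat \<times> nat \<Rightarrow> real) \<Rightarrow> (nat \<Rightarrow> real) \<Rightarrow> real" where
  "rest g \<sigma> = exp (D * (\<Sum>j\<in>J. (\<sigma> j)\<^sup>2) + h * (\<Sum>j\<in>J. \<sigma> j)
     + (\<Sum>k\<in>{k\<in>pairs N. fst k \<noteq> i \<and> snd k \<noteq> i}. \<beta> / sqrt (real N) * (\<sigma> (fst k) * \<sigma> (snd k)) * g k))"

lemma rest_upd: "rest g (\<sigma>(i := y)) = rest g \<sigma>"
  unfolding rest_def by (intro arg_cong[where f=exp] arg_cong2[where f="(+)"] arg_cong2[where f="(*)"] sum.cong refl) auto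

lemma rest_gupd: "rest (g((0, 0) := y)) \<sigma> = rest g \<sigma>"
  unfolding rest_def by (intro arg_cong[where f=exp] arg_cong2[where f="(+)"] arg_cong2[where f="(*)"] sum.cong refl) (auto simp: pairs_def)

lemma exp_ham_0: "exp (ham 0 g \<sigma>) = wt \<beta> h D p q (g (0, 0)) (\<sigma> i) * rest g \<sigma>"
proof -
  have 0: "(0, 0) \<notin> pairs N" by (auto simp: pairs_def)
  have N: "{..<N} = insert i J" using i by auto
  have 1: "(\<Sum>k\<in>pairs N. cx 0 k \<sigma> * g k)
      = (\<Sum>k\<in>{k\<in>pairs N. fst k \<noteq> i \<and> snd k \<noteq> i}. \<beta> / sqrt (real N) * (\<sigma> (fst k) * \<sigma> (snd k)) * g k)"
    unfolding sum.inter_filter[OF finite_pairs]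
    using 0 by (intro sum.cong refl) (auto simp: cx_def)
  have 2: "(\<Sum>j<N. \<sigma> j) = \<sigma> i + (\<Sum>j\<in>J. \<sigma> j)" "(\<Sum>j<N. (\<sigma> j)\<^sup>2) = (\<sigma> i)\<^sup>2 + (\<Sum>j\<in>J. (\<sigma> j)\<^sup>2)"
    using i by (simp_all add: sum.remove)
  have "ham 0 g \<sigma> = (\<beta> * sqrt q * g (0, 0) * \<sigma> i + h * \<sigma> i + (D + \<beta>\<^sup>2 / 2 * (p - q)) * (\<sigma> i)\<^sup>2)
     + (D * (\<Sum>j\<in>J. (\<sigma> j)\<^sup>2) + h * (\<Sum>j\<in>J. \<sigma> j)
     + (\<Sum>k\<in>{k\<in>pairs N. fst k \<noteq> i \<and> snd k \<noteq> i}. \<beta> / sqrt (real N) * (\<sigma> (fst k) * \<sigma> (snd k)) * g k))"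
    unfolding ham_def sum.insert[OF finite_pairs 0] 1 cc_def 2 by (simp add: cx_def algebra_simps)
  then show ?thesis unfolding wt_def rest_def by (simp only: exp_add)
qed

lemma sum_config: "(\<Sum>\<sigma>\<in>config S N. F \<sigma>) = (\<Sum>y\<in>spins S. \<Sum>\<tau>\<in>PiE J (\<lambda>_. spins S). F (\<tau>(i := y)))"
proof -
  have N: "{..<N} = insert i J" using i by auto
  have "config S N = (\<lambda>(y, g). g(i := y)) ` (spins S \<times> PiE J (\<lambda>_. spins S))"
    unfolding config_def using PiE_insert_eq[of i J "\<lambda>_. spins S"] by (simp only: N[symmetric])
  then have "(\<Sum>\<sigma>\<in>config S N. F \<sigma>) = (\<Sum>(y, \<tau>)\<in>spins S \<times> PiE J (\<lambda>_. spins S). F (\<tau>(i := y)))"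
    by (simp only:, subst sum.reindex[OF inj_combinator]) (auto simp: case_prod_unfold)
  then show ?thesis by (simp add: sum.cartesian_product)
qed

lemma sum_config_split:
  assumes "\<And>\<sigma> y. v (\<sigma>(i := y)) = v \<sigma>"
  shows "(\<Sum>\<sigma>\<in>config S N. u (\<sigma> i) * v \<sigma>) = (\<Sum>y\<in>spins S. u y) * (\<Sum>\<tau>\<in>PiE J (\<lambda>_. spins S). (v \<tau> :: real))"
  by (subst sum_config) (simp add: assms sum_product)

text \<open>At angle 0 the Boltzmann weight is a function of the spin at \<open>i\<close> times
  \<open>rest\<close>, so numerator and partition function both factor.\<close>

lemma one_site:
  assumes v: "\<And>\<sigma> y. v (\<sigma>(i := y)) = v \<sigma>"
  shows "(\<Sum>\<sigma>\<in>config S N. sm g \<sigma> * (u (\<sigma> i) * v \<sigma>))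
     = (\<Sum>y\<in>spins S. psite S \<beta> h D p q (g (0, 0)) y * u y)
       * ((\<Sum>\<tau>\<in>PiE J (\<lambda>_. spins S). rest g \<tau> * v \<tau>) / (\<Sum>\<tau>\<in>PiE J (\<lambda>_. spins S). rest g \<tau>))"
proof -
  let ?w = "wt \<beta> h D p q (g (0, 0))"
  have Z: "(\<Sum>\<tau>\<in>config S N. exp (ham 0 g \<tau>)) = (\<Sum>y\<in>spins S. ?w y) * (\<Sum>\<tau>\<in>PiE J (\<lambda>_. spins S). rest g \<tau>)"
    unfolding exp_ham_0 by (rule sum_config_split) (rule rest_upd)
  have "(\<Sum>\<sigma>\<in>config S N. exp (ham 0 g \<sigma>) * (u (\<sigma> i) * v \<sigma>))
      = (\<Sum>\<sigma>\<in>config S N. (?w (\<sigma> i) * u (\<sigma> i)) * (rest g \<sigma> * v \<sigma>))"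
    unfolding exp_ham_0 by (simp add: mult_ac)
  also have "\<dots> = (\<Sum>y\<in>spins S. ?w y * u y) * (\<Sum>\<tau>\<in>PiE J (\<lambda>_. spins S). rest g \<tau> * v \<tau>)"
    by (rule sum_config_split[where u="\<lambda>y. ?w y * u y"]) (simp add: rest_upd v)
  finally show ?thesis
    unfolding softmax_def Z psite_wt by (simp add: sum_divide_distrib[symmetric])
qed

lemma rest_pos: "0 < (\<Sum>\<tau>\<in>PiE J (\<lambda>_. spins S). rest g \<tau>)"
  by (intro sum_pos) (auto simp: rest_def PiE_eq_empty_iff spins_nonempty intro!: finite_PiE finite_spins)

lemma one_site_marginal:
  "(\<Sum>\<sigma>\<in>config S N. sm g \<sigma> * u (\<sigma> i)) = (\<Sum>y\<in>spins S. psite S \<beta> h D p q (g (0, 0)) y * u y)"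
  using one_site[of "\<lambda>_. 1" g u] rest_pos[of g] by simp

lemma one_site_factor:
  assumes v: "\<And>\<sigma> y. v (\<sigma>(i := y)) = v \<sigma>"
  shows "(\<Sum>\<sigma>\<in>config S N. sm g \<sigma> * (u (\<sigma> i) * v \<sigma>))
     = (\<Sum>\<sigma>\<in>config S N. sm g \<sigma> * u (\<sigma> i)) * (\<Sum>\<sigma>\<in>config S N. sm g \<sigma> * v \<sigma>)"
proof -
  have "(\<Sum>y\<in>spins S. psite S \<beta> h D p q (g (0, 0)) y * 1) = 1"
    using psite_prb[of S \<beta> h D p q "g (0, 0)"] by (simp add: prb_def)
  then show ?thesis
    using one_site[OF v, of g u] one_site[OF v, of g "\<lambda>_. 1"] unfolding one_site_marginal by simp
qed

lemma marginal_gupd: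
  assumes v: "\<And>\<sigma> y. v (\<sigma>(i := y)) = v \<sigma>"
  shows "(\<Sum>\<sigma>\<in>config S N. sm (g((0, 0) := x)) \<sigma> * v \<sigma>) = (\<Sum>\<sigma>\<in>config S N. sm g \<sigma> * v \<sigma>)"
proof -
  have "(\<Sum>y\<in>spins S. psite S \<beta> h D p q \<eta> y * 1) = 1" for \<eta>
    using psite_prb[of S \<beta> h D p q \<eta>] by (simp add: prb_def)
  then show ?thesis
    using one_site[OF v, of g "\<lambda>_. 1"] one_site[OF v, of "g((0, 0) := x)" "\<lambda>_. 1"] by (simp add: rest_gupd)
qed

text \<open>The replacement value at \<open>i\<close> may differ between replicas, since each
  carries its own configuration.\<close>

definition off_site :: "((nat \<Rightarrow> nat \<Rightarrow> real) \<Rightarrow> real) \<Rightarrow> bool" where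
  "off_site f \<longleftrightarrow> (\<forall>s y. f (\<lambda>a. (s a)(i := y a)) = f s)"

lemma off_site_upd: assumes "off_site f" shows "f (s(n := \<tau>(i := y))) = f (s(n := \<tau>))"
proof -
  have "(\<lambda>a. ((s(n := \<tau>)) a)(i := (if a = n then y else s a i))) = s(n := \<tau>(i := y))"
    by (auto simp: fun_eq_iff)
  then show ?thesis using assms unfolding off_site_def by metis
qed

lemma off_site_average:
  assumes "off_site f" shows "off_site (\<lambda>s. \<Sum>\<tau>\<in>\<Omega>. w \<tau> * f (s(n := \<tau>)))"
proof -
  have "f ((\<lambda>a. (s a)(i := y a))(n := \<tau>)) = f (s(n := \<tau>))" for s y \<tau>
  proof -
    have "(\<lambda>a. (s a)(i := y a))(n := \<tau>) = (\<lambda>a. ((s(n := \<tau>)) a)(i := (y(n := \<tau> i)) a))"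
      by (auto simp: fun_eq_iff)
    then show ?thesis using assms unfolding off_site_def by metis
  qed
  then show ?thesis by (simp add: off_site_def)
qed

text \<open>Induction on the replicas: summing out the last one by \<open>one_site_factor\<close>
  leaves a new function of the spins at \<open>i\<close> times a new off-site function.\<close>

lemma rep_factor:
  assumes "off_site f"
  shows "rep (config S N) (sm g) n (\<lambda>s. \<phi> (\<lambda>a. s a i) * f s)
     = rep (config S N) (sm g) n (\<lambda>s. \<phi> (\<lambda>a. s a i)) * rep (config S N) (sm g) n f"
  using assms
proof (induction n arbitrary: \<phi> f)
  case 0
  then show ?case by (simp add: rep_0)
next
  case (Suc n)
  have upd: "(\<lambda>a. (s(n := \<tau>)) a i) = (\<lambda>a. s a i)(n := \<tau> i)" for s :: "nat \<Rightarrow> nat \<Rightarrow> real" and \<tau>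
    by auto
  define \<phi>1 where "\<phi>1 z = (\<Sum>\<sigma>\<in>config S N. sm g \<sigma> * \<phi> (z(n := \<sigma> i)))" for z
  define f1 where "f1 s = (\<Sum>\<sigma>\<in>config S N. sm g \<sigma> * f (s(n := \<sigma>)))" for s
  have "(\<Sum>\<tau>\<in>config S N. sm g \<tau> * (\<phi> (\<lambda>a. (s(n := \<tau>)) a i) * f (s(n := \<tau>)))) = \<phi>1 (\<lambda>a. s a i) * f1 s" for s
    unfolding upd \<phi>1_def f1_def
    by (rule one_site_factor[where u="\<lambda>y. \<phi> ((\<lambda>a. s a i)(n := y))" and v="\<lambda>\<tau>. f (s(n := \<tau>))"])
       (rule off_site_upd[OF Suc.prems])
  moreover have "off_site f1" unfolding f1_def[abs_def] by (rule off_site_average[OF Suc.prems])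
  note Suc.IH[OF this, of \<phi>1]
  ultimately show ?case
    unfolding rep_Suc by (simp only: upd \<phi>1_def f1_def)
qed

lemma rep_site:
  assumes "dep n \<phi>"
  shows "rep (config S N) (sm g) n (\<lambda>s. \<phi> (\<lambda>a. s a i)) = rep (spins S) (psite S \<beta> h D p q (g (0, 0))) n \<phi>"
  using assms
proof (induction n arbitrary: \<phi>)
  case 0
  have "\<phi> (\<lambda>a. undefined i) = \<phi> (\<lambda>_. undefined)" by (rule depD[OF 0]) simp
  then show ?case by (simp add: rep_0)
next
  case (Suc n)
  have upd: "(\<lambda>a. (s(n := \<tau>)) a i) = (\<lambda>a. s a i)(n := \<tau> i)" for s :: "nat \<Rightarrow> nat \<Rightarrow> real" and \<tau>
    by auto
  let ?\<phi>1 = "\<lambda>z. \<Sum>y\<in>spins S. psite S \<beta> h D p q (g (0, 0)) y * \<phi> (z(n := y))"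
  have "dep n ?\<phi>1"
  proof (intro dep_sum dep_mult dep_const depI)
    fix y s t assume "\<And>a. a < n \<Longrightarrow> s a = (t a :: real)"
    then show "\<phi> (s(n := y)) = \<phi> (t(n := y))" by (intro depD[OF Suc.prems]) auto
  qed
  from Suc.IH[OF this] show ?case
    unfolding rep_Suc upd
    by (simp only: one_site_marginal[of g "\<lambda>y. \<phi> ((\<lambda>a. s a i)(n := y))" for s])
qed

text \<open>The field coordinate acts on the spin at \<open>i\<close> only. This is what separates
  the two disorder integrals in \<open>E0_factor\<close>.\<close>

lemma av_off_site_gupd:
  assumes "off_site f"
  shows "av n 0 (g((0, 0) := x)) f = av n 0 g f"
  unfolding av_def using assms
proof (induction n arbitrary: f)
  case 0
  then show ?case by (simp add: rep_0)
next
  case (Suc n)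
  have "(\<Sum>\<tau>\<in>config S N. sm (g((0, 0) := x)) \<tau> * f (s(n := \<tau>))) = (\<Sum>\<tau>\<in>config S N. sm g \<tau> * f (s(n := \<tau>)))" for s
    by (rule marginal_gupd) (rule off_site_upd[OF Suc.prems])
  then show ?case
    unfolding rep_Suc by (simp only: Suc.IH[OF off_site_average[OF Suc.prems]])
qed

lemma E0_site:
  assumes "dep 10 \<phi>"
  shows "E 0 (\<lambda>s. \<phi> (\<lambda>a. s a i)) = siteE S \<beta> h D p q \<phi>"
proof -
  have 0: "(0, 0) \<notin> pairs N" by (auto simp: pairs_def)
  have "E 0 (\<lambda>s. \<phi> (\<lambda>a. s a i)) = (\<integral>g. (\<integral>\<eta>. rep (spins S) (psite S \<beta> h D p q \<eta>) 10 \<phi> \<partial>std_normal_distribution) \<partial>gauss (pairs N))"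
    unfolding Eav_def gauss_integral_insert[OF finite_pairs 0 integrable_av]
    unfolding av_def rep_site[OF assms] fun_upd_same ..
  also have "\<dots> = siteE S \<beta> h D p q \<phi>"
    using prob_space.prob_space[OF prob_space_gauss, of "pairs N"]
    unfolding siteE_def Eeta_eq[OF rep_site_measurable] by simp
  finally show ?thesis .
qed

text \<open>Two independences combine: for fixed disorder site \<open>i\<close> factors from the
  rest, and the site factor depends on the field coordinate alone, the other one on the couplings
  alone.\<close>

lemma E0_factor:
  assumes \<phi>: "dep 10 \<phi>" and f: "off_site f"
  shows "E 0 (\<lambda>s. \<phi> (\<lambda>a. s a i) * f s) = siteE S \<beta> h D p q \<phi> * E 0 f"
proof -
  have 0: "(0, 0) \<notin> pairs N" by (auto simp: pairs_def)
  have "E 0 (\<lambda>s. \<phi> (\<lambda>a. s a i) * f s)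
      = (\<integral>g. (\<integral>\<eta>. rep (spins S) (psite S \<beta> h D p q \<eta>) 10 \<phi> * av 10 0 g f \<partial>std_normal_distribution) \<partial>gauss (pairs N))"
    unfolding Eav_def gauss_integral_insert[OF finite_pairs 0 integrable_av]
    unfolding av_def rep_factor[OF f] rep_site[OF \<phi>] av_off_site_gupd[OF f, unfolded av_def] fun_upd_same ..
  also have "\<dots> = (\<integral>g. siteE S \<beta> h D p q \<phi> * av 10 0 g f \<partial>gauss (pairs N))"
    unfolding siteE_def Eeta_eq[OF rep_site_measurable] by simp
  also have "\<dots> = siteE S \<beta> h D p q \<phi> * (\<integral>g. av 10 0 g f \<partial>gauss (pairs N))" by simp
  also have "(\<integral>g. av 10 0 g f \<partial>gauss (pairs N)) = E 0 f"
    using prob_space.prob_space[OF prob_space_normal_density[of 1 0]]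
    unfolding Eav_def gauss_integral_insert[OF finite_pairs 0 integrable_av] av_off_site_gupd[OF f] by simp
  finally show ?thesis .
qed

lemma off_site_rm: "off_site (rm a b)"
  unfolding off_site_def rm_def by (auto intro!: sum.cong arg_cong2[where f="(/)"])

lemma off_site_mult: "off_site f \<Longrightarrow> off_site f' \<Longrightarrow> off_site (\<lambda>s. f s * f' s)"
  and off_site_power: "off_site f \<Longrightarrow> off_site (\<lambda>s. f s ^ k)"
  by (auto simp: off_site_def)

end

section \<open>Replica symmetry and one-site moments\<close>

text \<open>The indices left over are equally many on both sides and are matched by an arbitrary
  bijection. Any pattern of distinct replicas can thus be taken to be 0, 1, 2, ...\<close>

lemma ex_permutes_nth:
  assumes "distinct xs" "set xs \<subseteq> {..<n::nat}"
  shows "\<exists>\<pi>. \<pi> permutes {..<n} \<and> (\<forall>k<length xs. \<pi> k = xs ! k)"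
proof -
  have le: "length xs \<le> n"
    using card_mono[OF _ assms(2)] distinct_card[OF assms(1)] by simp
  have "card ({..<n} - {..<length xs}) = card ({..<n} - set xs)"
    using le assms distinct_card[OF assms(1)] by (simp add: card_Diff_subset)
  then obtain f where f: "bij_betw f ({..<n} - {..<length xs}) ({..<n} - set xs)"
    using finite_same_card_bij[of "{..<n} - {..<length xs}" "{..<n} - set xs"] by auto
  define \<pi> where "\<pi> k = (if k < length xs then xs ! k else if k < n then f k else k)" for k
  have "bij_betw \<pi> ({..<length xs} \<union> ({..<n} - {..<length xs})) (set xs \<union> ({..<n} - set xs))"
  proof (rule bij_betw_combine)
    show "bij_betw \<pi> {..<length xs} (set xs)"
      using bij_betw_nth[OF assms(1) refl refl] by (rule bij_betw_cong[THEN iffD1, rotated]) (auto simp: \<pi>_def)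
    show "bij_betw \<pi> ({..<n} - {..<length xs}) ({..<n} - set xs)"
      using f by (rule bij_betw_cong[THEN iffD1, rotated]) (auto simp: \<pi>_def)
  qed auto
  moreover have "{..<length xs} \<union> ({..<n} - {..<length xs}) = {..<n}" "set xs \<union> ({..<n} - set xs) = {..<n}"
    using le assms(2) by auto
  ultimately have "bij_betw \<pi> {..<n} {..<n}" by simp
  then have "\<pi> permutes {..<n}"
    by (rule bij_imp_permutes) (use le in \<open>auto simp: \<pi>_def\<close>)
  then show ?thesis by (auto simp: \<pi>_def)
qed

text \<open>The orbits of pairs of unordered replica pairs under permutation of the replicas. The centered
  overlap of two replicas splits as \<open>T\<^sub>1\<^sub>2 + T\<^sub>1 + T\<^sub>2 + T\<close> with variances \<open>A\<^sub>2\<^sup>2, A\<^sub>1\<^sup>2, A\<^sub>1\<^sup>2, A\<^sub>0\<^sup>2\<close>, the centered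
  self-overlap as \<open>S\<^sub>1 + S\<close> with variances \<open>B\<^sub>1\<^sup>2, B\<^sub>0\<^sup>2\<close>, and \<open>C\<^sub>1\<^sup>2, C\<^sub>0\<^sup>2\<close> are the cross covariances.\<close>

definition cls :: "real \<Rightarrow> real \<Rightarrow> real \<Rightarrow> real \<Rightarrow> real \<Rightarrow> real \<Rightarrow> real \<Rightarrow> nat \<Rightarrow> nat \<Rightarrow> nat \<Rightarrow> nat \<Rightarrow> real" where
  "cls c2 c1 c0 d1 d0 e1 e0 a b c d =
    (if a = b then if c = d then if a = c then d1 else d0 else if a = c \<or> a = d then e1 else e0
     else if c = d then if a = c \<or> b = c then e1 else e0
     else if a = c \<and> b = d \<or> a = d \<and> b = c then c2
     else if a = c \<or> a = d \<or> b = c \<or> b = d then c1 else c0)"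

text \<open>Invariance leaves only the coincidence pattern of the four indices, and there are
  fifteen patterns. Swapping inside a pair and swapping the pairs merge them into seven.\<close>

lemma symmetric_eq_cls:
  fixes Y :: "nat \<Rightarrow> nat \<Rightarrow> nat \<Rightarrow> nat \<Rightarrow> real"
  assumes perm: "\<And>\<pi> a b c d. \<pi> permutes {..<n} \<Longrightarrow> Y (\<pi> a) (\<pi> b) (\<pi> c) (\<pi> d) = Y a b c d"
    and sym: "\<And>a b c d. Y a b c d = Y b a c d" "\<And>a b c d. Y a b c d = Y c d a b"
    and lt: "a < n" "b < n" "c < n" "d < n"
  shows "Y a b c d = cls (Y 0 1 0 1) (Y 0 1 0 2) (Y 0 1 2 3) (Y 0 0 0 0) (Y 0 0 1 1) (Y 0 0 0 1) (Y 0 0 1 2) a b c d"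
proof -
  have sym': "Y a b c d = Y a b d c" for a b c d using sym by metis
  have c0: "Y a b c d = Y 0 1 2 3" if "distinct [a, b, c, d]" "set [a, b, c, d] \<subseteq> {..<n}" for a b c d
  proof -
    from ex_permutes_nth[OF that] obtain \<pi> where "\<pi> permutes {..<n}" "\<forall>k<4. \<pi> k = [a, b, c, d] ! k" by auto
    with perm[of \<pi> 0 1 2 3] show ?thesis by simp
  qed
  have c1: "Y a b a c = Y 0 1 0 2" "Y a a b c = Y 0 0 1 2" if "distinct [a, b, c]" "set [a, b, c] \<subseteq> {..<n}" for a b c
  proof -
    from ex_permutes_nth[OF that] obtain \<pi> where "\<pi> permutes {..<n}" "\<forall>k<3. \<pi> k = [a, b, c] ! k" by auto
    with perm[of \<pi> 0 1 0 2] perm[of \<pi> 0 0 1 2] show "Y a b a c = Y 0 1 0 2" "Y a a b c = Y 0 0 1 2" by simp_all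
  qed
  have c2: "Y a b a b = Y 0 1 0 1" "Y a a b b = Y 0 0 1 1" "Y a a a b = Y 0 0 0 1"
    if "distinct [a, b]" "set [a, b] \<subseteq> {..<n}" for a b
  proof -
    from ex_permutes_nth[OF that] obtain \<pi> where "\<pi> permutes {..<n}" "\<forall>k<2. \<pi> k = [a, b] ! k" by auto
    with perm[of \<pi> 0 1 0 1] perm[of \<pi> 0 0 1 1] perm[of \<pi> 0 0 0 1]
    show "Y a b a b = Y 0 1 0 1" "Y a a b b = Y 0 0 1 1" "Y a a a b = Y 0 0 0 1" by simp_all
  qed
  have c3: "Y a a a a = Y 0 0 0 0" if "a < n" for a
  proof -
    from ex_permutes_nth[of "[a]" n] that obtain \<pi> where "\<pi> permutes {..<n}" "\<forall>k<1. \<pi> k = [a] ! k" by auto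
    with perm[of \<pi> 0 0 0 0] show ?thesis by simp
  qed
  consider "a = b" "c = d" "a = c" | "a = b" "c = d" "a \<noteq> c" | "a = b" "c \<noteq> d" "a = c" | "a = b" "c \<noteq> d" "a = d"
    | "a = b" "c \<noteq> d" "a \<noteq> c" "a \<noteq> d" | "a \<noteq> b" "c = d" "a = c" | "a \<noteq> b" "c = d" "b = c"
    | "a \<noteq> b" "c = d" "a \<noteq> c" "b \<noteq> c" | "a \<noteq> b" "c \<noteq> d" "a = c" "b = d" | "a \<noteq> b" "c \<noteq> d" "a = d" "b = c"
    | "a \<noteq> b" "c \<noteq> d" "a = c" "b \<noteq> d" | "a \<noteq> b" "c \<noteq> d" "a = d" "b \<noteq> c"
    | "a \<noteq> b" "c \<noteq> d" "b = c" "a \<noteq> d" | "a \<noteq> b" "c \<noteq> d" "b = d" "a \<noteq> c"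
    | "a \<noteq> b" "c \<noteq> d" "a \<noteq> c" "a \<noteq> d" "b \<noteq> c" "b \<noteq> d" by metis
  then show ?thesis
  proof cases
    case 1 then show ?thesis using c3[of a] lt by (simp add: cls_def)
  next
    case 2 then show ?thesis using c2(2)[of a c] lt by (simp add: cls_def)
  next
    case 3 then show ?thesis using c2(3)[of a d] lt by (simp add: cls_def)
  next
    case 4 then show ?thesis using c2(3)[of a c] sym'[of a a a c] lt by (simp add: cls_def)
  next
    case 5 then show ?thesis using c1(2)[of a c d] lt by (simp add: cls_def)
  next
    case 6 then show ?thesis using c2(3)[of a b] sym(2)[of a b a a] lt by (simp add: cls_def)
  next
    case 7 then show ?thesis using c2(3)[of b a] sym(2)[of a b b b] sym'[of b b a b] lt by (simp add: cls_def)
  next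
    case 8 then show ?thesis using c1(2)[of c a b] sym(2)[of a b c c] lt by (simp add: cls_def)
  next
    case 9 then show ?thesis using c2(1)[of a b] lt by (simp add: cls_def)
  next
    case 10 then show ?thesis using c2(1)[of a b] sym'[of a b a b] lt by (simp add: cls_def)
  next
    case 11 then show ?thesis using c1(1)[of a b d] lt by (simp add: cls_def)
  next
    case 12 then show ?thesis using c1(1)[of a b c] sym'[of a b a c] lt by (simp add: cls_def)
  next
    case 13 then show ?thesis using c1(1)[of b a d] sym(1)[of b a b d] lt by (simp add: cls_def)
  next
    case 14 then show ?thesis using c1(1)[of b a c] sym(1)[of b a b c] sym'[of a b b c] lt by (simp add: cls_def)
  next
    case 15 then show ?thesis using c0[of a b c d] lt by (simp add: cls_def)
  qed
qed

section \<open>Averages over the Gaussian field of the decoupled site\<close>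

definition bounded_borel :: "(real \<Rightarrow> real) \<Rightarrow> bool" where
  "bounded_borel f \<longleftrightarrow> f \<in> borel_measurable borel \<and> (\<exists>C. \<forall>x. \<bar>f x\<bar> \<le> C)"

lemma bounded_borel_integrable:
  assumes "bounded_borel f" shows "integrable std_normal_distribution f"
proof -
  obtain C where "f \<in> borel_measurable borel" "\<And>x. \<bar>f x\<bar> \<le> C" using assms by (auto simp: bounded_borel_def)
  then show ?thesis
    by (intro finite_measure.integrable_const_bound[where B=C]
        prob_space.finite_measure[OF prob_space_normal_density]) auto
qed

lemma bounded_borel_Eeta: "bounded_borel f \<Longrightarrow> Eeta f = integral\<^sup>L std_normal_distribution f"
  by (rule Eeta_eq) (simp add: bounded_borel_def)

lemma bounded_borel_const: "bounded_borel (\<lambda>_. c)"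
  by (auto simp: bounded_borel_def)

lemma bounded_borel_add: "bounded_borel f \<Longrightarrow> bounded_borel f' \<Longrightarrow> bounded_borel (\<lambda>x. f x + f' x)"
  unfolding bounded_borel_def by (auto intro!: borel_measurable_add) (meson abs_triangle_ineq add_mono order_trans)

lemma bounded_borel_diff: "bounded_borel f \<Longrightarrow> bounded_borel f' \<Longrightarrow> bounded_borel (\<lambda>x. f x - f' x)"
  unfolding bounded_borel_def by (auto intro!: borel_measurable_diff) (meson abs_triangle_ineq4 add_mono order_trans)

lemma bounded_borel_mult: "bounded_borel f \<Longrightarrow> bounded_borel f' \<Longrightarrow> bounded_borel (\<lambda>x. f x * f' x)"
  unfolding bounded_borel_def by (auto intro!: borel_measurable_times) (meson abs_mult_le)

lemma bounded_borel_power: "bounded_borel f \<Longrightarrow> bounded_borel (\<lambda>x. f x ^ k)"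
  by (induction k) (auto intro: bounded_borel_const bounded_borel_mult)

lemma bounded_borel_prod: "(\<And>e. e \<in> A \<Longrightarrow> bounded_borel (f e)) \<Longrightarrow> bounded_borel (\<lambda>x. \<Prod>e\<in>A. f e x)"
  by (induction A rule: infinite_finite_induct) (auto intro: bounded_borel_const bounded_borel_mult)

lemma bounded_borel_rep: "bounded_borel (\<lambda>\<eta>. rep (spins S) (psite S \<beta> h D p q \<eta>) n \<phi>)"
  unfolding bounded_borel_def using rep_site_measurable rep_bounded[OF psite_prb] by blast

lemma bounded_borel_mom: "bounded_borel (mom S \<beta> h D p q k)"
proof -
  have "mom S \<beta> h D p q k = (\<lambda>\<eta>. rep (spins S) (psite S \<beta> h D p q \<eta>) 1 (\<lambda>z. \<Prod>a<1. z a ^ k))"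
    unfolding rep_prod[where n=1 and \<phi>="\<lambda>_ y. y ^ k", OF finite_spins] mom_psite by simp
  then show ?thesis using bounded_borel_rep by metis
qed

lemmas bounded_borel_intros = bounded_borel_const bounded_borel_add bounded_borel_diff bounded_borel_mult bounded_borel_power bounded_borel_prod bounded_borel_mom bounded_borel_rep

lemma Eeta_add: "bounded_borel f \<Longrightarrow> bounded_borel f' \<Longrightarrow> Eeta (\<lambda>x. f x + f' x) = Eeta f + Eeta f'"
  by (simp add: bounded_borel_Eeta bounded_borel_add bounded_borel_integrable)

lemma Eeta_diff: "bounded_borel f \<Longrightarrow> bounded_borel f' \<Longrightarrow> Eeta (\<lambda>x. f x - f' x) = Eeta f - Eeta f'"
  by (simp add: bounded_borel_Eeta bounded_borel_diff bounded_borel_integrable)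

lemma Eeta_cmult: "bounded_borel f \<Longrightarrow> Eeta (\<lambda>x. c * f x) = c * Eeta f"
  using bounded_borel_mult[OF bounded_borel_const, of f c] by (simp add: bounded_borel_Eeta)

lemma Eeta_const: "Eeta (\<lambda>_. c) = c"
  using bounded_borel_Eeta[OF bounded_borel_const] prob_space.prob_space[OF prob_space_normal_density[of 1 0]] by simp

lemma Eeta_mono: "bounded_borel f \<Longrightarrow> bounded_borel f' \<Longrightarrow> (\<And>x. f x \<le> f' x) \<Longrightarrow> Eeta f \<le> Eeta f'"
  by (simp add: bounded_borel_Eeta bounded_borel_integrable integral_mono)

lemma Eeta_abs_le:
  assumes "bounded_borel f" "\<And>x. \<bar>f x\<bar> \<le> C" shows "\<bar>Eeta f\<bar> \<le> C"
  using Eeta_mono[OF assms(1) bounded_borel_const, of C] Eeta_mono[OF bounded_borel_const assms(1), of "- C"] assms(2)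
  by (auto simp: Eeta_const abs_le_iff minus_le_iff)

lemma mom_abs_le: "\<bar>mom S \<beta> h D p q k \<eta>\<bar> \<le> real S ^ k"
proof -
  let ?p = "psite S \<beta> h D p q \<eta>"
  have p: "\<And>s. s \<in> spins S \<Longrightarrow> 0 \<le> ?p s" "sum ?p (spins S) = 1"
    using psite_prb[of S \<beta> h D p q \<eta>] by (auto simp: prb_def)
  have "\<bar>\<Sum>s\<in>spins S. ?p s * s ^ k\<bar> \<le> (\<Sum>s\<in>spins S. ?p s * real S ^ k)"
    by (intro order_trans[OF sum_abs] sum_mono)
       (auto simp: abs_mult power_abs p(1) intro!: mult_left_mono power_mono spins_abs_le)
  also have "\<dots> = real S ^ k" by (simp add: p(2) flip: sum_distrib_right)
  finally show ?thesis by (simp add: mom_psite)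
qed

lemma is_pq_bounds:
  assumes "is_pq S \<beta> h D p q"
  shows "0 \<le> q" "\<bar>q\<bar> \<le> (real S)\<^sup>2" "\<bar>p\<bar> \<le> (real S)\<^sup>2"
proof -
  have pq: "q = Eeta (\<lambda>\<eta>. (mom S \<beta> h D p q 1 \<eta>)\<^sup>2)" "p = Eeta (mom S \<beta> h D p q 2)"
    using assms unfolding is_pq_def by auto
  show "0 \<le> q"
    by (subst pq(1)) (use Eeta_mono[OF bounded_borel_const[of 0] bounded_borel_power[OF bounded_borel_mom, of S \<beta> h D p q 1 2]] in \<open>simp add: Eeta_const\<close>)
  show "\<bar>q\<bar> \<le> (real S)\<^sup>2"
  proof (subst pq(1), rule Eeta_abs_le)
    show "\<bar>(mom S \<beta> h D p q 1 x)\<^sup>2\<bar> \<le> (real S)\<^sup>2" for x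
      using power_mono[OF mom_abs_le[of S \<beta> h D p q 1 x], of 2] by simp
  qed (intro bounded_borel_intros)
  show "\<bar>p\<bar> \<le> (real S)\<^sup>2"
    by (subst pq(2), rule Eeta_abs_le) (intro bounded_borel_intros mom_abs_le)+
qed

text \<open>Replicas are independent given \<open>\<eta>\<close>, so a monomial splits into one-site
  moments before the average over the field.\<close>

lemma siteE_monomial:
  "siteE S \<beta> h D p q (\<lambda>z. \<Prod>a<10. z a ^ k a) = Eeta (\<lambda>\<eta>. \<Prod>a<10. mom S \<beta> h D p q (k a) \<eta>)"
  unfolding siteE_def
  unfolding rep_prod[where n=10 and \<phi>="\<lambda>a y. y ^ k a", OF finite_spins] mom_psite ..

lemma siteE_permute: "\<pi> permutes {..<10} \<Longrightarrow> siteE S \<beta> h D p q (\<lambda>z. \<phi> (z \<circ> \<pi>)) = siteE S \<beta> h D p q \<phi>"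
  unfolding siteE_def by (simp add: rep_permute)

lemma siteE_diff: "siteE S \<beta> h D p q (\<lambda>z. \<phi> z - \<psi> z) = siteE S \<beta> h D p q \<phi> - siteE S \<beta> h D p q \<psi>"
  unfolding siteE_def rep_diff by (intro Eeta_diff bounded_borel_intros)

lemma siteE_cmult: "siteE S \<beta> h D p q (\<lambda>z. c * \<phi> z) = c * siteE S \<beta> h D p q \<phi>"
  unfolding siteE_def rep_cmult by (intro Eeta_cmult bounded_borel_intros)

lemma siteE_const: "siteE S \<beta> h D p q (\<lambda>_. c) = c"
  unfolding siteE_def rep_const[OF psite_prb] by (rule Eeta_const)

lemma mom_0: "mom S \<beta> h D p q 0 \<eta> = 1"
  using mom_psite[of S \<beta> h D p q \<eta> 0] psite_prb[of S \<beta> h D p q \<eta>] by (simp add: prb_def)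

lemma siteE_monomial4:
  fixes k0 k1 k2 k3 :: nat
  shows "siteE S \<beta> h D p q (\<lambda>z. z 0 ^ k0 * z 1 ^ k1 * z 2 ^ k2 * z 3 ^ k3)
   = Eeta (\<lambda>\<eta>. mom S \<beta> h D p q k0 \<eta> * mom S \<beta> h D p q k1 \<eta> * mom S \<beta> h D p q k2 \<eta> * mom S \<beta> h D p q k3 \<eta>)"
proof -
  let ?k = "\<lambda>a::nat. if a = 0 then k0 else if a = 1 then k1 else if a = 2 then k2 else if a = 3 then k3 else 0"
  show ?thesis
    using siteE_monomial[of S \<beta> h D p q ?k]
    by (simp add: eval_nat_numeral lessThan_Suc mom_0 mult_ac)
qed

text \<open>This is where the fixed point equations enter: products of decoupled spins have
  precisely the means at which the overlaps are centered. A permutation of replicas reduces to the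
  pairs (0, 0) and (0, 1).\<close>

lemma siteE_pair:
  assumes pq: "is_pq S \<beta> h D p q" and ab: "a < 10" "b < 10"
  shows "siteE S \<beta> h D p q (\<lambda>z. z a * z b) = Qv p q a b"
proof (cases "a = b")
  case True
  from ex_permutes_nth[of "[a]" 10] ab obtain \<pi> where \<pi>: "\<pi> permutes {..<10}" "\<pi> 0 = a" by auto
  have "siteE S \<beta> h D p q (\<lambda>z. z a * z a) = siteE S \<beta> h D p q (\<lambda>z. z 0 * z 0)"
    using siteE_permute[OF \<pi>(1), of S \<beta> h D p q "\<lambda>z. z 0 * z 0"] \<pi>(2) by simp
  also have "\<dots> = p"
    using siteE_monomial4[of S \<beta> h D p q 2 0 0 0] pq by (simp add: mom_0 is_pq_def power2_eq_square)
  finally show ?thesis using True by (simp add: Qv_def)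
next
  case False
  from ex_permutes_nth[of "[a, b]" 10] ab False obtain \<pi>
    where \<pi>: "\<pi> permutes {..<10}" "\<forall>k<2. \<pi> k = [a, b] ! k" by auto
  have "siteE S \<beta> h D p q (\<lambda>z. z a * z b) = siteE S \<beta> h D p q (\<lambda>z. z 0 * z 1)"
    using siteE_permute[OF \<pi>(1), of S \<beta> h D p q "\<lambda>z. z 0 * z 1"] \<pi>(2) by simp
  also have "\<dots> = q"
    using siteE_monomial4[of S \<beta> h D p q 1 1 0 0] pq by (simp add: mom_0 is_pq_def power2_eq_square)
  finally show ?thesis using False by (simp add: Qv_def)
qed

section \<open>Second and fourth moments of the overlaps\<close>

text \<open>The larger of the two numbers, raised to the power k + 1, already bounds the
  product.\<close>

lemma power_mult_le_add:
  fixes x y :: real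
  assumes "0 \<le> x" "0 \<le> y" shows "x ^ k * y \<le> x ^ Suc k + y ^ Suc k"
proof (cases "x \<le> y")
  case True
  then have "x ^ k * y \<le> y ^ k * y" using assms by (intro mult_right_mono power_mono) auto
  moreover have "0 \<le> x ^ Suc k" using assms by simp
  ultimately show ?thesis by (simp add: mult.commute)
next
  case False
  then have "x ^ k * y \<le> x ^ k * x" using assms by (intro mult_left_mono) auto
  moreover have "0 \<le> y ^ Suc k" using assms by simp
  ultimately show ?thesis by (simp add: mult.commute)
qed

lemma abs_add_power_le:
  fixes x y :: real
  shows "\<bar>x + y\<bar> ^ k \<le> 2 ^ k * (\<bar>x\<bar> ^ k + \<bar>y\<bar> ^ k)"
proof -
  have "\<bar>x + y\<bar> ^ k \<le> (2 * max \<bar>x\<bar> \<bar>y\<bar>) ^ k" by (intro power_mono) auto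
  also have "\<dots> \<le> 2 ^ k * (\<bar>x\<bar> ^ k + \<bar>y\<bar> ^ k)"
    unfolding power_mult_distrib by (intro mult_left_mono) (auto simp: max_def)
  finally show ?thesis .
qed

lemma abs_mult3_le:
  fixes x y z :: real
  shows "\<bar>x\<bar> * \<bar>y\<bar> * \<bar>z\<bar> \<le> \<bar>x\<bar> ^ 3 + \<bar>y\<bar> ^ 3 + \<bar>z\<bar> ^ 3"
proof -
  define w where "w = max \<bar>x\<bar> (max \<bar>y\<bar> \<bar>z\<bar>)"
  have "\<bar>x\<bar> * \<bar>y\<bar> * \<bar>z\<bar> \<le> w * w * w"
    by (intro mult_mono) (auto simp: w_def)
  also have "\<dots> = w ^ 3" by (simp add: power3_eq_cube)
  also have "\<dots> \<le> \<bar>x\<bar> ^ 3 + \<bar>y\<bar> ^ 3 + \<bar>z\<bar> ^ 3" by (auto simp: w_def max_def)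
  finally show ?thesis .
qed

text \<open>The factor 1000000 makes the feedback 2304 beta^2 B^2 and 9216 beta^2 B^2 in the moment
  bounds, and the factor 80 beta^2 B^2 of the linear system, small enough to be absorbed.\<close>

locale cavity_pq =
  fixes S N i :: nat and \<beta> h D p q :: real
  assumes i: "i < N" and S: "1 \<le> S" and pq: "is_pq S \<beta> h D p q"
    and small: "\<beta>\<^sup>2 * ((real S)\<^sup>2)\<^sup>2 * 1000000 \<le> 1"
begin

sublocale cavity S N i \<beta> h D p q
proof
  have "0 \<le> \<beta>\<^sup>2 * ((real S)\<^sup>2)\<^sup>2" by simp
  then show "\<beta>\<^sup>2 * ((real S)\<^sup>2)\<^sup>2 * 10000 \<le> 1" using small by linarith
qed (use i S is_pq_bounds[OF pq] in auto)

abbreviation "V \<equiv> nu_rep S N \<beta> h D 10"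
abbreviation "ov \<equiv> ovl N p q"
abbreviation "ex a b s \<equiv> s a i * s b i - Qv p q a b"

lemmas V_add = Eav_add[of 10 "pi / 2", unfolded Eav_pi_half]
lemmas V_diff = Eav_diff[of 10 "pi / 2", unfolded Eav_pi_half]
lemmas V_cmult = Eav_cmult[of 10 "pi / 2", unfolded Eav_pi_half]
lemmas V_sum = Eav_sum[of 10 "pi / 2", unfolded Eav_pi_half]
lemmas V_const = Eav_const[of 10 "pi / 2", unfolded Eav_pi_half]
lemmas V_mono = Eav_mono[of 10 _ _ "pi / 2", unfolded Eav_pi_half]
lemmas V_cong = Eav_cong[of 10 _ _ "pi / 2", unfolded Eav_pi_half]
lemmas V_abs_le = Eav_abs_le[of 10 "pi / 2", unfolded Eav_pi_half]
lemmas V_permute = Eav_permute[of _ 10 "pi / 2", unfolded Eav_pi_half]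

lemma ov_rm: "ov a b s = rm a b s + s a i * s b i / real N"
  unfolding ovl_def rm_def using i by (simp add: sum.remove[of "{..<N}" i] add_divide_distrib)

lemma ov_rm_diff: "s \<in> Sp10 \<Longrightarrow> a < 10 \<Longrightarrow> b < 10 \<Longrightarrow> \<bar>ov a b s - rm a b s\<bar> \<le> B / real N"
  using prod_le[of s a b i] i by (simp add: ov_rm divide_right_mono)

lemma Qv_le: "\<bar>Qv p q a b\<bar> \<le> B"
  using pq_le by (simp add: Qv_def)

lemma ex_le: "s \<in> Sp10 \<Longrightarrow> a < 10 \<Longrightarrow> b < 10 \<Longrightarrow> \<bar>ex a b s\<bar> \<le> 2 * B"
  using prod_le[of s a b i] Qv_le[of a b] i by simp

lemma V_mult_L_le:
  assumes n: "n \<le> 8" and F: "\<And>s. s \<in> Sp10 \<Longrightarrow> 0 \<le> F s"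
    and Y: "\<And>a b. a < 10 \<Longrightarrow> b < 10 \<Longrightarrow> V (\<lambda>s. F s * \<bar>rm a b s\<bar>) \<le> Y"
  shows "V (\<lambda>s. F s * \<bar>L n s\<bar>) \<le> 4 * real n * (real n + 1) * (B * Y)"
proof -
  have "V (\<lambda>s. F s * \<bar>L n s\<bar>)
     \<le> V (\<lambda>s. \<Sum>a<Suc n. \<Sum>b<Suc (Suc n). (\<bar>coef n a\<bar> * \<bar>coef (Suc n) b\<bar> * B) * (F s * \<bar>rm a b s\<bar>))"
  proof (rule V_mono)
    fix s assume s: "s \<in> Sp10"
    from mult_left_mono[OF L_le[OF s n] F[OF s]]
    show "F s * \<bar>L n s\<bar> \<le> (\<Sum>a<Suc n. \<Sum>b<Suc (Suc n). (\<bar>coef n a\<bar> * \<bar>coef (Suc n) b\<bar> * B) * (F s * \<bar>rm a b s\<bar>))"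
      by (simp only: sum_distrib_left mult_ac)
  qed
  also have "\<dots> = (\<Sum>a<Suc n. \<Sum>b<Suc (Suc n). \<bar>coef n a\<bar> * \<bar>coef (Suc n) b\<bar> * (B * V (\<lambda>s. F s * \<bar>rm a b s\<bar>)))"
    unfolding V_sum V_cmult by (simp only: mult_ac)
  also have "\<dots> \<le> 4 * real n * (real n + 1) * (B * Y)"
    using n by (intro sum_coef_le mult_left_mono Y) auto
  finally show ?thesis .
qed

text \<open>At angle 0 the site is independent of \<open>f\<close>, and its centered product has
  mean zero by \<open>siteE_pair\<close>.\<close>

lemma E0_ex_factor:
  assumes "a < 10" "b < 10" "off_site f" shows "E 0 (\<lambda>s. ex a b s * f s) = 0"
proof -
  have "dep 10 (\<lambda>z. z a * z b - Qv p q a b)"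
    using assms by (intro dep_intros dep_comp[where y="\<lambda>x. x"]) auto
  from E0_factor[OF this assms(3)] show ?thesis
    by (simp add: siteE_diff siteE_const siteE_pair[OF pq assms(1,2)])
qed

lemma dep_ex: "a < n \<Longrightarrow> b < n \<Longrightarrow> dep n (ex a b)"
  by (intro dep_intros dep_comp[where y="\<lambda>x. x _"])

text \<open>The value at angle 0 vanishes, so only the first order remainder is left. Its
  \<open>L\<close> supplies one more overlap: a moment of degree k + 1 with the small prefactor
  beta^2.\<close>

lemma V_ex_rm_power:
  assumes ab: "a < 2" "b < 2" and R: "\<And>c d. c < 10 \<Longrightarrow> d < 10 \<Longrightarrow> V (\<lambda>s. \<bar>rm c d s\<bar> ^ Suc k) \<le> R"
  shows "\<bar>V (\<lambda>s. ex a b s * rm a b s ^ k)\<bar> \<le> 576 * (\<beta>\<^sup>2 * B\<^sup>2) * R"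
proof -
  have "dep 2 (\<lambda>s. ex a b s * rm a b s ^ k)"
    using ab by (intro dep_intros dep_ex dep_rm dep_power)
  from E_first_order[OF this, of "pi / 2"]
  have "\<bar>V (\<lambda>s. ex a b s * rm a b s ^ k)\<bar> \<le> 6 * \<beta>\<^sup>2 * V (\<lambda>s. \<bar>ex a b s * rm a b s ^ k * L 2 s\<bar>)"
    using E0_ex_factor[of a b "\<lambda>s. rm a b s ^ k"] ab off_site_power[OF off_site_rm, of a b k]
    unfolding Eav_pi_half by simp
  also have "V (\<lambda>s. \<bar>ex a b s * rm a b s ^ k * L 2 s\<bar>) \<le> V (\<lambda>s. (2 * B * \<bar>rm a b s\<bar> ^ k) * \<bar>L 2 s\<bar>)"
  proof (rule V_mono)
    fix s assume "s \<in> Sp10"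
    from ex_le[OF this, of a b] ab
    show "\<bar>ex a b s * rm a b s ^ k * L 2 s\<bar> \<le> (2 * B * \<bar>rm a b s\<bar> ^ k) * \<bar>L 2 s\<bar>"
      unfolding abs_mult[of _ "L 2 s"] abs_mult[of "ex a b s"] power_abs[symmetric]
      by (intro mult_right_mono) auto
  qed
  also have "V (\<lambda>s. (2 * B * \<bar>rm a b s\<bar> ^ k) * \<bar>L 2 s\<bar>) \<le> 4 * real 2 * (real 2 + 1) * (B * (2 * B * (R + R)))"
  proof (rule V_mult_L_le)
    fix c d :: nat assume cd: "c < 10" "d < 10"
    have "V (\<lambda>s. (2 * B * \<bar>rm a b s\<bar> ^ k) * \<bar>rm c d s\<bar>)
        \<le> V (\<lambda>s. 2 * B * (\<bar>rm a b s\<bar> ^ Suc k + \<bar>rm c d s\<bar> ^ Suc k))"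
      by (intro V_mono, subst mult.assoc) (intro mult_left_mono power_mult_le_add, auto)
    also have "\<dots> \<le> 2 * B * (R + R)"
      unfolding V_cmult V_add using R cd ab by (intro mult_left_mono add_mono) auto
    finally show "V (\<lambda>s. (2 * B * \<bar>rm a b s\<bar> ^ k) * \<bar>rm c d s\<bar>) \<le> 2 * B * (R + R)" .
  qed auto
  finally have "\<bar>V (\<lambda>s. ex a b s * rm a b s ^ k)\<bar> \<le> 6 * \<beta>\<^sup>2 * (4 * real 2 * (real 2 + 1) * (B * (2 * B * (R + R))))"
    by (simp add: mult_left_mono)
  then show ?thesis by (simp add: power2_eq_square algebra_simps)
qed

lemma V_rm_power:
  assumes "a < 10" "b < 10" "V (\<lambda>s. \<bar>ov a b s\<bar> ^ k) \<le> Y"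
  shows "V (\<lambda>s. \<bar>rm a b s\<bar> ^ k) \<le> 2 ^ k * (Y + (B / real N) ^ k)"
proof -
  have "V (\<lambda>s. \<bar>rm a b s\<bar> ^ k) \<le> V (\<lambda>s. 2 ^ k * (\<bar>ov a b s\<bar> ^ k + (B / real N) ^ k))"
  proof (rule V_mono)
    fix s assume s: "s \<in> Sp10"
    have "\<bar>rm a b s\<bar> ^ k \<le> 2 ^ k * (\<bar>ov a b s\<bar> ^ k + \<bar>rm a b s - ov a b s\<bar> ^ k)"
      using abs_add_power_le[of "ov a b s" "rm a b s - ov a b s" k] by simp
    also have "\<dots> \<le> 2 ^ k * (\<bar>ov a b s\<bar> ^ k + (B / real N) ^ k)"
      using ov_rm_diff[OF s assms(1,2)] by (intro mult_left_mono add_left_mono power_mono) auto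
    finally show "\<bar>rm a b s\<bar> ^ k \<le> \<dots>" .
  qed
  also have "\<dots> \<le> 2 ^ k * (Y + (B / real N) ^ k)"
    unfolding V_cmult V_add V_const using assms(3) by (intro mult_left_mono add_right_mono) auto
  finally show ?thesis .
qed

text \<open>Replacing the overlap by \<open>rm\<close> makes it ignore the site, so that
  \<open>V_ex_rm_power\<close> applies; the replacement costs 2 B^2 / N and is the source of the
  order 1/N.\<close>

lemma site_second_moment:
  assumes ab: "a < 2" "b < 2" and Y: "\<And>c d. c < 10 \<Longrightarrow> d < 10 \<Longrightarrow> V (\<lambda>s. \<bar>ov c d s\<bar> ^ 2) \<le> Y"
  shows "\<bar>V (\<lambda>s. ex a b s * ov a b s)\<bar> \<le> 2 * B\<^sup>2 / real N + 2304 * (\<beta>\<^sup>2 * B\<^sup>2) * (Y + (B / real N)\<^sup>2)"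
proof -
  have 1: "\<bar>V (\<lambda>s. ex a b s * rm a b s ^ 1)\<bar> \<le> 576 * (\<beta>\<^sup>2 * B\<^sup>2) * (2\<^sup>2 * (Y + (B / real N)\<^sup>2))"
    using V_rm_power[OF _ _ Y] by (intro V_ex_rm_power ab) (simp add: numeral_2_eq_2)
  have "\<bar>V (\<lambda>s. ex a b s * (ov a b s - rm a b s))\<bar> \<le> V (\<lambda>s. 2 * B * (B / real N))"
  proof (intro order_trans[OF V_abs_le] V_mono)
    fix s assume "s \<in> Sp10"
    then show "\<bar>ex a b s * (ov a b s - rm a b s)\<bar> \<le> 2 * B * (B / real N)"
      using ab by (intro abs_mult_le ex_le ov_rm_diff) auto
  qed
  then have 2: "\<bar>V (\<lambda>s. ex a b s * (ov a b s - rm a b s))\<bar> \<le> 2 * B * (B / real N)"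
    by (simp only: V_const)
  have "V (\<lambda>s. ex a b s * ov a b s) = V (\<lambda>s. ex a b s * rm a b s ^ 1) + V (\<lambda>s. ex a b s * (ov a b s - rm a b s))"
    unfolding V_add[symmetric] by (intro V_cong) (simp add: algebra_simps)
  with 1 2 show ?thesis by (simp add: power2_eq_square algebra_simps)
qed

lemma abs_cube_diff_le:
  fixes x y :: real
  shows "\<bar>x ^ 3 - y ^ 3\<bar> \<le> \<bar>x - y\<bar> * (2 * (\<bar>x\<bar> ^ 2 + \<bar>y\<bar> ^ 2))"
proof -
  have "x ^ 3 - y ^ 3 = (x - y) * (x\<^sup>2 + x * y + y\<^sup>2)" by (simp add: power3_eq_cube power2_eq_square algebra_simps)
  moreover have "\<bar>x\<^sup>2 + x * y + y\<^sup>2\<bar> \<le> 2 * (\<bar>x\<bar> ^ 2 + \<bar>y\<bar> ^ 2)"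
  proof -
    have "0 \<le> (x + y)\<^sup>2" "0 \<le> (x - y)\<^sup>2" "0 \<le> x\<^sup>2" "0 \<le> y\<^sup>2" by auto
    then show ?thesis unfolding power2_sum power2_diff power2_abs by (auto simp: abs_le_iff)
  qed
  ultimately show ?thesis by (simp add: abs_mult mult_left_mono)
qed

text \<open>The same argument with cubes. Passing from the overlap to \<open>rm\<close> costs 1/N
  times second moments, which will be of order 1/N themselves.\<close>

lemma site_fourth_moment:
  assumes ab: "a < 2" "b < 2" and Y: "\<And>c d. c < 10 \<Longrightarrow> d < 10 \<Longrightarrow> V (\<lambda>s. \<bar>ov c d s\<bar> ^ 2) \<le> Y"
    and Y4: "\<And>c d. c < 10 \<Longrightarrow> d < 10 \<Longrightarrow> V (\<lambda>s. \<bar>ov c d s\<bar> ^ 4) \<le> Y4"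
  shows "\<bar>V (\<lambda>s. ex a b s * ov a b s ^ 3)\<bar>
     \<le> 4 * B\<^sup>2 / real N * (5 * Y + 4 * (B / real N)\<^sup>2) + 9216 * (\<beta>\<^sup>2 * B\<^sup>2) * (Y4 + (B / real N) ^ 4)"
proof -
  have 1: "\<bar>V (\<lambda>s. ex a b s * rm a b s ^ 3)\<bar> \<le> 576 * (\<beta>\<^sup>2 * B\<^sup>2) * (2 ^ 4 * (Y4 + (B / real N) ^ 4))"
    using V_rm_power[OF _ _ Y4] by (intro V_ex_rm_power ab) simp
  have ab': "a < 10" "b < 10" using ab by auto
  have "\<bar>V (\<lambda>s. ex a b s * (ov a b s ^ 3 - rm a b s ^ 3))\<bar>
      \<le> V (\<lambda>s. 2 * B * (B / real N) * 2 * (\<bar>ov a b s\<bar> ^ 2 + \<bar>rm a b s\<bar> ^ 2))"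
  proof (intro order_trans[OF V_abs_le] V_mono)
    fix s assume s: "s \<in> Sp10"
    have "\<bar>ov a b s ^ 3 - rm a b s ^ 3\<bar> \<le> \<bar>ov a b s - rm a b s\<bar> * (2 * (\<bar>ov a b s\<bar> ^ 2 + \<bar>rm a b s\<bar> ^ 2))"
      by (rule abs_cube_diff_le)
    also have "\<dots> \<le> (B / real N) * (2 * (\<bar>ov a b s\<bar> ^ 2 + \<bar>rm a b s\<bar> ^ 2))"
      by (intro mult_right_mono ov_rm_diff s ab') auto
    finally have "\<bar>ex a b s * (ov a b s ^ 3 - rm a b s ^ 3)\<bar> \<le> 2 * B * ((B / real N) * (2 * (\<bar>ov a b s\<bar> ^ 2 + \<bar>rm a b s\<bar> ^ 2)))"
      by (intro abs_mult_le ex_le s ab')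
    then show "\<bar>ex a b s * (ov a b s ^ 3 - rm a b s ^ 3)\<bar> \<le> 2 * B * (B / real N) * 2 * (\<bar>ov a b s\<bar> ^ 2 + \<bar>rm a b s\<bar> ^ 2)"
      by (simp only: mult.assoc)
  qed
  also have "\<dots> \<le> 2 * B * (B / real N) * 2 * (Y + 2\<^sup>2 * (Y + (B / real N)\<^sup>2))"
    unfolding V_cmult V_add by (intro mult_left_mono add_mono Y V_rm_power ab') auto
  finally have 2: "\<bar>V (\<lambda>s. ex a b s * (ov a b s ^ 3 - rm a b s ^ 3))\<bar> \<le> \<dots>" .
  have "V (\<lambda>s. ex a b s * ov a b s ^ 3) = V (\<lambda>s. ex a b s * rm a b s ^ 3) + V (\<lambda>s. ex a b s * (ov a b s ^ 3 - rm a b s ^ 3))"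
    unfolding V_add[symmetric] by (intro V_cong) (simp add: algebra_simps)
  with 1 2 show ?thesis by (simp add: power2_eq_square algebra_simps)
qed

end

section \<open>Moment bounds from the average over all sites\<close>

locale model =
  fixes S N :: nat and \<beta> h D p q :: real
  assumes N: "1 \<le> N" and S: "1 \<le> S" and pq: "is_pq S \<beta> h D p q"
    and small: "\<beta>\<^sup>2 * ((real S)\<^sup>2)\<^sup>2 * 1000000 \<le> 1"
begin

lemma cavity_at: "i < N \<Longrightarrow> cavity_pq S N i \<beta> h D p q"
  using S pq small by (simp add: cavity_pq_def)

sublocale c: cavity_pq S N 0 \<beta> h D p q
  using N by (intro cavity_at) simp

abbreviation "V \<equiv> nu_rep S N \<beta> h D 10"
abbreviation "ov \<equiv> ovl N p q"
abbreviation "B \<equiv> (real S)\<^sup>2"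

text \<open>The centered overlap is the mean of its one-site summands, and each summand can be
  treated by the interpolation at its own site.\<close>

lemma V_average: "V (\<lambda>s. ov a b s * f s) = (\<Sum>i<N. V (\<lambda>s. (s a i * s b i - Qv p q a b) * f s)) / real N"
proof -
  have "ov a b s * f s = 1 / real N * (\<Sum>i<N. (s a i * s b i - Qv p q a b) * f s)" for s
  proof -
    have "ov a b s = (\<Sum>i<N. s a i * s b i - Qv p q a b) / real N"
      unfolding ovl_def using N by (simp add: sum_subtractf field_simps)
    then show ?thesis by (simp add: sum_distrib_right)
  qed
  then show ?thesis by (simp only: c.V_cmult c.V_sum) simp
qed

lemma V_average_le:
  assumes "\<And>i. i < N \<Longrightarrow> \<bar>V (\<lambda>s. (s a i * s b i - Qv p q a b) * f s) - y\<bar> \<le> Y"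
  shows "\<bar>V (\<lambda>s. ov a b s * f s) - y\<bar> \<le> Y"
proof -
  have "V (\<lambda>s. ov a b s * f s) - y = (\<Sum>i<N. V (\<lambda>s. (s a i * s b i - Qv p q a b) * f s) - y) / real N"
    unfolding V_average using N by (simp add: sum_subtractf field_simps)
  also have "\<bar>\<dots>\<bar> \<le> (\<Sum>i<N. Y) / real N"
    unfolding abs_divide abs_of_nat
    by (intro divide_right_mono order_trans[OF sum_abs] sum_mono assms) auto
  also have "\<dots> = Y" using N by simp
  finally show ?thesis .
qed

lemma ov_permute: assumes "\<pi> permutes {..<10::nat}" shows "ov (\<pi> a) (\<pi> b) s = ov a b (s \<circ> \<pi>)"
  using inj_eq[OF permutes_inj[OF assms]] by (simp add: ovl_def Qv_def)

lemma V_ov_cases: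
  assumes "a < 10" "b < 10"
  shows "V (\<lambda>s. \<psi> (ov a b s)) = V (\<lambda>s. \<psi> (ov 0 (if a = b then 0 else 1) s))"
proof -
  have "\<exists>\<pi>. \<pi> permutes {..<10} \<and> \<pi> 0 = a \<and> \<pi> (if a = b then 0 else 1) = b"
  proof (cases "a = b")
    case True
    with ex_permutes_nth[of "[a]" 10] assms show ?thesis by auto
  next
    case False
    with ex_permutes_nth[of "[a, b]" 10] assms show ?thesis by (auto simp: less_2_cases_iff)
  qed
  then obtain \<pi> where \<pi>: "\<pi> permutes {..<10}" "\<pi> 0 = a" "\<pi> (if a = b then 0 else 1) = b" by blast
  show ?thesis
    using c.V_permute[OF \<pi>(1), of "\<lambda>s. \<psi> (ov 0 (if a = b then 0 else 1) s)"]
    unfolding ov_permute[OF \<pi>(1), symmetric] \<pi>(2,3) .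
qed

text \<open>One pair of distinct replicas and one self-overlap represent all pairs. Their sum is a
  single quantity in which the estimate closes.\<close>

definition moment_sum :: "nat \<Rightarrow> real" where
  "moment_sum k = V (\<lambda>s. \<bar>ov 0 1 s\<bar> ^ k) + V (\<lambda>s. \<bar>ov 0 0 s\<bar> ^ k)"

lemma V_ov_le_moment_sum: "a < 10 \<Longrightarrow> b < 10 \<Longrightarrow> V (\<lambda>s. \<bar>ov a b s\<bar> ^ k) \<le> moment_sum k"
proof -
  have "0 \<le> V (\<lambda>s. \<bar>ov a b s\<bar> ^ k)" for a b
    using c.V_mono[of "\<lambda>_. 0" "\<lambda>s. \<bar>ov a b s\<bar> ^ k"] by (simp add: c.V_const)
  then show "a < 10 \<Longrightarrow> b < 10 \<Longrightarrow> V (\<lambda>s. \<bar>ov a b s\<bar> ^ k) \<le> moment_sum k"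
    using V_ov_cases[of a b "\<lambda>x. \<bar>x\<bar> ^ k"] by (auto simp: moment_sum_def)
qed

lemma \<beta>B: "\<beta>\<^sup>2 * B\<^sup>2 \<le> 1 / 1000000"
  using small by simp

lemma BN: "(B / real N)\<^sup>2 \<le> B\<^sup>2 / real N" "(B / real N) ^ 4 \<le> B ^ 4 / (real N)\<^sup>2"
proof -
  have "real N \<le> real N ^ 2" "real N ^ 2 \<le> real N ^ 4"
    using N by (auto intro!: power_increasing self_le_power)
  then show "(B / real N)\<^sup>2 \<le> B\<^sup>2 / real N" "(B / real N) ^ 4 \<le> B ^ 4 / (real N)\<^sup>2"
    using N unfolding power_divide by (auto intro!: divide_left_mono)
qed

lemma second_moment: "moment_sum 2 \<le> 6 * B\<^sup>2 / real N"
proof -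
  define r where "r = B\<^sup>2 / real N"
  have r: "0 \<le> r" by (simp add: r_def)
  have moment_sum: "0 \<le> moment_sum 2"
    using c.V_mono[of "\<lambda>_. 0" "\<lambda>s. \<bar>ov 0 1 s\<bar>\<^sup>2"] c.V_mono[of "\<lambda>_. 0" "\<lambda>s. \<bar>ov 0 0 s\<bar>\<^sup>2"]
    by (simp add: moment_sum_def c.V_const)
  have "V (\<lambda>s. \<bar>ov a b s\<bar> ^ 2) \<le> 2 * r + 2304 * (1 / 1000000) * (moment_sum 2 + r)" if ab: "a < 2" "b < 2" for a b
  proof -
    have "\<bar>V (\<lambda>s. ov a b s * ov a b s) - 0\<bar> \<le> 2 * B\<^sup>2 / real N + 2304 * (\<beta>\<^sup>2 * B\<^sup>2) * (moment_sum 2 + (B / real N)\<^sup>2)"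
    proof (rule V_average_le)
      fix i assume "i < N"
      then interpret ci: cavity_pq S N i \<beta> h D p q by (rule cavity_at)
      show "\<bar>V (\<lambda>s. (s a i * s b i - Qv p q a b) * ov a b s) - 0\<bar>
          \<le> 2 * B\<^sup>2 / real N + 2304 * (\<beta>\<^sup>2 * B\<^sup>2) * (moment_sum 2 + (B / real N)\<^sup>2)"
        using ci.site_second_moment[OF ab V_ov_le_moment_sum[of _ _ 2]] by simp
    qed
    also have "\<dots> \<le> 2 * r + 2304 * (1 / 1000000) * (moment_sum 2 + r)"
      unfolding r_def using \<beta>B BN moment_sum
      by (intro add_mono mult_mono) auto
    finally show ?thesis by (simp add: power2_eq_square)
  qed
  from add_mono[OF this[of 0 1] this[of 0 0]]
  have "moment_sum 2 \<le> 2 * (2 * r + 2304 * (1 / 1000000) * (moment_sum 2 + r))" by (simp add: moment_sum_def)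
  \<comment> \<open>The sum reappears on the right with a factor below 1/100 and is absorbed; 4 plus
    that small part is below 6.\<close>
  then have "moment_sum 2 \<le> 6 * r" using r by (simp add: field_simps)
  then show ?thesis by (simp add: r_def)
qed

lemma fourth_moment: "moment_sum 4 \<le> 300 * B ^ 4 / (real N)\<^sup>2"
proof -
  define r where "r = B ^ 4 / (real N)\<^sup>2"
  have r: "0 \<le> r" by (simp add: r_def)
  have moment_sum: "0 \<le> moment_sum 4"
    using c.V_mono[of "\<lambda>_. 0" "\<lambda>s. \<bar>ov 0 1 s\<bar> ^ 4"] c.V_mono[of "\<lambda>_. 0" "\<lambda>s. \<bar>ov 0 0 s\<bar> ^ 4"]
    by (simp add: moment_sum_def c.V_const)
  have "V (\<lambda>s. \<bar>ov a b s\<bar> ^ 4) \<le> 4 * 34 * r + 9216 * (1 / 1000000) * (moment_sum 4 + r)" if ab: "a < 2" "b < 2" for a b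
  proof -
    have "\<bar>V (\<lambda>s. ov a b s * ov a b s ^ 3) - 0\<bar>
        \<le> 4 * B\<^sup>2 / real N * (5 * (6 * B\<^sup>2 / real N) + 4 * (B / real N)\<^sup>2) + 9216 * (\<beta>\<^sup>2 * B\<^sup>2) * (moment_sum 4 + (B / real N) ^ 4)"
    proof (rule V_average_le)
      fix i assume "i < N"
      then interpret ci: cavity_pq S N i \<beta> h D p q by (rule cavity_at)
      show "\<bar>V (\<lambda>s. (s a i * s b i - Qv p q a b) * ov a b s ^ 3) - 0\<bar>
          \<le> 4 * B\<^sup>2 / real N * (5 * (6 * B\<^sup>2 / real N) + 4 * (B / real N)\<^sup>2) + 9216 * (\<beta>\<^sup>2 * B\<^sup>2) * (moment_sum 4 + (B / real N) ^ 4)"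
        using ci.site_fourth_moment[OF ab order_trans[OF V_ov_le_moment_sum second_moment] V_ov_le_moment_sum[of _ _ 4]] by simp
    qed
    also have "\<dots> \<le> 4 * B\<^sup>2 / real N * (5 * (6 * B\<^sup>2 / real N) + 4 * (B\<^sup>2 / real N)) + 9216 * (1 / 1000000) * (moment_sum 4 + r)"
      unfolding r_def using \<beta>B BN moment_sum
      by (intro add_mono mult_mono order_refl) auto
    \<comment> \<open>Here 34 = 5 * 6 + 4, the 6 coming from \<open>second_moment\<close>. Twice
      136, after absorption of the feedback, stays below 300.\<close>
    also have "4 * B\<^sup>2 / real N * (5 * (6 * B\<^sup>2 / real N) + 4 * (B\<^sup>2 / real N)) = 4 * 34 * r"
      unfolding r_def by (simp add: power2_eq_square power4_eq_xxxx field_simps)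
    finally show ?thesis by (simp add: power4_eq_xxxx power3_eq_cube mult_ac)
  qed
  from add_mono[OF this[of 0 1] this[of 0 0]]
  have "moment_sum 4 \<le> 2 * (4 * 34 * r + 9216 * (1 / 1000000) * (moment_sum 4 + r))" by (simp add: moment_sum_def)
  then have "moment_sum 4 \<le> 300 * r" using r by (simp add: field_simps)
  then show ?thesis by (simp add: r_def)
qed

end

section \<open>Linear system for the covariances\<close>

text \<open>A covariance although only one factor is centered: the pairs have the means
  \<open>Qv\<close> (\<open>site_cov_eq\<close>).\<close>

definition site_cov :: "nat \<Rightarrow> real \<Rightarrow> real \<Rightarrow> real \<Rightarrow> real \<Rightarrow> real \<Rightarrow> nat \<Rightarrow> nat \<Rightarrow> nat \<Rightarrow> nat \<Rightarrow> real" where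
  "site_cov S \<beta> h D p q a b c d = siteE S \<beta> h D p q (\<lambda>z. (z a * z b - Qv p q a b) * (z c * z d))"

text \<open>7266 is three times the constant 2422 of \<open>V_rm3_le\<close>, since a product of
  three overlaps is bounded by the sum of three cubes.\<close>

definition third_const :: "nat \<Rightarrow> real" where
  "third_const S = 7266 * (real S)\<^sup>2 ^ 4"

text \<open>In this order: the self term, the second order remainder, and the exchange of cavity
  pairs at angle 0 for full overlaps in the model.\<close>

definition err_const :: "nat \<Rightarrow> real" where
  "err_const S = 14400 * (real S)\<^sup>2 ^ 5 + 322560 * (real S)\<^sup>2 ^ 3 * third_const S
     + 80 * (real S)\<^sup>2 ^ 2 * (1008 * (real S)\<^sup>2 * third_const S + 30 * (real S)\<^sup>2 ^ 3)"

context cavity_pq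
begin

lemma model: "model S N \<beta> h D p q"
  using i S pq small by (simp add: model_def)

abbreviation "\<delta> \<equiv> 1 / sqrt (real N)"

lemma \<delta>: "0 < \<delta>" "\<delta>\<^sup>2 = 1 / real N" "\<delta> \<le> 1"
  using i by (simp_all add: power_divide)

lemma \<beta>2_le_1: "\<beta>\<^sup>2 \<le> 1"
proof -
  have "\<beta>\<^sup>2 * 1 \<le> \<beta>\<^sup>2 * (B\<^sup>2 * 1000000)"
    using B_ge_1 one_le_power[of B 2] by (intro mult_left_mono) auto
  then show ?thesis using small by simp
qed

lemma B_le_pow: "1 \<le> k \<Longrightarrow> 1 \<le> B ^ k"
  using B_ge_1 by (rule one_le_power)

lemma V_ov2_le: "a < 10 \<Longrightarrow> b < 10 \<Longrightarrow> V (\<lambda>s. \<bar>ov a b s\<bar> ^ 2) \<le> 6 * B\<^sup>2 * \<delta>\<^sup>2"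
  using model.V_ov_le_moment_sum[OF model, of a b 2] model.second_moment[OF model] unfolding \<delta>(2) by simp

lemma V_rm2_le:
  assumes "a < 10" "b < 10" shows "V (\<lambda>s. \<bar>rm a b s\<bar> ^ 2) \<le> 28 * B\<^sup>2 * \<delta>\<^sup>2"
proof -
  have "V (\<lambda>s. \<bar>rm a b s\<bar> ^ 2) \<le> 2\<^sup>2 * (6 * B\<^sup>2 * \<delta>\<^sup>2 + (B / real N)\<^sup>2)"
    by (rule V_rm_power[OF assms V_ov2_le[OF assms]])
  also have "\<dots> \<le> 2\<^sup>2 * (6 * B\<^sup>2 * \<delta>\<^sup>2 + B\<^sup>2 / real N)"
    using model.BN(1)[OF model] by (intro mult_left_mono add_left_mono) auto
  finally show ?thesis unfolding \<delta>(2) by simp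
qed

lemma V_rm4_le:
  assumes "a < 10" "b < 10" shows "V (\<lambda>s. \<bar>rm a b s\<bar> ^ 4) \<le> 4816 * B ^ 4 * (\<delta>\<^sup>2)\<^sup>2"
proof -
  have "V (\<lambda>s. \<bar>rm a b s\<bar> ^ 4) \<le> 2 ^ 4 * (300 * B ^ 4 / (real N)\<^sup>2 + (B / real N) ^ 4)"
    by (rule V_rm_power[OF assms order_trans[OF model.V_ov_le_moment_sum[OF model assms] model.fourth_moment[OF model]]])
  also have "\<dots> \<le> 2 ^ 4 * (300 * B ^ 4 / (real N)\<^sup>2 + B ^ 4 / (real N)\<^sup>2)"
    using model.BN(2)[OF model] by (intro mult_left_mono add_left_mono) auto
  finally show ?thesis unfolding \<delta>(2) by (simp add: power_divide)
qed

text \<open>Young's inequality with the weight \<open>\<delta>\<close> = N^(-1/2). This is the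
  typical size of an overlap and so the weight that balances the two terms.\<close>

lemma abs_le_of_square: "\<bar>x\<bar> \<le> 1 / (2 * \<delta>) * \<bar>x\<bar> ^ 2 + \<delta> / 2"
proof -
  have "y \<le> 1 / (2 * d) * y ^ 2 + d / 2" if "0 < d" for y d :: real
  proof -
    have "0 \<le> (y - d)\<^sup>2 / (2 * d)" using that by simp
    then show ?thesis using that by (simp add: power2_diff field_simps power2_eq_square)
  qed
  then show ?thesis using \<delta>(1) .
qed

lemma abs_cube_le: "\<bar>x\<bar> ^ 3 \<le> \<delta> / 2 * \<bar>x\<bar> ^ 2 + 1 / (2 * \<delta>) * \<bar>x\<bar> ^ 4"
proof -
  have "\<bar>x\<bar> ^ 3 = \<bar>x\<bar> ^ 2 * \<bar>x\<bar>" by (simp only: power3_eq_cube power2_eq_square)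
  also have "\<dots> \<le> \<bar>x\<bar> ^ 2 * (1 / (2 * \<delta>) * \<bar>x\<bar> ^ 2 + \<delta> / 2)"
    by (intro mult_left_mono abs_le_of_square) simp
  also have "\<dots> = \<delta> / 2 * \<bar>x\<bar> ^ 2 + 1 / (2 * \<delta>) * (\<bar>x\<bar> ^ 2 * \<bar>x\<bar> ^ 2)"
    by (simp only: distrib_left mult_ac)
  also have "\<bar>x\<bar> ^ 2 * \<bar>x\<bar> ^ 2 = \<bar>x\<bar> ^ 4" by (simp flip: power_add)
  finally show ?thesis .
qed

lemma V_abs_le_of_square:
  assumes "V (\<lambda>s. \<bar>f s\<bar> ^ 2) \<le> 28 * B\<^sup>2 * \<delta>\<^sup>2" shows "V (\<lambda>s. \<bar>f s\<bar>) \<le> 15 * B\<^sup>2 * \<delta>"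
proof -
  have "V (\<lambda>s. \<bar>f s\<bar>) \<le> V (\<lambda>s. 1 / (2 * \<delta>) * \<bar>f s\<bar> ^ 2 + \<delta> / 2)"
    by (intro V_mono abs_le_of_square)
  also have "\<dots> \<le> 1 / (2 * \<delta>) * (28 * B\<^sup>2 * \<delta>\<^sup>2) + \<delta> / 2"
    unfolding V_cmult V_add V_const using assms \<delta>(1) by (intro add_right_mono mult_left_mono) auto
  also have "\<dots> = (14 * B\<^sup>2 + 1 / 2) * \<delta>"
    using \<delta>(1) by (simp add: power2_eq_square[of \<delta>] field_simps)
  also have "\<dots> \<le> 15 * B\<^sup>2 * \<delta>"
    using \<delta>(1) B_le_pow[of 2] by (intro mult_right_mono) auto
  finally show ?thesis .
qed

lemma V_rm_le: "a < 10 \<Longrightarrow> b < 10 \<Longrightarrow> V (\<lambda>s. \<bar>rm a b s\<bar>) \<le> 15 * B\<^sup>2 * \<delta>"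
  by (intro V_abs_le_of_square V_rm2_le)

lemma V_ov_le: "a < 10 \<Longrightarrow> b < 10 \<Longrightarrow> V (\<lambda>s. \<bar>ov a b s\<bar>) \<le> 15 * B\<^sup>2 * \<delta>"
  by (intro V_abs_le_of_square order_trans[OF V_ov2_le] mult_right_mono) auto

text \<open>Interpolation between the second and fourth moments: with these of orders 1/N and 1/N^2,
  both terms of \<open>abs_cube_le\<close> have order N^(-3/2).\<close>

lemma V_rm3_le:
  assumes "a < 10" "b < 10" shows "V (\<lambda>s. \<bar>rm a b s\<bar> ^ 3) \<le> 2422 * B ^ 4 * \<delta> ^ 3"
proof -
  have "V (\<lambda>s. \<bar>rm a b s\<bar> ^ 3) \<le> V (\<lambda>s. \<delta> / 2 * \<bar>rm a b s\<bar> ^ 2 + 1 / (2 * \<delta>) * \<bar>rm a b s\<bar> ^ 4)"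
    by (intro V_mono abs_cube_le)
  also have "\<dots> \<le> \<delta> / 2 * (28 * B\<^sup>2 * \<delta>\<^sup>2) + 1 / (2 * \<delta>) * (4816 * B ^ 4 * (\<delta>\<^sup>2)\<^sup>2)"
    unfolding V_cmult V_add using V_rm2_le[OF assms] V_rm4_le[OF assms] \<delta>(1)
    by (intro add_mono mult_left_mono) auto
  also have "\<dots> = (14 * B\<^sup>2 + 2408 * B ^ 4) * \<delta> ^ 3"
  proof -
    have "1 / (2 * x) * (4816 * y * (x\<^sup>2)\<^sup>2) = 2408 * y * x ^ 3" if "0 < x" for x y :: real
      using that by (simp add: power2_eq_square power3_eq_cube)
    moreover have "x / 2 * (28 * y * x\<^sup>2) = 14 * y * x ^ 3" for x y :: real
      by (simp add: power2_eq_square power3_eq_cube)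
    ultimately show ?thesis using \<delta>(1) by (simp only: distrib_right)
  qed
  also have "\<dots> \<le> 2422 * B ^ 4 * \<delta> ^ 3"
  proof (intro mult_right_mono)
    have "B ^ 2 \<le> B ^ 4" using B_ge_1 by (intro power_increasing) auto
    then show "14 * B\<^sup>2 + 2408 * B ^ 4 \<le> 2422 * B ^ 4" by linarith
  qed (use \<delta>(1) in auto)
  finally show ?thesis .
qed

lemma V_rm_triple_le:
  assumes "a < 10" "b < 10" "c < 10" "d < 10" "e < 10" "f < 10"
  shows "V (\<lambda>s. \<bar>rm a b s\<bar> * \<bar>rm c d s\<bar> * \<bar>rm e f s\<bar>) \<le> third_const S * \<delta> ^ 3"
proof -
  have "V (\<lambda>s. \<bar>rm a b s\<bar> * \<bar>rm c d s\<bar> * \<bar>rm e f s\<bar>) \<le> V (\<lambda>s. \<bar>rm a b s\<bar> ^ 3 + \<bar>rm c d s\<bar> ^ 3 + \<bar>rm e f s\<bar> ^ 3)"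
    by (intro V_mono abs_mult3_le)
  also have "\<dots> \<le> third_const S * \<delta> ^ 3"
    unfolding V_add third_const_def using V_rm3_le[of a b] V_rm3_le[of c d] V_rm3_le[of e f] assms by simp
  finally show ?thesis .
qed

abbreviation "SG \<equiv> site_cov S \<beta> h D p q"

lemma dep_site4: "a < 10 \<Longrightarrow> b < 10 \<Longrightarrow> c < 10 \<Longrightarrow> d < 10 \<Longrightarrow> dep 10 (\<lambda>z. (z a * z b - Qv p q a b) * (z c * z d))"
  by (intro dep_intros dep_comp[where y="\<lambda>x. x"])

lemma E0_site4:
  assumes "a < 10" "b < 10" "c < 10" "d < 10"
  shows "E 0 (\<lambda>s. ex a b s * (s c i * s d i)) = SG a b c d"
  unfolding site_cov_def using E0_site[OF dep_site4[OF assms]] by simp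

lemma SG_le:
  assumes "a < 10" "b < 10" "c < 10" "d < 10" shows "\<bar>SG a b c d\<bar> \<le> 2 * B\<^sup>2"
proof -
  have "\<bar>E 0 (\<lambda>s. ex a b s * (s c i * s d i))\<bar> \<le> E 0 (\<lambda>_. 2 * B * B)"
    by (intro order_trans[OF Eav_abs_le] Eav_mono abs_mult_le ex_le prod_le i assms)
  then show ?thesis unfolding E0_site4[OF assms] Eav_const by (simp add: power2_eq_square)
qed

lemma dep_prod: "a < n \<Longrightarrow> b < n \<Longrightarrow> dep n (\<lambda>s. s a i * s b i)"
  by (intro dep_intros dep_comp[where y="\<lambda>x. x _"])

text \<open>The site's own share of the second overlap. It will be multiplied by 1/N, so an error of
  order N^(-1/2) is enough and a first order expansion gives it.\<close>

lemma self_term: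
  assumes "a < 4" "b < 4" "c < 4" "d < 4"
  shows "\<bar>V (\<lambda>s. ex a b s * (s c i * s d i)) - SG a b c d\<bar> \<le> 14400 * B ^ 5 * \<delta>"
proof -
  have lt: "a < 10" "b < 10" "c < 10" "d < 10" using assms by auto
  have "\<bar>V (\<lambda>s. ex a b s * (s c i * s d i)) - SG a b c d\<bar>
      \<le> 6 * \<beta>\<^sup>2 * V (\<lambda>s. \<bar>ex a b s * (s c i * s d i) * L 4 s\<bar>)"
    unfolding E0_site4[OF lt, symmetric] Eav_pi_half[symmetric]
    by (rule E_first_order[of 4]) (use assms in \<open>auto intro!: dep_mult[OF dep_ex dep_prod]\<close>)
  also have "V (\<lambda>s. \<bar>ex a b s * (s c i * s d i) * L 4 s\<bar>) \<le> V (\<lambda>s. (2 * B * B) * \<bar>L 4 s\<bar>)"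
    unfolding abs_mult[of _ "L _ _"] by (intro V_mono mult_right_mono abs_mult_le ex_le prod_le i lt) auto
  also have "\<dots> \<le> 4 * real 4 * (real 4 + 1) * (B * (2 * B * B * (15 * B\<^sup>2 * \<delta>)))"
  proof (rule V_mult_L_le)
    fix e f :: nat assume "e < 10" "f < 10"
    then show "V (\<lambda>s. 2 * B * B * \<bar>rm e f s\<bar>) \<le> 2 * B * B * (15 * B\<^sup>2 * \<delta>)"
      unfolding V_cmult by (intro mult_left_mono V_rm_le) auto
  qed auto
  finally have "\<bar>V (\<lambda>s. ex a b s * (s c i * s d i)) - SG a b c d\<bar>
      \<le> 6 * \<beta>\<^sup>2 * (4 * real 4 * (real 4 + 1) * (B * (2 * B * B * (15 * B\<^sup>2 * \<delta>))))"
    by (simp add: mult_left_mono)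
  also have "\<dots> \<le> 6 * 1 * (4 * real 4 * (real 4 + 1) * (B * (2 * B * B * (15 * B\<^sup>2 * \<delta>))))"
    using \<beta>2_le_1 \<delta>(1) by (intro mult_right_mono mult_left_mono) auto
  also have "\<dots> = 14400 * B ^ 5 * \<delta>"
    by (simp add: eval_nat_numeral)
  finally show ?thesis .
qed

text \<open>Changing the angle costs one more overlap through \<open>L\<close>, hence a third
  moment.\<close>

lemma rm_pair_change:
  assumes "c < 6" "d < 6" "e < 6" "f < 6"
  shows "\<bar>V (\<lambda>s. rm c d s * rm e f s) - E 0 (\<lambda>s. rm c d s * rm e f s)\<bar> \<le> 1008 * B * third_const S * \<delta> ^ 3"
proof -
  have "\<bar>V (\<lambda>s. rm c d s * rm e f s) - E 0 (\<lambda>s. rm c d s * rm e f s)\<bar>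
      \<le> 6 * \<beta>\<^sup>2 * V (\<lambda>s. \<bar>rm c d s * rm e f s * L 6 s\<bar>)"
    unfolding Eav_pi_half[symmetric]
    by (rule E_first_order[of 6]) (use assms in \<open>auto intro!: dep_mult[OF dep_rm dep_rm]\<close>)
  also have "V (\<lambda>s. \<bar>rm c d s * rm e f s * L 6 s\<bar>) = V (\<lambda>s. (\<bar>rm c d s\<bar> * \<bar>rm e f s\<bar>) * \<bar>L 6 s\<bar>)"
    by (simp only: abs_mult)
  also have "\<dots> \<le> 4 * real 6 * (real 6 + 1) * (B * (third_const S * \<delta> ^ 3))"
    using assms by (intro V_mult_L_le V_rm_triple_le) auto
  finally have "\<bar>V (\<lambda>s. rm c d s * rm e f s) - E 0 (\<lambda>s. rm c d s * rm e f s)\<bar>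
      \<le> 6 * \<beta>\<^sup>2 * (4 * real 6 * (real 6 + 1) * (B * (third_const S * \<delta> ^ 3)))"
    by (simp add: mult_left_mono)
  also have "\<dots> \<le> 6 * 1 * (4 * real 6 * (real 6 + 1) * (B * (third_const S * \<delta> ^ 3)))"
    using \<beta>2_le_1 \<delta>(1) by (intro mult_right_mono mult_left_mono) (auto simp: third_const_def)
  finally show ?thesis by simp
qed

text \<open>The two overlaps are exchanged one at a time; each exchange costs B/N times the other
  overlap, whose absolute mean has order N^(-1/2).\<close>

lemma ov_pair_change:
  assumes "c < 10" "d < 10" "e < 10" "f < 10"
  shows "\<bar>V (\<lambda>s. ov c d s * ov e f s) - V (\<lambda>s. rm c d s * rm e f s)\<bar> \<le> 30 * B ^ 3 * \<delta> ^ 3"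
proof -
  have "\<bar>V (\<lambda>s. ov c d s * ov e f s) - V (\<lambda>s. rm c d s * rm e f s)\<bar>
      \<le> V (\<lambda>s. B / real N * (\<bar>ov c d s\<bar> + \<bar>rm e f s\<bar>))"
    unfolding V_diff[symmetric]
  proof (intro order_trans[OF V_abs_le] V_mono)
    fix s assume s: "s \<in> Sp10"
    have "ov c d s * ov e f s - rm c d s * rm e f s
        = (ov e f s - rm e f s) * ov c d s + (ov c d s - rm c d s) * rm e f s" by (simp add: algebra_simps)
    also have "\<bar>\<dots>\<bar> \<le> B / real N * \<bar>ov c d s\<bar> + B / real N * \<bar>rm e f s\<bar>"
      by (intro order_trans[OF abs_triangle_ineq] add_mono abs_mult_le ov_rm_diff s assms) auto
    finally show "\<bar>ov c d s * ov e f s - rm c d s * rm e f s\<bar> \<le> B / real N * (\<bar>ov c d s\<bar> + \<bar>rm e f s\<bar>)"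
      by (simp only: distrib_left)
  qed
  also have "\<dots> \<le> B / real N * (15 * B\<^sup>2 * \<delta> + 15 * B\<^sup>2 * \<delta>)"
    unfolding V_cmult V_add by (intro mult_left_mono add_mono V_ov_le V_rm_le assms) auto
  also have "\<dots> = B * \<delta>\<^sup>2 * (15 * B\<^sup>2 * \<delta> + 15 * B\<^sup>2 * \<delta>)" unfolding \<delta>(2) by simp
  also have "\<dots> = 30 * B ^ 3 * \<delta> ^ 3" by (simp only: power2_eq_square power3_eq_cube) simp
  finally show ?thesis .
qed

text \<open>The zeroth order vanishes by \<open>E0_ex_factor\<close>. The second order remainder
  contains \<open>L\<close> twice besides \<open>rm c d\<close>, hence three overlaps and a third
  moment.\<close>

lemma interaction_term:
  assumes "a < 4" "b < 4" "c < 4" "d < 4"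
  shows "\<bar>V (\<lambda>s. ex a b s * rm c d s) - \<beta>\<^sup>2 / 2 * E 0 (\<lambda>s. ex a b s * rm c d s * L 4 s)\<bar>
     \<le> 322560 * B ^ 3 * third_const S * \<delta> ^ 3"
proof -
  have lt: "a < 10" "b < 10" "c < 10" "d < 10" using assms by auto
  have "dep 4 (\<lambda>s. ex a b s * rm c d s)"
    by (intro dep_mult dep_ex dep_rm assms)
  from E_second_order[OF this order_refl]
  have "\<bar>V (\<lambda>s. ex a b s * rm c d s) - \<beta>\<^sup>2 / 2 * E 0 (\<lambda>s. ex a b s * rm c d s * L 4 s)\<bar>
     \<le> 12 * \<beta> ^ 4 * V (\<lambda>s. \<bar>ex a b s * rm c d s * L 4 s * L 6 s\<bar>)"
    unfolding E0_ex_factor[OF lt(1,2) off_site_rm] Eav_pi_half by simp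
  also have "V (\<lambda>s. \<bar>ex a b s * rm c d s * L 4 s * L 6 s\<bar>) \<le> V (\<lambda>s. (2 * B * \<bar>rm c d s\<bar> * \<bar>L 4 s\<bar>) * \<bar>L 6 s\<bar>)"
    unfolding abs_mult[of _ "L _ _"] by (intro V_mono mult_right_mono abs_mult_le ex_le lt) auto
  also have "\<dots> \<le> 4 * real 6 * (real 6 + 1) * (B * (4 * real 4 * (real 4 + 1) * (B * (2 * B * (third_const S * \<delta> ^ 3)))))"
  proof (rule V_mult_L_le)
    fix e f :: nat assume ef: "e < 10" "f < 10"
    have "V (\<lambda>s. 2 * B * \<bar>rm c d s\<bar> * \<bar>L 4 s\<bar> * \<bar>rm e f s\<bar>) = V (\<lambda>s. (2 * B * (\<bar>rm c d s\<bar> * \<bar>rm e f s\<bar>)) * \<bar>L 4 s\<bar>)"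
      by (simp only: mult_ac)
    also have "\<dots> \<le> 4 * real 4 * (real 4 + 1) * (B * (2 * B * (third_const S * \<delta> ^ 3)))"
    proof (rule V_mult_L_le)
      fix g k :: nat assume gk: "g < 10" "k < 10"
      show "V (\<lambda>s. 2 * B * (\<bar>rm c d s\<bar> * \<bar>rm e f s\<bar>) * \<bar>rm g k s\<bar>) \<le> 2 * B * (third_const S * \<delta> ^ 3)"
        unfolding mult.assoc[of "2 * B"] V_cmult[of "2 * B"]
        by (intro mult_left_mono V_rm_triple_le lt ef gk) auto
    qed auto
    finally show "V (\<lambda>s. 2 * B * \<bar>rm c d s\<bar> * \<bar>L 4 s\<bar> * \<bar>rm e f s\<bar>)
        \<le> 4 * real 4 * (real 4 + 1) * (B * (2 * B * (third_const S * \<delta> ^ 3)))" .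
  qed auto
  finally have "\<bar>V (\<lambda>s. ex a b s * rm c d s) - \<beta>\<^sup>2 / 2 * E 0 (\<lambda>s. ex a b s * rm c d s * L 4 s)\<bar>
     \<le> 12 * \<beta> ^ 4 * (4 * real 6 * (real 6 + 1) * (B * (4 * real 4 * (real 4 + 1) * (B * (2 * B * (third_const S * \<delta> ^ 3))))))"
    by (simp add: mult_left_mono)
  also have "\<dots> \<le> 12 * 1 * (4 * real 6 * (real 6 + 1) * (B * (4 * real 4 * (real 4 + 1) * (B * (2 * B * (third_const S * \<delta> ^ 3))))))"
  proof (intro mult_right_mono mult_left_mono)
    show "\<beta> ^ 4 \<le> 1" using power_mono[OF \<beta>2_le_1, of 2] by simp
  qed (use \<delta>(1) in \<open>auto simp: third_const_def\<close>)
  also have "\<dots> = 322560 * B ^ 3 * third_const S * \<delta> ^ 3"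
    by (simp add: power3_eq_cube)
  finally show ?thesis .
qed

text \<open>Both \<open>rm c d\<close> and the overlap \<open>rm e f\<close> inside \<open>L\<close>
  ignore site \<open>i\<close>; the spins of the site collect into the covariance
  \<open>SG a b e f\<close>.\<close>

lemma E0_interaction:
  assumes "a < 4" "b < 4" "c < 4" "d < 4"
  shows "E 0 (\<lambda>s. ex a b s * rm c d s * L 4 s)
    = (\<Sum>e<5. \<Sum>f<6. coef 4 e * coef 5 f * (SG a b e f * E 0 (\<lambda>s. rm c d s * rm e f s)))"
proof -
  have "(\<lambda>s. ex a b s * rm c d s * L 4 s)
      = (\<lambda>s. \<Sum>e<Suc 4. \<Sum>f<Suc (Suc 4). (coef 4 e * coef (Suc 4) f) * (ex a b s * (s e i * s f i) * (rm c d s * rm e f s)))"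
    unfolding L_def by (simp only: sum_distrib_left mult_ac)
  then have "E 0 (\<lambda>s. ex a b s * rm c d s * L 4 s)
     = (\<Sum>e<Suc 4. \<Sum>f<Suc (Suc 4). (coef 4 e * coef (Suc 4) f) * E 0 (\<lambda>s. ex a b s * (s e i * s f i) * (rm c d s * rm e f s)))"
    by (simp only: Eav_sum Eav_cmult)
  also have "\<dots> = (\<Sum>e<Suc 4. \<Sum>f<Suc (Suc 4). (coef 4 e * coef (Suc 4) f) * (SG a b e f * E 0 (\<lambda>s. rm c d s * rm e f s)))"
  proof (intro sum.cong refl arg_cong2[where f="(*)"])
    fix e f assume "e \<in> {..<Suc 4}" "f \<in> {..<Suc (Suc 4)}"
    then have "dep 10 (\<lambda>z. (z a * z b - Qv p q a b) * (z e * z f))"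
      using assms by (intro dep_site4) auto
    from E0_factor[OF this off_site_mult[OF off_site_rm off_site_rm]]
    show "E 0 (\<lambda>s. ex a b s * (s e i * s f i) * (rm c d s * rm e f s)) = SG a b e f * E 0 (\<lambda>s. rm c d s * rm e f s)"
      unfolding site_cov_def by simp
  qed
  finally show ?thesis by simp
qed

text \<open>The second overlap splits into \<open>rm c d\<close> and 1/N times its summand at
  \<open>i\<close>. The latter gives the source SG / N, the former the interaction; exchanging its
  cavity pairs for full overlaps in the model makes the overlap covariances reappear on the
  right.\<close>

lemma site_expansion:
  assumes "a < 4" "b < 4" "c < 4" "d < 4"
  shows "\<bar>V (\<lambda>s. ex a b s * ov c d s)
      - (SG a b c d / real N + \<beta>\<^sup>2 / 2 * (\<Sum>e<5. \<Sum>f<6. coef 4 e * coef 5 f * (SG a b e f * V (\<lambda>s. ov e f s * ov c d s))))\<bar>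
     \<le> err_const S * \<delta> ^ 3"
proof -
  define W where "W = (\<Sum>e<5. \<Sum>f<6. coef 4 e * coef 5 f * (SG a b e f * V (\<lambda>s. ov e f s * ov c d s)))"
  define W0 where "W0 = (\<Sum>e<5. \<Sum>f<6. coef 4 e * coef 5 f * (SG a b e f * E 0 (\<lambda>s. rm c d s * rm e f s)))"
  define Y where "Y = 2 * B\<^sup>2 * ((1008 * B * third_const S + 30 * B ^ 3) * \<delta> ^ 3)"
  have Y0: "0 \<le> Y" using \<delta>(1) by (auto simp: Y_def third_const_def)
  have "\<bar>W - W0\<bar> \<le> (\<Sum>e<Suc 4. \<Sum>f<Suc (Suc 4). \<bar>coef 4 e\<bar> * \<bar>coef (Suc 4) f\<bar> * Y)"
  proof -
    have eq: "W - W0 = (\<Sum>e<Suc 4. \<Sum>f<Suc (Suc 4). coef 4 e * coef (Suc 4) f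
        * (SG a b e f * (V (\<lambda>s. ov e f s * ov c d s) - E 0 (\<lambda>s. rm c d s * rm e f s))))"
    proof -
      have "{..<5::nat} = {..<Suc 4}" "{..<6::nat} = {..<Suc (Suc 4)}" "(5::nat) = Suc 4" by auto
      then show ?thesis unfolding W_def W0_def by (simp only: right_diff_distrib sum_subtractf)
    qed
    show ?thesis unfolding eq
    proof (intro order_trans[OF sum_abs] sum_mono)
      fix e f assume ef: "e \<in> {..<Suc 4}" "f \<in> {..<Suc (Suc 4)}"
      have "V (\<lambda>s. ov e f s * ov c d s) = V (\<lambda>s. ov c d s * ov e f s)" by (simp only: mult.commute)
      then have "\<bar>V (\<lambda>s. ov e f s * ov c d s) - E 0 (\<lambda>s. rm c d s * rm e f s)\<bar> \<le> (1008 * B * third_const S + 30 * B ^ 3) * \<delta> ^ 3"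
        using rm_pair_change[of c d e f] ov_pair_change[of c d e f] assms ef
        unfolding distrib_right by simp
      then have "\<bar>SG a b e f * (V (\<lambda>s. ov e f s * ov c d s) - E 0 (\<lambda>s. rm c d s * rm e f s))\<bar> \<le> Y"
        unfolding Y_def using assms ef by (intro abs_mult_le SG_le) auto
      then show "\<bar>coef 4 e * coef (Suc 4) f * (SG a b e f * (V (\<lambda>s. ov e f s * ov c d s) - E 0 (\<lambda>s. rm c d s * rm e f s)))\<bar>
          \<le> \<bar>coef 4 e\<bar> * \<bar>coef (Suc 4) f\<bar> * Y"
        unfolding abs_mult[of "coef 4 e * coef (Suc 4) f"] abs_mult[of "coef 4 e"] by (intro mult_left_mono) auto
    qed
  qed
  also have "\<dots> \<le> 4 * real 4 * (real 4 + 1) * Y" by (rule sum_coef_le) simp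
  finally have W: "\<bar>W - W0\<bar> \<le> 80 * Y" by simp
  have b2: "\<bar>\<beta>\<^sup>2 / 2 * (W0 - W)\<bar> \<le> 1 / 2 * (80 * Y)"
    using W \<beta>2_le_1 by (intro abs_mult_le) auto
  have N: "V (\<lambda>s. ex a b s * ov c d s) = V (\<lambda>s. ex a b s * rm c d s) + \<delta>\<^sup>2 * V (\<lambda>s. ex a b s * (s c i * s d i))"
    unfolding V_cmult[symmetric] V_add[symmetric] \<delta>(2) by (intro V_cong) (simp add: ov_rm field_simps)
  have 1: "\<bar>\<delta>\<^sup>2 * (V (\<lambda>s. ex a b s * (s c i * s d i)) - SG a b c d)\<bar> \<le> \<delta>\<^sup>2 * (14400 * B ^ 5 * \<delta>)"
    by (intro abs_mult_le self_term assms) auto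
  have 2: "\<bar>V (\<lambda>s. ex a b s * rm c d s) - \<beta>\<^sup>2 / 2 * W0\<bar> \<le> 322560 * B ^ 3 * third_const S * \<delta> ^ 3"
    using interaction_term[OF assms] unfolding E0_interaction[OF assms] W0_def .
  have eq: "V (\<lambda>s. ex a b s * ov c d s) - (SG a b c d / real N + \<beta>\<^sup>2 / 2 * W)
     = \<delta>\<^sup>2 * (V (\<lambda>s. ex a b s * (s c i * s d i)) - SG a b c d)
       + (V (\<lambda>s. ex a b s * rm c d s) - \<beta>\<^sup>2 / 2 * W0) + \<beta>\<^sup>2 / 2 * (W0 - W)"
    unfolding N right_diff_distrib \<delta>(2) by simp
  have K: "\<delta>\<^sup>2 * (14400 * B ^ 5 * \<delta>) + 322560 * B ^ 3 * third_const S * \<delta> ^ 3 + 1 / 2 * (80 * Y) = err_const S * \<delta> ^ 3"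
  proof -
    have "x\<^sup>2 * (14400 * b5 * x) + 322560 * b3 * t * x ^ 3 + 1 / 2 * (80 * (2 * b2 * ((1008 * b * t + 30 * b3) * x ^ 3)))
        = (14400 * b5 + 322560 * b3 * t + 80 * b2 * (1008 * b * t + 30 * b3)) * x ^ 3" for x b b2 b3 b5 t :: real
      by (simp add: power2_eq_square power3_eq_cube algebra_simps)
    then show ?thesis unfolding err_const_def Y_def .
  qed
  show ?thesis
    unfolding W_def[symmetric] eq K[symmetric] using 1 2 b2 by linarith
qed

end

context model
begin

definition ovl_cov :: "nat \<Rightarrow> nat \<Rightarrow> nat \<Rightarrow> nat \<Rightarrow> real" where
  "ovl_cov a b c d = V (\<lambda>s. ov a b s * ov c d s)"

text \<open>The coefficients \<open>site_cov\<close> are the same for every site, so averaging the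
  site expansions produces a linear system with the overlap covariances on both sides.\<close>

lemma ovl_cov_system:
  assumes "a < 4" "b < 4" "c < 4" "d < 4"
  shows "\<bar>ovl_cov a b c d - (site_cov S \<beta> h D p q a b c d / real N
      + \<beta>\<^sup>2 / 2 * (\<Sum>e<5. \<Sum>f<6. coef 4 e * coef 5 f * (site_cov S \<beta> h D p q a b e f * ovl_cov e f c d)))\<bar>
    \<le> err_const S * (1 / sqrt (real N)) ^ 3"
  unfolding ovl_cov_def
proof (rule V_average_le)
  fix i assume "i < N"
  then interpret ci: cavity_pq S N i \<beta> h D p q by (rule cavity_at)
  show "\<bar>V (\<lambda>s. (s a i * s b i - Qv p q a b) * ov c d s) - (site_cov S \<beta> h D p q a b c d / real N
      + \<beta>\<^sup>2 / 2 * (\<Sum>e<5. \<Sum>f<6. coef 4 e * coef 5 f * (site_cov S \<beta> h D p q a b e f * V (\<lambda>s. ov e f s * ov c d s))))\<bar>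
    \<le> err_const S * (1 / sqrt (real N)) ^ 3"
    by (rule ci.site_expansion[OF assms])
qed

lemma ovl_cov_cls:
  assumes "a < 10" "b < 10" "c < 10" "d < 10"
  shows "ovl_cov a b c d = cls (ovl_cov 0 1 0 1) (ovl_cov 0 1 0 2) (ovl_cov 0 1 2 3) (ovl_cov 0 0 0 0) (ovl_cov 0 0 1 1) (ovl_cov 0 0 0 1) (ovl_cov 0 0 1 2) a b c d"
proof (rule symmetric_eq_cls[OF _ _ _ assms])
  show "ovl_cov (\<pi> a) (\<pi> b) (\<pi> c) (\<pi> d) = ovl_cov a b c d" if "\<pi> permutes {..<10}" for \<pi> a b c d
    unfolding ovl_cov_def ov_permute[OF that] by (rule c.V_permute[OF that])
  show "ovl_cov a b c d = ovl_cov b a c d" for a b c d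
    unfolding ovl_cov_def ovl_def Qv_def by (simp add: mult.commute eq_commute)
  show "ovl_cov a b c d = ovl_cov c d a b" for a b c d
    unfolding ovl_cov_def by (simp only: mult.commute)
qed

lemma site_cov_eq:
  assumes "a < 10" "b < 10" "c < 10" "d < 10"
  shows "site_cov S \<beta> h D p q a b c d = siteE S \<beta> h D p q (\<lambda>z. z a * z b * (z c * z d)) - Qv p q a b * Qv p q c d"
  unfolding site_cov_def left_diff_distrib siteE_diff siteE_cmult siteE_pair[OF pq assms(3,4)] ..

lemma site_cov_cls:
  assumes "a < 10" "b < 10" "c < 10" "d < 10"
  shows "site_cov S \<beta> h D p q a b c d = (let Y = site_cov S \<beta> h D p q in
    cls (Y 0 1 0 1) (Y 0 1 0 2) (Y 0 1 2 3) (Y 0 0 0 0) (Y 0 0 1 1) (Y 0 0 0 1) (Y 0 0 1 2)) a b c d"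
proof -
  define Y where "Y a b c d = siteE S \<beta> h D p q (\<lambda>z. z a * z b * (z c * z d)) - Qv p q a b * Qv p q c d" for a b c d
  have "Y a b c d = cls (Y 0 1 0 1) (Y 0 1 0 2) (Y 0 1 2 3) (Y 0 0 0 0) (Y 0 0 1 1) (Y 0 0 0 1) (Y 0 0 1 2) a b c d"
  proof (rule symmetric_eq_cls[OF _ _ _ assms])
    show "Y (\<pi> a) (\<pi> b) (\<pi> c) (\<pi> d) = Y a b c d" if \<pi>: "\<pi> permutes {..<10}" for \<pi> a b c d
      using siteE_permute[OF \<pi>, of S \<beta> h D p q "\<lambda>z. z a * z b * (z c * z d)"] inj_eq[OF permutes_inj[OF \<pi>]]
      unfolding Y_def Qv_def by simp
    show "Y a b c d = Y b a c d" for a b c d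
      unfolding Y_def Qv_def by (simp add: mult.commute eq_commute)
    show "Y a b c d = Y c d a b" for a b c d
      unfolding Y_def Qv_def by (simp add: mult.commute)
  qed
  then show ?thesis using assms by (simp add: site_cov_eq Y_def)
qed

end

section \<open>Solution of the linear system\<close>

text \<open>The equations of the linear system, decoupled by the above decomposition of the
  overlaps. Here \<open>b\<close> is \<open>\<beta>\<^sup>2\<close> and \<open>w\<close> is \<open>1/N\<close>.\<close>

lemma fluctuation_relations:
  fixes A G J3 D K E J5 b w n1 n2 n3 mm a2 a1 a0 b1 b0 c1 c0 :: real
  assumes n: "n1 = 1 - b * (A - 2 * G)" "n2 = 1 - b / 2 * D" "n3 = 1 - b * A" "mm = n1 * n2 + b\<^sup>2 * E\<^sup>2"
    and nz: "mm \<noteq> 0" "n3 \<noteq> 0"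
    and a2: "a2 = w * A / n3" and a1: "a1 = w * (G * n2 + b / 2 * E\<^sup>2) / (mm * n3)"
    and b1: "b1 = w * (D * n1 - 2 * b * E\<^sup>2) / mm" and c1: "c1 = w * E / mm"
    and a0: "a0 = (b * (b * E * K + n2 * J5) * c1 + 2 * b * (b * E * (E - J5) + n2 * (2 * G - J3)) * a1
        + b * (b * E * J5 + n2 * J3) * a2 + w * (b * E * J5 + n2 * J3)) / mm"
    and b0: "b0 = (b / 2 * (n1 * K - b * E * J5) * b1 + b * (n1 * (E - J5) - b * E * (2 * G - J3)) * c1
        + w * (n1 * K - b * E * J5)) / mm"
    and c0: "c0 = (b / 2 * (n2 * J5 + b * E * K) * b1 + b * (n2 * (2 * G - J3) + b * E * (E - J5)) * c1
        + w * (n2 * J5 + b * E * K)) / mm"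
  shows "a2 = w * A + b * A * a2"
    and "n1 * a1 = G * (w + b * a2) + b / 2 * E * c1"
    and "n2 * b1 = w * D - 2 * b * E * c1"
    and "n1 * c1 = E * (w + b / 2 * b1)"
    and "n2 * c1 = E * (w + b * (a2 - 2 * a1))"
    and "n1 * a0 = J3 * (w + b * (a2 - 2 * a1)) + 4 * b * G * a1 + b * J5 * c1 + b * E * c0"
    and "n2 * c0 = J5 * (w + b * (a2 - 2 * a1)) + 2 * b * E * a1 + b * K * c1 - b * E * a0"
    and "n1 * c0 = J5 * (w + b / 2 * b1) + b * (2 * G - J3) * c1 + b * E * b0"
    and "n2 * b0 = K * (w + b / 2 * b1) + b * (E - J5) * c1 - b * E * c0"
proof -
  define u where "u = w / mm"
  have w: "w = u * mm" using nz by (simp add: u_def)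
  have c1': "c1 = u * E" by (simp add: c1 u_def)
  have b1': "b1 = u * (D * n1 - 2 * b * E\<^sup>2)" by (simp add: b1 u_def)
  have a1': "n3 * a1 = u * (G * n2 + b / 2 * E\<^sup>2)" using nz by (simp add: a1 u_def)
  have a2': "n3 * a2 = w * A" using nz by (simp add: a2)
  show 1: "a2 = w * A + b * A * a2" using a2' unfolding n(3) by (simp add: algebra_simps)
  have "n3 * (w + b * a2) = n3 * w + b * (n3 * a2)" by (simp add: algebra_simps)
  also have "\<dots> = w" unfolding a2' unfolding n(3) by (simp add: algebra_simps)
  finally have wa: "n3 * (w + b * a2) = w" .
  \<comment> \<open>The combinations w + b/2 b1 and w + b (a2 - 2 a1) recur on the right-hand sides;
    in units of u = w / mm they are simply n1 and n2.\<close>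
  have wb: "w + b / 2 * b1 = u * n1"
    unfolding w b1' n(4) n(2) by (simp add: algebra_simps power2_eq_square)
  have n13: "n1 = n3 + 2 * b * G" unfolding n by (simp add: algebra_simps)
  have "n3 * (w + b * (a2 - 2 * a1)) = n3 * (w + b * a2) - 2 * b * (n3 * a1)" by (simp add: algebra_simps)
  also have "\<dots> = n3 * (u * n2)"
    unfolding wa a1' unfolding w n(4) n13 by (simp add: algebra_simps power2_eq_square)
  finally have wc: "w + b * (a2 - 2 * a1) = u * n2" using nz(2) by simp
  show "n1 * c1 = E * (w + b / 2 * b1)" unfolding wb c1' by simp
  show "n2 * c1 = E * (w + b * (a2 - 2 * a1))" unfolding wc c1' by simp
  show "n2 * b1 = w * D - 2 * b * E * c1"
    unfolding b1' c1' w n(4) n(2) by (simp add: algebra_simps power2_eq_square)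
  have "n3 * (n1 * a1) = n1 * (n3 * a1)" by simp
  also have "\<dots> = G * (n3 * (w + b * a2)) + n3 * (b / 2 * E * c1)"
    unfolding a1' wa c1' unfolding w n(4) n13 by (simp add: algebra_simps power2_eq_square)
  also have "\<dots> = n3 * (G * (w + b * a2) + b / 2 * E * c1)" by (simp add: algebra_simps)
  finally show "n1 * a1 = G * (w + b * a2) + b / 2 * E * c1" using nz(2) by simp
  \<comment> \<open>r1, r2 are the right-hand sides of a two-by-two system for (a0, c0), and s1, s2
    those of one for (c0, b0). Both have determinant mm, and the given formulas are Cramer's rule:
    a0 from the first system, c0 and b0 from the second.\<close>
  define r1 where "r1 = J3 * (w + b * (a2 - 2 * a1)) + 4 * b * G * a1 + b * J5 * c1"
  define r2 where "r2 = J5 * (w + b * (a2 - 2 * a1)) + 2 * b * E * a1 + b * K * c1"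
  define s1 where "s1 = J5 * (w + b / 2 * b1) + b * (2 * G - J3) * c1"
  define s2 where "s2 = K * (w + b / 2 * b1) + b * (E - J5) * c1"
  have a0': "mm * a0 = n2 * r1 + b * E * r2"
    unfolding a0 r1_def r2_def times_divide_eq_right nonzero_mult_div_cancel_left[OF nz(1)] by (simp add: algebra_simps)
  have c0': "mm * c0 = n2 * s1 + b * E * s2"
    unfolding c0 s1_def s2_def times_divide_eq_right nonzero_mult_div_cancel_left[OF nz(1)] by (simp add: algebra_simps)
  have b0': "mm * b0 = n1 * s2 - b * E * s1"
    unfolding b0 s1_def s2_def times_divide_eq_right nonzero_mult_div_cancel_left[OF nz(1)] by (simp add: algebra_simps)
  \<comment> \<open>The given c0 solves the second system; that it solves the first as well is a
    compatibility condition, which comes down to the value of n3 a1.\<close>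
  have "n3 * a1 * (2 * b * E) = u * (G * n2 + b / 2 * E\<^sup>2) * (2 * b * E)" using a1' by simp
  then have c0'': "mm * c0 = n1 * r2 - b * E * r1"
    unfolding c0' r1_def r2_def s1_def s2_def wb wc c1' n13 by (simp add: algebra_simps power2_eq_square)
  have "mm * (n1 * a0) = mm * (r1 + b * E * c0)"
  proof -
    have "mm * (n1 * a0) = n1 * (mm * a0)" by simp
    also have "\<dots> = mm * r1 + b * E * (mm * c0)" unfolding a0' c0'' unfolding n(4) by (simp add: algebra_simps power2_eq_square)
    finally show ?thesis by (simp add: algebra_simps)
  qed
  then show "n1 * a0 = J3 * (w + b * (a2 - 2 * a1)) + 4 * b * G * a1 + b * J5 * c1 + b * E * c0"
    using nz(1) by (simp add: r1_def)
  have "mm * (n2 * c0) = mm * (r2 - b * E * a0)"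
  proof -
    have "mm * (n2 * c0) = n2 * (mm * c0)" by simp
    also have "\<dots> = mm * r2 - b * E * (mm * a0)" unfolding a0' c0'' unfolding n(4) by (simp add: algebra_simps power2_eq_square)
    finally show ?thesis by (simp add: algebra_simps)
  qed
  then show "n2 * c0 = J5 * (w + b * (a2 - 2 * a1)) + 2 * b * E * a1 + b * K * c1 - b * E * a0"
    using nz(1) by (simp add: r2_def)
  have "mm * (n1 * c0) = mm * (s1 + b * E * b0)"
  proof -
    have "mm * (n1 * c0) = n1 * (mm * c0)" by simp
    also have "\<dots> = mm * s1 + b * E * (mm * b0)" unfolding b0' c0' unfolding n(4) by (simp add: algebra_simps power2_eq_square)
    finally show ?thesis by (simp add: algebra_simps)
  qed
  then show "n1 * c0 = J5 * (w + b / 2 * b1) + b * (2 * G - J3) * c1 + b * E * b0"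
    using nz(1) by (simp add: s1_def)
  have "mm * (n2 * b0) = mm * (s2 - b * E * c0)"
  proof -
    have "mm * (n2 * b0) = n2 * (mm * b0)" by simp
    also have "\<dots> = mm * s2 - b * E * (mm * c0)" unfolding b0' c0' unfolding n(4) by (simp add: algebra_simps power2_eq_square)
    finally show ?thesis by (simp add: algebra_simps)
  qed
  then show "n2 * b0 = K * (w + b / 2 * b1) + b * (E - J5) * c1 - b * E * c0"
    using nz(1) by (simp add: s2_def)
qed

definition replica_sum :: "(nat \<Rightarrow> nat \<Rightarrow> nat \<Rightarrow> nat \<Rightarrow> real) \<Rightarrow> (nat \<Rightarrow> nat \<Rightarrow> nat \<Rightarrow> nat \<Rightarrow> real) \<Rightarrow> nat \<Rightarrow> nat \<Rightarrow> nat \<Rightarrow> nat \<Rightarrow> real" where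
  "replica_sum X Y a b c d = (\<Sum>e<5. \<Sum>f<6. coef 4 e * coef 5 f * (X a b e f * Y e f c d))"

lemma coef_values:
  "coef 4 0 = 1" "coef 4 (Suc 0) = 1" "coef 4 2 = 1" "coef 4 3 = 1" "coef 4 4 = -4"
  "coef 5 0 = 1" "coef 5 (Suc 0) = 1" "coef 5 2 = 1" "coef 5 3 = 1" "coef 5 4 = 1" "coef 5 5 = -5"
  by (simp_all add: coef_def)

lemma replica_sum_unfold:
  "replica_sum X Y a b c d = (\<Sum>e\<leftarrow>[0,1,2,3,4]. \<Sum>f\<leftarrow>[0,1,2,3,4,5]. coef 4 e * coef 5 f * (X a b e f * Y e f c d))"
  unfolding replica_sum_def by (simp add: eval_nat_numeral lessThan_Suc add_ac)

text \<open>The entries of \<open>X\<close> and \<open>Z\<close> split alike into a part of the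
  shared pair, parts of a shared replica and a common part. Once the thirty terms of
  \<open>replica_sum\<close> are written out, each identity is a linear combination of the
  relations.\<close>

lemma exact_system:
  fixes A G J3 D K E J5 b w a2 a1 a0 b1 b0 c1 c0 :: real
  assumes rel: "a2 = w * A + b * A * a2"
    "(1 - b * (A - 2 * G)) * a1 = G * (w + b * a2) + b / 2 * E * c1"
    "(1 - b / 2 * D) * b1 = w * D - 2 * b * E * c1"
    "(1 - b * (A - 2 * G)) * c1 = E * (w + b / 2 * b1)"
    "(1 - b / 2 * D) * c1 = E * (w + b * (a2 - 2 * a1))"
    "(1 - b * (A - 2 * G)) * a0 = J3 * (w + b * (a2 - 2 * a1)) + 4 * b * G * a1 + b * J5 * c1 + b * E * c0"
    "(1 - b / 2 * D) * c0 = J5 * (w + b * (a2 - 2 * a1)) + 2 * b * E * a1 + b * K * c1 - b * E * a0"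
    "(1 - b * (A - 2 * G)) * c0 = J5 * (w + b / 2 * b1) + b * (2 * G - J3) * c1 + b * E * b0"
    "(1 - b / 2 * D) * b0 = K * (w + b / 2 * b1) + b * (E - J5) * c1 - b * E * c0"
  defines "X \<equiv> cls (A + 2 * G + J3) (G + J3) J3 (D + K) K (E + J5) J5"
    and "Z \<equiv> cls (a2 + 2 * a1 + a0) (a1 + a0) a0 (b1 + b0) b0 (c1 + c0) c0"
  shows "Z 0 1 0 1 = w * X 0 1 0 1 + b / 2 * replica_sum X Z 0 1 0 1"
    and "Z 0 1 0 2 = w * X 0 1 0 2 + b / 2 * replica_sum X Z 0 1 0 2"
    and "Z 0 1 2 3 = w * X 0 1 2 3 + b / 2 * replica_sum X Z 0 1 2 3"
    and "Z 0 0 0 0 = w * X 0 0 0 0 + b / 2 * replica_sum X Z 0 0 0 0"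
    and "Z 0 0 1 1 = w * X 0 0 1 1 + b / 2 * replica_sum X Z 0 0 1 1"
    and "Z 0 0 0 1 = w * X 0 0 0 1 + b / 2 * replica_sum X Z 0 0 0 1"
    and "Z 0 0 1 2 = w * X 0 0 1 2 + b / 2 * replica_sum X Z 0 0 1 2"
proof -
  show "Z 0 1 0 1 = w * X 0 1 0 1 + b / 2 * replica_sum X Z 0 1 0 1"
    unfolding X_def Z_def replica_sum_unfold
    by (simp add: cls_def coef_values, insert rel, simp (no_asm_use) add: algebra_simps add_divide_distrib diff_divide_distrib)
  show "Z 0 1 0 2 = w * X 0 1 0 2 + b / 2 * replica_sum X Z 0 1 0 2"
    unfolding X_def Z_def replica_sum_unfold
    by (simp add: cls_def coef_values, insert rel, simp (no_asm_use) add: algebra_simps add_divide_distrib diff_divide_distrib)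
  show "Z 0 1 2 3 = w * X 0 1 2 3 + b / 2 * replica_sum X Z 0 1 2 3"
    unfolding X_def Z_def replica_sum_unfold
    by (simp add: cls_def coef_values, insert rel, simp (no_asm_use) add: algebra_simps add_divide_distrib diff_divide_distrib)
  show "Z 0 0 0 0 = w * X 0 0 0 0 + b / 2 * replica_sum X Z 0 0 0 0"
    unfolding X_def Z_def replica_sum_unfold
    by (simp add: cls_def coef_values, insert rel, simp (no_asm_use) add: algebra_simps add_divide_distrib diff_divide_distrib)
  show "Z 0 0 1 1 = w * X 0 0 1 1 + b / 2 * replica_sum X Z 0 0 1 1"
    unfolding X_def Z_def replica_sum_unfold
    by (simp add: cls_def coef_values, insert rel, simp (no_asm_use) add: algebra_simps add_divide_distrib diff_divide_distrib)
  show "Z 0 0 0 1 = w * X 0 0 0 1 + b / 2 * replica_sum X Z 0 0 0 1"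
    unfolding X_def Z_def replica_sum_unfold
    by (simp add: cls_def coef_values, insert rel, simp (no_asm_use) add: algebra_simps add_divide_distrib diff_divide_distrib)
  show "Z 0 0 1 2 = w * X 0 0 1 2 + b / 2 * replica_sum X Z 0 0 1 2"
    unfolding X_def Z_def replica_sum_unfold
    by (simp add: cls_def coef_values, insert rel, simp (no_asm_use) add: algebra_simps add_divide_distrib diff_divide_distrib)
qed

section \<open>The second moments of T and S\<close>

lemma cls_diff_le:
  assumes "\<bar>x2 - y2\<bar> \<le> \<Delta>" "\<bar>x1 - y1\<bar> \<le> \<Delta>" "\<bar>x0 - y0\<bar> \<le> \<Delta>" "\<bar>u1 - v1\<bar> \<le> \<Delta>" "\<bar>u0 - v0\<bar> \<le> \<Delta>"
    "\<bar>w1 - z1\<bar> \<le> \<Delta>" "\<bar>w0 - z0\<bar> \<le> \<Delta>"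
  shows "\<bar>cls x2 x1 x0 u1 u0 w1 w0 a b c d - cls y2 y1 y0 v1 v0 z1 z0 a b c d\<bar> \<le> \<Delta>"
  by (cases "a = b"; cases "c = d"; cases "a = c"; cases "a = d"; cases "b = c"; cases "b = d"; simp add: cls_def assms)

lemma prod_first_four:
  fixes f :: "nat \<Rightarrow> real"
  assumes "\<And>a. 4 \<le> a \<Longrightarrow> f a = 1" shows "(\<Prod>a<10. f a) = f 0 * f 1 * f 2 * f 3"
proof -
  have "(\<Prod>a<10. f a) = (\<Prod>a<4. f a)" by (rule prod.mono_neutral_right) (auto intro: assms)
  then show ?thesis by (simp add: eval_nat_numeral lessThan_Suc mult_ac)
qed

lemma rep_four:
  assumes p: "prb \<Omega> p"
  shows "rep \<Omega> p 10 (\<lambda>s. f0 (s 0) * f1 (s 1) * f2 (s 2) * f3 (s 3))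
    = (\<Sum>\<sigma>\<in>\<Omega>. p \<sigma> * f0 \<sigma>) * (\<Sum>\<sigma>\<in>\<Omega>. p \<sigma> * f1 \<sigma>) * (\<Sum>\<sigma>\<in>\<Omega>. p \<sigma> * f2 \<sigma>) * (\<Sum>\<sigma>\<in>\<Omega>. p \<sigma> * f3 \<sigma>)"
proof -
  define \<phi> where "\<phi> a = (if a = 0 then f0 else if a = 1 then f1 else if a = 2 then f2 else if a = 3 then f3 else (\<lambda>_. 1))" for a :: nat
  have "rep \<Omega> p 10 (\<lambda>s. \<Prod>a<10. \<phi> a (s a)) = (\<Prod>a<10. \<Sum>\<sigma>\<in>\<Omega>. p \<sigma> * \<phi> a \<sigma>)"
    using p by (intro rep_prod) (simp add: prb_def)
  then show ?thesis
    using p prod_first_four[of "\<lambda>a. \<phi> a (s a)" for s] prod_first_four[of "\<lambda>a. \<Sum>\<sigma>\<in>\<Omega>. p \<sigma> * \<phi> a \<sigma>"]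
    by (simp add: \<phi>_def prb_def)
qed

text \<open>Bilinearity: if each product of two summands factors under the replica average, so do
  the centered normalised sums.\<close>

lemma rep_centered_mult:
  assumes p: "prb \<Omega> p" and uv: "\<And>j k. rep \<Omega> p n (\<lambda>s. u j s * v k s) = rep \<Omega> p n (u j) * rep \<Omega> p n (v k)"
  shows "rep \<Omega> p n (\<lambda>s. ((\<Sum>j\<in>J. u j s) / c - x) * ((\<Sum>k\<in>J. v k s) / c - y))
    = rep \<Omega> p n (\<lambda>s. (\<Sum>j\<in>J. u j s) / c - x) * rep \<Omega> p n (\<lambda>s. (\<Sum>k\<in>J. v k s) / c - y)"
proof -
  let ?R = "rep \<Omega> p n"
  have R: "?R (\<lambda>s. (\<Sum>j\<in>J. u j s) / c - x) = (\<Sum>j\<in>J. ?R (u j)) / c - x" for u x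
    using rep_cmult[of \<Omega> p n "1 / c" "\<lambda>s. \<Sum>j\<in>J. u j s"] by (simp add: rep_diff rep_const[OF p] rep_sum)
  have "?R (\<lambda>s. ((\<Sum>j\<in>J. u j s) / c - x) * ((\<Sum>k\<in>J. v k s) / c - y))
      = ?R (\<lambda>s. (1 / (c * c)) * (\<Sum>j\<in>J. \<Sum>k\<in>J. u j s * v k s) - (y / c) * (\<Sum>j\<in>J. u j s) - (x / c) * (\<Sum>k\<in>J. v k s) + x * y)"
    by (intro rep_cong refl) (simp add: sum_product[symmetric] algebra_simps)
  also have "\<dots> = (1 / (c * c)) * (\<Sum>j\<in>J. \<Sum>k\<in>J. ?R (u j) * ?R (v k)) - (y / c) * (\<Sum>j\<in>J. ?R (u j)) - (x / c) * (\<Sum>k\<in>J. ?R (v k)) + x * y"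
    unfolding rep_add rep_diff rep_cmult rep_sum rep_const[OF p] uv ..
  also have "\<dots> = ((\<Sum>j\<in>J. ?R (u j)) / c - x) * ((\<Sum>k\<in>J. ?R (v k)) / c - y)"
    by (simp add: sum_product[symmetric] algebra_simps)
  finally show ?thesis unfolding R .
qed

lemma gibbs_eq: "gibbs S N \<beta> h D g f = (\<Sum>\<sigma>\<in>config S N. gibbs_weight S N \<beta> h D g \<sigma> * f \<sigma>)"
  unfolding gibbs_def gibbs_weight_def softmax_def by (simp add: sum_divide_distrib mult.commute)

lemma gibbs_weight_prb: "prb (config S N) (gibbs_weight S N \<beta> h D g)"
  unfolding gibbs_weight_def by (rule softmax_prb[OF finite_config config_nonempty])

context
  fixes S N :: nat and \<beta> h D p q :: real and g :: "nat \<times> nat \<Rightarrow> real"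
begin

abbreviation "R \<equiv> rep (config S N) (gibbs_weight S N \<beta> h D g) 10"
abbreviation "gb \<equiv> gibbs S N \<beta> h D g"

lemmas R_four = rep_four[OF gibbs_weight_prb[of S N \<beta> h D g], folded gibbs_eq]

lemma gibbs_one: "gb (\<lambda>_. 1) = 1"
  unfolding gibbs_eq using gibbs_weight_prb[of S N \<beta> h D g] by (simp add: prb_def)

lemma R_spin_pairs:
  "R (\<lambda>s. s 0 j * s 1 j) = (gb (\<lambda>\<sigma>. \<sigma> j))\<^sup>2" "R (\<lambda>s. s 2 j * s 3 j) = (gb (\<lambda>\<sigma>. \<sigma> j))\<^sup>2"
  "R (\<lambda>s. s 1 j * s 2 j) = (gb (\<lambda>\<sigma>. \<sigma> j))\<^sup>2"
  "R (\<lambda>s. s 0 j * s 0 j) = gb (\<lambda>\<sigma>. (\<sigma> j)\<^sup>2)" "R (\<lambda>s. s 1 j * s 1 j) = gb (\<lambda>\<sigma>. (\<sigma> j)\<^sup>2)"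
  using R_four[of "\<lambda>\<sigma>. \<sigma> j" "\<lambda>\<sigma>. \<sigma> j" "\<lambda>_. 1" "\<lambda>_. 1"] R_four[of "\<lambda>_. 1" "\<lambda>_. 1" "\<lambda>\<sigma>. \<sigma> j" "\<lambda>\<sigma>. \<sigma> j"]
    R_four[of "\<lambda>_. 1" "\<lambda>\<sigma>. \<sigma> j" "\<lambda>\<sigma>. \<sigma> j" "\<lambda>_. 1"] R_four[of "\<lambda>\<sigma>. (\<sigma> j)\<^sup>2" "\<lambda>_. 1" "\<lambda>_. 1" "\<lambda>_. 1"]
    R_four[of "\<lambda>_. 1" "\<lambda>\<sigma>. (\<sigma> j)\<^sup>2" "\<lambda>_. 1" "\<lambda>_. 1"]
  by (simp_all add: gibbs_one power2_eq_square)

lemma R_spin_quadruples: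
  "R (\<lambda>s. (s 0 j * s 1 j) * (s 2 k * s 3 k)) = R (\<lambda>s. s 0 j * s 1 j) * R (\<lambda>s. s 2 k * s 3 k)"
  "R (\<lambda>s. (s 0 j * s 0 j) * (s 1 k * s 1 k)) = R (\<lambda>s. s 0 j * s 0 j) * R (\<lambda>s. s 1 k * s 1 k)"
  "R (\<lambda>s. (s 0 j * s 0 j) * (s 1 k * s 2 k)) = R (\<lambda>s. s 0 j * s 0 j) * R (\<lambda>s. s 1 k * s 2 k)"
  unfolding R_spin_pairs
  using R_four[of "\<lambda>\<sigma>. \<sigma> j" "\<lambda>\<sigma>. \<sigma> j" "\<lambda>\<sigma>. \<sigma> k" "\<lambda>\<sigma>. \<sigma> k"] R_four[of "\<lambda>\<sigma>. (\<sigma> j)\<^sup>2" "\<lambda>\<sigma>. (\<sigma> k)\<^sup>2" "\<lambda>_. 1" "\<lambda>_. 1"]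
    R_four[of "\<lambda>\<sigma>. (\<sigma> j)\<^sup>2" "\<lambda>\<sigma>. \<sigma> k" "\<lambda>\<sigma>. \<sigma> k" "\<lambda>_. 1"]
  by (simp_all add: gibbs_one power2_eq_square mult_ac)

lemma R_centered: "R (\<lambda>s. (\<Sum>j<N. u j s) / real N - x) = (\<Sum>j<N. R (u j)) / real N - x"
  using rep_cmult[of "config S N" "gibbs_weight S N \<beta> h D g" 10 "1 / real N" "\<lambda>s. \<Sum>j<N. u j s"]
  by (simp add: rep_diff rep_const[OF gibbs_weight_prb] rep_sum)

text \<open>Disjoint replicas are independent for fixed disorder, so the average of the product is
  the product of the averages. An overlap of two distinct replicas averages to \<open>T\<close>, a
  self-overlap to \<open>S\<close>.\<close>

lemma R_ovl_products:
  "R (\<lambda>s. ovl N p q 0 1 s * ovl N p q 2 3 s) = (Tq S N \<beta> h D q g)\<^sup>2"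
  "R (\<lambda>s. ovl N p q 0 0 s * ovl N p q 1 1 s) = (Sp S N \<beta> h D p g)\<^sup>2"
  "R (\<lambda>s. ovl N p q 0 0 s * ovl N p q 1 2 s) = Sp S N \<beta> h D p g * Tq S N \<beta> h D q g"
  unfolding ovl_def
    rep_centered_mult[OF gibbs_weight_prb, where u="\<lambda>j s. s 0 j * s 1 j" and v="\<lambda>j s. s 2 j * s 3 j", OF R_spin_quadruples(1)]
    rep_centered_mult[OF gibbs_weight_prb, where u="\<lambda>j s. s 0 j * s 0 j" and v="\<lambda>j s. s 1 j * s 1 j", OF R_spin_quadruples(2)]
    rep_centered_mult[OF gibbs_weight_prb, where u="\<lambda>j s. s 0 j * s 0 j" and v="\<lambda>j s. s 1 j * s 2 j", OF R_spin_quadruples(3)]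
    R_centered R_spin_pairs
  by (simp_all add: Qv_def Tq_def Sp_def power2_eq_square)

end

context model
begin

lemma ovl_cov_eq_nu:
  "ovl_cov 0 1 2 3 = nu N (\<lambda>g. (Tq S N \<beta> h D q g)\<^sup>2)"
  "ovl_cov 0 0 1 1 = nu N (\<lambda>g. (Sp S N \<beta> h D p g)\<^sup>2)"
  "ovl_cov 0 0 1 2 = nu N (\<lambda>g. Sp S N \<beta> h D p g * Tq S N \<beta> h D q g)"
  unfolding ovl_cov_def nu_rep_def R_ovl_products by (rule refl)+

abbreviation "mm j \<equiv> mom S \<beta> h D p q j"
abbreviation "SG \<equiv> site_cov S \<beta> h D p q"

lemma site_cov_moments:
  "SG 0 1 0 1 = Eeta (\<lambda>\<eta>. (mm 2 \<eta>)\<^sup>2) - q\<^sup>2"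
  "SG 0 1 0 2 = Eeta (\<lambda>\<eta>. (mm 1 \<eta>)\<^sup>2 * mm 2 \<eta>) - q\<^sup>2"
  "SG 0 1 2 3 = Eeta (\<lambda>\<eta>. mm 1 \<eta> ^ 4) - q\<^sup>2"
  "SG 0 0 0 0 = Eeta (mm 4) - p\<^sup>2"
  "SG 0 0 1 1 = Eeta (\<lambda>\<eta>. (mm 2 \<eta>)\<^sup>2) - p\<^sup>2"
  "SG 0 0 0 1 = Eeta (\<lambda>\<eta>. mm 1 \<eta> * mm 3 \<eta>) - p * q"
  "SG 0 0 1 2 = Eeta (\<lambda>\<eta>. (mm 1 \<eta>)\<^sup>2 * mm 2 \<eta>) - p * q"
  using siteE_monomial4[of S \<beta> h D p q 2 2 0 0] siteE_monomial4[of S \<beta> h D p q 2 1 1 0]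
    siteE_monomial4[of S \<beta> h D p q 1 1 1 1] siteE_monomial4[of S \<beta> h D p q 4 0 0 0]
    siteE_monomial4[of S \<beta> h D p q 3 1 0 0]
  by (simp_all add: site_cov_eq Qv_def mom_0 power2_eq_square power3_eq_cube power4_eq_xxxx mult_ac)

lemma Eeta_constants:
  "cA S \<beta> h D p q = Eeta (\<lambda>\<eta>. (mm 2 \<eta>)\<^sup>2) - 2 * Eeta (\<lambda>\<eta>. (mm 1 \<eta>)\<^sup>2 * mm 2 \<eta>) + Eeta (\<lambda>\<eta>. mm 1 \<eta> ^ 4)"
  "cD S \<beta> h D p q = Eeta (mm 4) - Eeta (\<lambda>\<eta>. (mm 2 \<eta>)\<^sup>2)"
  "cF S \<beta> h D p q = Eeta (\<lambda>\<eta>. (mm 2 \<eta>)\<^sup>2) - Eeta (\<lambda>\<eta>. (mm 1 \<eta>)\<^sup>2 * mm 2 \<eta>)"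
  "cG S \<beta> h D p q = Eeta (\<lambda>\<eta>. (mm 1 \<eta>)\<^sup>2 * mm 2 \<eta>) - Eeta (\<lambda>\<eta>. mm 1 \<eta> ^ 4)"
  "cE S \<beta> h D p q = Eeta (\<lambda>\<eta>. mm 1 \<eta> * mm 3 \<eta>) - Eeta (\<lambda>\<eta>. (mm 1 \<eta>)\<^sup>2 * mm 2 \<eta>)"
proof -
  have "cA S \<beta> h D p q = Eeta (\<lambda>\<eta>. (mm 2 \<eta>)\<^sup>2 - 2 * ((mm 1 \<eta>)\<^sup>2 * mm 2 \<eta>) + mm 1 \<eta> ^ 4)"
    unfolding cA_def m_def by (intro arg_cong[where f=Eeta]) (simp add: fun_eq_iff power2_eq_square power4_eq_xxxx algebra_simps)
  also have "\<dots> = Eeta (\<lambda>\<eta>. (mm 2 \<eta>)\<^sup>2) - 2 * Eeta (\<lambda>\<eta>. (mm 1 \<eta>)\<^sup>2 * mm 2 \<eta>) + Eeta (\<lambda>\<eta>. mm 1 \<eta> ^ 4)"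
  proof -
    have "Eeta (\<lambda>\<eta>. (mm 2 \<eta>)\<^sup>2 - 2 * ((mm 1 \<eta>)\<^sup>2 * mm 2 \<eta>) + mm 1 \<eta> ^ 4)
        = Eeta (\<lambda>\<eta>. (mm 2 \<eta>)\<^sup>2 - 2 * ((mm 1 \<eta>)\<^sup>2 * mm 2 \<eta>)) + Eeta (\<lambda>\<eta>. mm 1 \<eta> ^ 4)"
      by (intro Eeta_add bounded_borel_intros)
    moreover have "Eeta (\<lambda>\<eta>. (mm 2 \<eta>)\<^sup>2 - 2 * ((mm 1 \<eta>)\<^sup>2 * mm 2 \<eta>))
        = Eeta (\<lambda>\<eta>. (mm 2 \<eta>)\<^sup>2) - Eeta (\<lambda>\<eta>. 2 * ((mm 1 \<eta>)\<^sup>2 * mm 2 \<eta>))"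
      by (intro Eeta_diff bounded_borel_intros)
    moreover have "Eeta (\<lambda>\<eta>. 2 * ((mm 1 \<eta>)\<^sup>2 * mm 2 \<eta>)) = 2 * Eeta (\<lambda>\<eta>. (mm 1 \<eta>)\<^sup>2 * mm 2 \<eta>)"
      by (intro Eeta_cmult bounded_borel_intros)
    ultimately show ?thesis by simp
  qed
  finally show "cA S \<beta> h D p q = \<dots>" .
  show "cD S \<beta> h D p q = Eeta (mm 4) - Eeta (\<lambda>\<eta>. (mm 2 \<eta>)\<^sup>2)"
    unfolding cD_def m_def by (intro Eeta_diff bounded_borel_intros)
  show "cF S \<beta> h D p q = Eeta (\<lambda>\<eta>. (mm 2 \<eta>)\<^sup>2) - Eeta (\<lambda>\<eta>. (mm 1 \<eta>)\<^sup>2 * mm 2 \<eta>)"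
    unfolding cF_def m_def by (intro Eeta_diff bounded_borel_intros)
  have "cG S \<beta> h D p q = Eeta (\<lambda>\<eta>. (mm 1 \<eta>)\<^sup>2 * mm 2 \<eta> - mm 1 \<eta> ^ 4)"
    unfolding cG_def m_def by (intro arg_cong[where f=Eeta]) (simp add: fun_eq_iff power2_eq_square power4_eq_xxxx algebra_simps)
  also have "\<dots> = Eeta (\<lambda>\<eta>. (mm 1 \<eta>)\<^sup>2 * mm 2 \<eta>) - Eeta (\<lambda>\<eta>. mm 1 \<eta> ^ 4)" by (intro Eeta_diff bounded_borel_intros)
  finally show "cG S \<beta> h D p q = \<dots>" .
  have "cE S \<beta> h D p q = Eeta (\<lambda>\<eta>. mm 1 \<eta> * mm 3 \<eta> - (mm 1 \<eta>)\<^sup>2 * mm 2 \<eta>)"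
    unfolding cE_def m_def by (intro arg_cong[where f=Eeta]) (simp add: fun_eq_iff power2_eq_square algebra_simps)
  also have "\<dots> = Eeta (\<lambda>\<eta>. mm 1 \<eta> * mm 3 \<eta>) - Eeta (\<lambda>\<eta>. (mm 1 \<eta>)\<^sup>2 * mm 2 \<eta>)" by (intro Eeta_diff bounded_borel_intros)
  finally show "cE S \<beta> h D p q = \<dots>" .
qed

text \<open>Going from a shared pair to one shared replica and then to none removes A + G and then
  G; for self-overlaps and mixed pairs, losing the shared replica removes D and E.\<close>

lemma site_cov_constants:
  "SG 0 1 0 1 = cA S \<beta> h D p q + 2 * cG S \<beta> h D p q + I3 S \<beta> h D p q"
  "SG 0 1 0 2 = cG S \<beta> h D p q + I3 S \<beta> h D p q"
  "SG 0 1 2 3 = I3 S \<beta> h D p q"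
  "SG 0 0 0 0 = cD S \<beta> h D p q + K4 S \<beta> h D p q"
  "SG 0 0 1 1 = K4 S \<beta> h D p q"
  "SG 0 0 0 1 = cE S \<beta> h D p q + I5 S \<beta> h D p q"
  "SG 0 0 1 2 = I5 S \<beta> h D p q"
  unfolding site_cov_moments Eeta_constants I3_def I5_def K4_def m_def by simp_all

text \<open>Each constant is a combination of the one-site covariances, which are bounded by
  \<open>SG_le\<close>.\<close>

lemma constants_le:
  "\<bar>cA S \<beta> h D p q\<bar> \<le> 8 * B\<^sup>2" "\<bar>cG S \<beta> h D p q\<bar> \<le> 4 * B\<^sup>2"
  "\<bar>cD S \<beta> h D p q\<bar> \<le> 4 * B\<^sup>2" "\<bar>cE S \<beta> h D p q\<bar> \<le> 4 * B\<^sup>2"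
  using c.SG_le[of 0 1 0 1] c.SG_le[of 0 1 0 2] c.SG_le[of 0 1 2 3] c.SG_le[of 0 0 0 0] c.SG_le[of 0 0 1 1]
    c.SG_le[of 0 0 0 1] c.SG_le[of 0 0 1 2]
  unfolding site_cov_constants by (simp_all add: abs_le_iff)

lemma \<beta>2_mult_le: "\<bar>x\<bar> \<le> y * B\<^sup>2 \<Longrightarrow> 0 \<le> y \<Longrightarrow> \<bar>\<beta>\<^sup>2 * x\<bar> \<le> y / 1000000"
proof -
  assume x: "\<bar>x\<bar> \<le> y * B\<^sup>2" and y: "0 \<le> y"
  have "\<bar>\<beta>\<^sup>2 * x\<bar> \<le> \<beta>\<^sup>2 * (y * B\<^sup>2)" unfolding abs_mult using x by (simp add: mult_left_mono)
  also have "\<dots> = y * (\<beta>\<^sup>2 * B\<^sup>2)" by simp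
  also have "\<dots> \<le> y * (1 / 1000000)" using \<beta>B y by (rule mult_left_mono)
  finally show ?thesis by simp
qed

text \<open>Both forms rest on F = A + G, which follows from \<open>Eeta_constants\<close>.\<close>

lemma M1_eq: "M1 S \<beta> h D p q = 1 - \<beta>\<^sup>2 * (cA S \<beta> h D p q - 2 * cG S \<beta> h D p q)"
  and M3_eq: "M3 S \<beta> h D p q = 1 - \<beta>\<^sup>2 * cA S \<beta> h D p q"
  unfolding M1_def M3_def Eeta_constants by (simp_all add: algebra_simps)

text \<open>For this size of beta^2 B^2 the factors M1, M2 and M3 are close to 1, and the remaining
  term of MM is a nonnegative square.\<close>

lemma denominators: "M3 S \<beta> h D p q \<noteq> 0" "MM S \<beta> h D p q \<noteq> 0"
proof -
  show "M3 S \<beta> h D p q \<noteq> 0"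
    using \<beta>2_mult_le[OF constants_le(1)] unfolding M3_eq by auto
  have "\<bar>cA S \<beta> h D p q - 2 * cG S \<beta> h D p q\<bar> \<le> 16 * B\<^sup>2"
    using constants_le(1,2) by linarith
  from \<beta>2_mult_le[OF this] have "1 / 2 \<le> M1 S \<beta> h D p q" unfolding M1_eq by (simp add: abs_le_iff)
  moreover from \<beta>2_mult_le[OF constants_le(3)] have "1 / 2 \<le> M2 S \<beta> h D p q"
    unfolding M2_def by (simp add: abs_le_iff)
  ultimately have "0 < M1 S \<beta> h D p q * M2 S \<beta> h D p q" by simp
  then show "MM S \<beta> h D p q \<noteq> 0"
    unfolding MM_def by (intro less_imp_neq[symmetric] add_pos_nonneg) auto
qed

section \<open>Comparison of the covariances with the exact solution\<close>

text \<open>Defined for each fixed \<open>N\<close> and proportional to 1/N: the array that will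
  solve the system without error, assembled from the variances in the statement.\<close>

definition ovl_cov_limit :: "nat \<Rightarrow> nat \<Rightarrow> nat \<Rightarrow> nat \<Rightarrow> real" where
  "ovl_cov_limit = cls (A2sq S \<beta> h D p q N + 2 * A1sq S \<beta> h D p q N + A0sq S \<beta> h D p q N)
     (A1sq S \<beta> h D p q N + A0sq S \<beta> h D p q N) (A0sq S \<beta> h D p q N)
     (B1sq S \<beta> h D p q N + B0sq S \<beta> h D p q N) (B0sq S \<beta> h D p q N)
     (C1sq S \<beta> h D p q N + C0sq S \<beta> h D p q N) (C0sq S \<beta> h D p q N)"

lemma SG_cls:
  assumes "a < 10" "b < 10" "c < 10" "d < 10"
  shows "SG a b c d = cls (cA S \<beta> h D p q + 2 * cG S \<beta> h D p q + I3 S \<beta> h D p q)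
     (cG S \<beta> h D p q + I3 S \<beta> h D p q) (I3 S \<beta> h D p q) (cD S \<beta> h D p q + K4 S \<beta> h D p q) (K4 S \<beta> h D p q)
     (cE S \<beta> h D p q + I5 S \<beta> h D p q) (I5 S \<beta> h D p q) a b c d"
  using site_cov_cls[OF assms] unfolding Let_def site_cov_constants .

lemma ovl_cov_limit_system:
  assumes "(a, b, c, d) \<in> {(0, 1, 0, 1), (0, 1, 0, 2), (0, 1, 2, 3), (0, 0, 0, 0), (0, 0, 1, 1), (0, 0, 0, 1), (0, 0, 1, 2)}"
  shows "ovl_cov_limit a b c d = SG a b c d / real N + \<beta>\<^sup>2 / 2 * replica_sum SG ovl_cov_limit a b c d"
proof -
  let ?A = "cA S \<beta> h D p q" and ?G = "cG S \<beta> h D p q" and ?J3 = "I3 S \<beta> h D p q" and ?D = "cD S \<beta> h D p q"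
    and ?K = "K4 S \<beta> h D p q" and ?E = "cE S \<beta> h D p q" and ?J5 = "I5 S \<beta> h D p q"
    and ?n1 = "M1 S \<beta> h D p q" and ?n2 = "M2 S \<beta> h D p q" and ?n3 = "M3 S \<beta> h D p q" and ?mm = "MM S \<beta> h D p q"
  let ?w = "1 / real N" and ?a2 = "A2sq S \<beta> h D p q N" and ?a1 = "A1sq S \<beta> h D p q N" and ?a0 = "A0sq S \<beta> h D p q N"
    and ?b1 = "B1sq S \<beta> h D p q N" and ?b0 = "B0sq S \<beta> h D p q N" and ?c1 = "C1sq S \<beta> h D p q N" and ?c0 = "C0sq S \<beta> h D p q N"
  have b4: "(\<beta>\<^sup>2)\<^sup>2 = \<beta> ^ 4" by simp
  have MM: "?mm = ?n1 * ?n2 + (\<beta>\<^sup>2)\<^sup>2 * ?E\<^sup>2" unfolding b4 by (rule MM_def)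
  have a2: "?a2 = ?w * ?A / ?n3" unfolding A2sq_def M3_eq by simp
  have a1: "?a1 = ?w * (?G * ?n2 + \<beta>\<^sup>2 / 2 * ?E\<^sup>2) / (?mm * ?n3)" unfolding A1sq_def by (simp add: mult.assoc)
  have b1: "?b1 = ?w * (?D * ?n1 - 2 * \<beta>\<^sup>2 * ?E\<^sup>2) / ?mm" unfolding B1sq_def by simp
  have c1: "?c1 = ?w * ?E / ?mm" unfolding C1sq_def by simp
  have a0: "?a0 = (\<beta>\<^sup>2 * (\<beta>\<^sup>2 * ?E * ?K + ?n2 * ?J5) * ?c1 + 2 * \<beta>\<^sup>2 * (\<beta>\<^sup>2 * ?E * (?E - ?J5) + ?n2 * (2 * ?G - ?J3)) * ?a1
        + \<beta>\<^sup>2 * (\<beta>\<^sup>2 * ?E * ?J5 + ?n2 * ?J3) * ?a2 + ?w * (\<beta>\<^sup>2 * ?E * ?J5 + ?n2 * ?J3)) / ?mm"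
    unfolding A0sq_def by (simp add: add_divide_distrib mult.commute[of _ "real N"])
  have b0: "?b0 = (\<beta>\<^sup>2 / 2 * (?n1 * ?K - \<beta>\<^sup>2 * ?E * ?J5) * ?b1 + \<beta>\<^sup>2 * (?n1 * (?E - ?J5) - \<beta>\<^sup>2 * ?E * (2 * ?G - ?J3)) * ?c1
        + ?w * (?n1 * ?K - \<beta>\<^sup>2 * ?E * ?J5)) / ?mm"
    unfolding B0sq_def by (simp add: add_divide_distrib mult.commute[of _ "real N"])
  have c0: "?c0 = (\<beta>\<^sup>2 / 2 * (?n2 * ?J5 + \<beta>\<^sup>2 * ?E * ?K) * ?b1 + \<beta>\<^sup>2 * (?n2 * (2 * ?G - ?J3) + \<beta>\<^sup>2 * ?E * (?E - ?J5)) * ?c1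
        + ?w * (?n2 * ?J5 + \<beta>\<^sup>2 * ?E * ?K)) / ?mm"
    unfolding C0sq_def by (simp add: add_divide_distrib mult.commute[of _ "real N"])
  note rel = fluctuation_relations[OF M1_eq M2_def M3_eq MM denominators(2,1) a2 a1 b1 c1 a0 b0 c0]
  note sys = exact_system[OF rel[unfolded M1_eq M2_def], folded ovl_cov_limit_def]
  have sum: "replica_sum SG ovl_cov_limit a b c d = replica_sum (cls (?A + 2 * ?G + ?J3) (?G + ?J3) ?J3 (?D + ?K) ?K (?E + ?J5) ?J5) ovl_cov_limit a b c d"
    if "a < 10" "b < 10" for a b c d
    unfolding replica_sum_def using that by (intro sum.cong refl) (simp add: SG_cls)
  have lt: "a < 10" "b < 10" "c < 10" "d < 10" using assms by auto
  show ?thesis unfolding SG_cls[OF lt] sum[OF lt(1,2)] using assms sys by auto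
qed

text \<open>The sums of the system reach replicas 4 and 5, beyond the representatives; replica
  symmetry carries the bound from seven entries to all of them.\<close>

lemma ovl_cov_diff_le:
  assumes "\<And>a b c d. (a, b, c, d) \<in> {(0, 1, 0, 1), (0, 1, 0, 2), (0, 1, 2, 3), (0, 0, 0, 0), (0, 0, 1, 1), (0, 0, 0, 1), (0, 0, 1, 2)}
      \<Longrightarrow> \<bar>ovl_cov a b c d - ovl_cov_limit a b c d\<bar> \<le> \<Delta>"
    and "a < 10" "b < 10" "c < 10" "d < 10"
  shows "\<bar>ovl_cov a b c d - ovl_cov_limit a b c d\<bar> \<le> \<Delta>"
proof -
  have Z: "ovl_cov_limit a b c d = cls (ovl_cov_limit 0 1 0 1) (ovl_cov_limit 0 1 0 2) (ovl_cov_limit 0 1 2 3)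
      (ovl_cov_limit 0 0 0 0) (ovl_cov_limit 0 0 1 1) (ovl_cov_limit 0 0 0 1) (ovl_cov_limit 0 0 1 2) a b c d"
    unfolding ovl_cov_limit_def by (simp add: cls_def)
  show ?thesis
    unfolding ovl_cov_cls[OF assms(2-)] Z by (intro cls_diff_le assms(1)) simp_all
qed

text \<open>Contraction: both arrays satisfy the same linear system, one up to \<open>err\<close>
  and the other exactly. If \<open>\<Delta>\<close> is the largest deviation among the seven
  entries, then subtraction gives \<Delta> <= err + \<Delta>/2.\<close>

lemma ovl_cov_asymptotics:
  assumes "a < 10" "b < 10" "c < 10" "d < 10"
  shows "\<bar>ovl_cov a b c d - ovl_cov_limit a b c d\<bar> \<le> 2 * err_const S * (1 / sqrt (real N)) ^ 3"
proof -
  define I :: "(nat \<times> nat \<times> nat \<times> nat) set"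
    where "I = {(0, 1, 0, 1), (0, 1, 0, 2), (0, 1, 2, 3), (0, 0, 0, 0), (0, 0, 1, 1), (0, 0, 0, 1), (0, 0, 1, 2)}"
  define err where "err = err_const S * (1 / sqrt (real N)) ^ 3"
  define f where "f = (\<lambda>(a, b, c, d). \<bar>ovl_cov a b c d - ovl_cov_limit a b c d\<bar>)"
  define \<Delta> where "\<Delta> = Max (f ` I)"
  have I: "finite I" "I \<noteq> {}" by (auto simp: I_def)
  have le: "\<bar>ovl_cov a b c d - ovl_cov_limit a b c d\<bar> \<le> \<Delta>" if "(a, b, c, d) \<in> I" for a b c d
  proof -
    have "f (a, b, c, d) \<le> \<Delta>" unfolding \<Delta>_def using I(1) that by (intro Max_ge finite_imageI imageI)
    then show ?thesis by (simp only: f_def prod.case)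
  qed
  have all: "\<bar>ovl_cov a b c d - ovl_cov_limit a b c d\<bar> \<le> \<Delta>" if "a < 10" "b < 10" "c < 10" "d < 10" for a b c d
    by (rule ovl_cov_diff_le[folded I_def]) (use le that in blast)+
  have \<Delta>0: "0 \<le> \<Delta>" by (rule order_trans[OF abs_ge_zero all[of 0 1 0 1]]) simp_all
  have step: "\<bar>ovl_cov a b c d - ovl_cov_limit a b c d\<bar> \<le> err + \<Delta> / 2" if abcd: "(a, b, c, d) \<in> I" for a b c d
  proof -
    have lt: "a < 4" "b < 4" "c < 4" "d < 4" using abcd by (auto simp: I_def)
    have diff: "replica_sum SG ovl_cov a b c d - replica_sum SG ovl_cov_limit a b c d
        = (\<Sum>e<Suc 4. \<Sum>f<Suc (Suc 4). coef 4 e * coef (Suc 4) f * (SG a b e f * (ovl_cov e f c d - ovl_cov_limit e f c d)))"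
    proof -
      have "{..<5::nat} = {..<Suc 4}" "{..<6::nat} = {..<Suc (Suc 4)}" "(5::nat) = Suc 4" by auto
      then show ?thesis unfolding replica_sum_def by (simp only: right_diff_distrib sum_subtractf)
    qed
    have "\<bar>replica_sum SG ovl_cov a b c d - replica_sum SG ovl_cov_limit a b c d\<bar>
        \<le> (\<Sum>e<Suc 4. \<Sum>f<Suc (Suc 4). \<bar>coef 4 e\<bar> * \<bar>coef (Suc 4) f\<bar> * (2 * B\<^sup>2 * \<Delta>))"
      unfolding diff
    proof (intro order_trans[OF sum_abs] sum_mono)
      fix e f assume ef: "e \<in> {..<Suc 4}" "f \<in> {..<Suc (Suc 4)}"
      have "\<bar>SG a b e f * (ovl_cov e f c d - ovl_cov_limit e f c d)\<bar> \<le> 2 * B\<^sup>2 * \<Delta>"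
        using lt ef by (intro abs_mult_le c.SG_le all) auto
      then show "\<bar>coef 4 e * coef (Suc 4) f * (SG a b e f * (ovl_cov e f c d - ovl_cov_limit e f c d))\<bar>
          \<le> \<bar>coef 4 e\<bar> * \<bar>coef (Suc 4) f\<bar> * (2 * B\<^sup>2 * \<Delta>)"
        unfolding abs_mult[of "coef 4 e * coef (Suc 4) f"] abs_mult[of "coef 4 e"] by (intro mult_left_mono) auto
    qed
    also have "\<dots> \<le> 4 * real 4 * (real 4 + 1) * (2 * B\<^sup>2 * \<Delta>)" by (rule c.sum_coef_le) simp
    finally have rs: "\<bar>replica_sum SG ovl_cov a b c d - replica_sum SG ovl_cov_limit a b c d\<bar> \<le> 160 * B\<^sup>2 * \<Delta>" by simp
    have "\<bar>\<beta>\<^sup>2 / 2 * (replica_sum SG ovl_cov a b c d - replica_sum SG ovl_cov_limit a b c d)\<bar> \<le> \<beta>\<^sup>2 / 2 * (160 * B\<^sup>2 * \<Delta>)"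
      using rs by (intro abs_mult_le) auto
    also have "\<dots> = 80 * \<Delta> * (\<beta>\<^sup>2 * B\<^sup>2)" by simp
    \<comment> \<open>The factor 80 is half of 160, the total coefficient weight 4 * 4 * 5 times the
      bound 2 of \<open>SG_le\<close>; smallness of beta^2 B^2 brings it far below 1/2.\<close>
    also have "\<dots> \<le> 80 * \<Delta> * (1 / 1000000)" using \<beta>B \<Delta>0 by (intro mult_left_mono) auto
    also have "\<dots> \<le> \<Delta> / 2" using \<Delta>0 by simp
    finally have 1: "\<bar>\<beta>\<^sup>2 / 2 * (replica_sum SG ovl_cov a b c d - replica_sum SG ovl_cov_limit a b c d)\<bar> \<le> \<Delta> / 2" .
    have 2: "\<bar>ovl_cov a b c d - (SG a b c d / real N + \<beta>\<^sup>2 / 2 * replica_sum SG ovl_cov a b c d)\<bar> \<le> err"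
      using ovl_cov_system[OF lt] unfolding replica_sum_def err_def .
    have "ovl_cov a b c d - ovl_cov_limit a b c d = (ovl_cov a b c d - (SG a b c d / real N + \<beta>\<^sup>2 / 2 * replica_sum SG ovl_cov a b c d))
        + \<beta>\<^sup>2 / 2 * (replica_sum SG ovl_cov a b c d - replica_sum SG ovl_cov_limit a b c d)"
      unfolding ovl_cov_limit_system[folded I_def, OF abcd] by (simp add: right_diff_distrib)
    then show ?thesis using 1 2 by linarith
  qed
  have "\<Delta> \<in> f ` I" unfolding \<Delta>_def using I by (intro Max_in finite_imageI) simp_all
  then obtain a' b' c' d' where "(a', b', c', d') \<in> I" "\<Delta> = f (a', b', c', d')" by force
  with step[of a' b' c' d'] have "\<Delta> \<le> err + \<Delta> / 2" by (simp only: f_def prod.case)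
  then have "\<Delta> \<le> 2 * err" by simp
  with all[OF assms] show ?thesis by (simp add: err_def mult.assoc)
qed

lemma second_moments:
  "\<bar>nu N (\<lambda>g. (Tq S N \<beta> h D q g)\<^sup>2) - A0sq S \<beta> h D p q N\<bar> \<le> 2 * err_const S * (1 / sqrt (real N)) ^ 3"
  "\<bar>nu N (\<lambda>g. (Sp S N \<beta> h D p g)\<^sup>2) - B0sq S \<beta> h D p q N\<bar> \<le> 2 * err_const S * (1 / sqrt (real N)) ^ 3"
  "\<bar>nu N (\<lambda>g. Sp S N \<beta> h D p g * Tq S N \<beta> h D q g) - C0sq S \<beta> h D p q N\<bar> \<le> 2 * err_const S * (1 / sqrt (real N)) ^ 3"
proof -
  have Z: "ovl_cov_limit 0 1 2 3 = A0sq S \<beta> h D p q N" "ovl_cov_limit 0 0 1 1 = B0sq S \<beta> h D p q N" "ovl_cov_limit 0 0 1 2 = C0sq S \<beta> h D p q N"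
    by (simp_all add: ovl_cov_limit_def cls_def)
  show "\<bar>nu N (\<lambda>g. (Tq S N \<beta> h D q g)\<^sup>2) - A0sq S \<beta> h D p q N\<bar> \<le> 2 * err_const S * (1 / sqrt (real N)) ^ 3"
    by (rule ovl_cov_asymptotics[of 0 1 2 3, unfolded ovl_cov_eq_nu Z]) simp_all
  show "\<bar>nu N (\<lambda>g. (Sp S N \<beta> h D p g)\<^sup>2) - B0sq S \<beta> h D p q N\<bar> \<le> 2 * err_const S * (1 / sqrt (real N)) ^ 3"
    by (rule ovl_cov_asymptotics[of 0 0 1 1, unfolded ovl_cov_eq_nu Z]) simp_all
  show "\<bar>nu N (\<lambda>g. Sp S N \<beta> h D p g * Tq S N \<beta> h D q g) - C0sq S \<beta> h D p q N\<bar> \<le> 2 * err_const S * (1 / sqrt (real N)) ^ 3"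
    by (rule ovl_cov_asymptotics[of 0 0 1 2, unfolded ovl_cov_eq_nu Z]) simp_all
qed

end

lemma inverse_sqrt_cube:
  assumes "0 < x" shows "(1 / sqrt x) ^ 3 = x powr (-3/2)"
proof -
  have "1 / sqrt x = x powr (- (1/2))"
    unfolding powr_minus_divide using powr_half_sqrt[of x] assms by simp
  then have "(1 / sqrt x) ^ 3 = (x powr (- (1/2))) ^ 3" by (simp only:)
  also have "\<dots> = x powr (real 3 * (- (1/2)))" using assms by (intro powr_power) simp
  finally show ?thesis by simp
qed

theorem theorem4p17:
  fixes S :: nat and h D :: real
  assumes "S \<ge> 1" and "h \<ge> 0"
  shows "\<exists>\<beta>'>0. \<forall>\<beta>. 0 < \<beta> \<and> \<beta> < \<beta>' \<longrightarrow>
           (\<forall>p q. is_pq S \<beta> h D p q \<longrightarrow>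
             (\<exists>C. \<forall>N\<ge>2.
                \<bar>nu N (\<lambda>g. (Tq S N \<beta> h D q g)\<^sup>2) - A0sq S \<beta> h D p q N\<bar> \<le> C * real N powr (-3/2)
              \<and> \<bar>nu N (\<lambda>g. (Sp S N \<beta> h D p g)\<^sup>2) - B0sq S \<beta> h D p q N\<bar> \<le> C * real N powr (-3/2)
              \<and> \<bar>nu N (\<lambda>g. Sp S N \<beta> h D p g * Tq S N \<beta> h D q g) - C0sq S \<beta> h D p q N\<bar>
                  \<le> C * real N powr (-3/2)))"
proof (rule exI[of _ "1 / (1000 * (real S)\<^sup>2)"], intro conjI allI impI)
  have S: "0 < (real S)\<^sup>2" using assms(1) by simp
  then show "0 < 1 / (1000 * (real S)\<^sup>2)" by simp
  fix \<beta> p q assume \<beta>: "0 < \<beta> \<and> \<beta> < 1 / (1000 * (real S)\<^sup>2)" and pq: "is_pq S \<beta> h D p q"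
  \<comment> \<open>This is the purpose of the witness 1 / (1000 S^2): squared, the bound becomes
    the smallness condition of \<open>model\<close>.\<close>
  have "1000 * (\<beta> * (real S)\<^sup>2) \<le> 1" using \<beta> S by (simp add: field_simps)
  then have "(1000 * (\<beta> * (real S)\<^sup>2))\<^sup>2 \<le> 1\<^sup>2" using \<beta> by (intro power_mono) auto
  then have small: "\<beta>\<^sup>2 * ((real S)\<^sup>2)\<^sup>2 * 1000000 \<le> 1" by (simp add: power_mult_distrib)
  show "\<exists>C. \<forall>N\<ge>2.
      \<bar>nu N (\<lambda>g. (Tq S N \<beta> h D q g)\<^sup>2) - A0sq S \<beta> h D p q N\<bar> \<le> C * real N powr (-3/2)
    \<and> \<bar>nu N (\<lambda>g. (Sp S N \<beta> h D p g)\<^sup>2) - B0sq S \<beta> h D p q N\<bar> \<le> C * real N powr (-3/2)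
    \<and> \<bar>nu N (\<lambda>g. Sp S N \<beta> h D p g * Tq S N \<beta> h D q g) - C0sq S \<beta> h D p q N\<bar> \<le> C * real N powr (-3/2)"
  \<comment> \<open>The constant depends on \<open>S\<close> alone, so it is uniform in
    \<open>\<beta>\<close>, \<open>p\<close> and \<open>q\<close> as well as in
    \<open>N\<close>.\<close>
  proof (rule exI[of _ "2 * err_const S"], intro allI impI)
    fix N :: nat assume N: "2 \<le> N"
    interpret model S N \<beta> h D p q
      using N assms(1) pq small by (simp add: model_def)
    have powr: "(1 / sqrt (real N)) ^ 3 = real N powr (-3/2)" using N by (intro inverse_sqrt_cube) simp
    show "\<bar>nu N (\<lambda>g. (Tq S N \<beta> h D q g)\<^sup>2) - A0sq S \<beta> h D p q N\<bar> \<le> 2 * err_const S * real N powr (-3/2)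
      \<and> \<bar>nu N (\<lambda>g. (Sp S N \<beta> h D p g)\<^sup>2) - B0sq S \<beta> h D p q N\<bar> \<le> 2 * err_const S * real N powr (-3/2)
      \<and> \<bar>nu N (\<lambda>g. Sp S N \<beta> h D p g * Tq S N \<beta> h D q g) - C0sq S \<beta> h D p q N\<bar> \<le> 2 * err_const S * real N powr (-3/2)"
      using second_moments unfolding powr by blast
  qed
qed

end
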